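(* Let $\mathcal P_q(\beta,R,m)$ be the class of distributions defined in the context. There is $c>0$, depending only on $\beta$, $R$ and the constants of Assumptions (A1)--(A6), such that for every $q\in\mathcal Q$, $$\inf_{\widetilde C_n}\ \sup_{P\in\mathcal P_q(\beta,R,m)}\mathbb E_P\bigl\|\widetilde C_n-C\bigr\|_{L^2(E\times E)}^2\ \ge\ c\Bigl[(nm^2)^{-(2\beta+1)/(2\beta+2)}+\frac1n\Bigr],$$ where the infimum is over all estimators $\widetilde C_n$ of $C$ based on the observations of $n$ subjects.
   Context: Model. $E=\mathbb S^1=\mathbb R/\mathbb Z$ with Lebesgue measure. One observes $(T_{ij},Y_{ij})$ with $Y_{ij}=X_i(T_{ij})+\varepsilon_{ij}$, $1\le i\le n$, $1\le j\le N_i$, where the $X_i$ are i.i.d. copies of a centred Gaussian element $X$ of $L^2(E)$ with covariance $C(s,t)=\operatorname{Cov}(X(s),X(t))$, the times $T_{ij}$ are i.i.d. with density $f$ on $E$, the errors $\varepsilon_{ij}$ are i.i.d. centred with variance $\sigma^2$, and the three families are independent. $G_q=\mathbb Z/q\mathbb Z$ acts on $E$ by $t\mapsto t+\ell/q$; $C$ is $G_q$-invariant if $C(s+1/q,t+1/q)=C(s,t)$. $\mathcal Q$ is a finite family $1=q_0<q_1<\dots<q_J$ with $q_j\mid q_{j+1}$. Assumptions. (A1) $C$ is Hölder of order $\beta\in(0,2]$ on $E\times E$ with $\|C\|_{C^\beta}\le R$. (A2) $0<a\le f\le b$. (A3) The counts form a triangular array, i.i.d. in $i$, with $\mathbb E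 N=m_n$, $\mathbb E[N(N-1)]\asymp m_n^2$, $\mathbb E[N^4]\lesssim m_n^4$ uniformly in $n$. (A4) There is $K_0>0$ with $\|X(t)\|_{L^p}\le K_0\sqrt p$ for all $t\in E$, $p\ge1$, and $\|\varepsilon\|_{L^p}\le K_0\sqrt p$. (A5) The design is $G_q$-invariant ($f(\cdot+1/q)=f$) for every $q\in\mathcal Q$. (A6) $K$ is a symmetric Lipschitz kernel supported in $[-1,1]$ with $\int K=1$ (with bandwidths $h<1/4$). Class. For $\beta>0$, $R>0$, $m\ge2$, $q\in\mathcal Q$, $\mathcal P_q(\beta,R,m)$ is the set of joint distributions of $(X,\{T_{ij}\},\{\varepsilon_{ij}\})$ such that (A1)--(A6) hold with $\|C\|_{C^\beta}\le R$ and sampling intensity $\mathbb E N_i\asymp m$, the process $X$ is Gaussian, and $C$ is $G_q$-invariant. $\asymp$ denotes two-sided bounds with constants not depending on $n,m,q$. *)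

theory Defs
  imports "HOL-Probability.Probability"
begin

text \<open>
  \<open>E = \<real>/\<int>\<close>: functions on \<open>E\<close> (and on \<open>E \<times> E\<close>) are represented by their lifts, i.e. by functions
  on \<open>\<real>\<close> that are 1-periodic (in each argument). Integrals over \<open>E\<close> use the fundamental
  domain \<open>[0,1)\<close>; \<open>circle\<close> is Lebesgue measure on it, as a probability measure on the Borel sets of \<open>\<real>\<close>.
\<close>

definition circle :: "real measure" where
  "circle = density lborel (indicator {0..<1})"

definition periodic :: "(real \<Rightarrow> 'b) \<Rightarrow> bool" where
  "periodic g \<longleftrightarrow> (\<forall>t. g (t + 1) = g t)"

definition invariant_density :: "nat \<Rightarrow> (real \<Rightarrow> real) \<Rightarrow> bool" where
  "invariant_density q f \<longleftrightarrow> (\<forall>t. f (t + 1 / real q) = f t)"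

definition invariant_cov :: "nat \<Rightarrow> (real \<times> real \<Rightarrow> real) \<Rightarrow> bool" where
  "invariant_cov q C \<longleftrightarrow> (\<forall>s t. C (s + 1 / real q, t + 1 / real q) = C (s, t))"

definition divisor_chain :: "(nat \<Rightarrow> nat) \<Rightarrow> nat \<Rightarrow> bool" where
  "divisor_chain q J \<longleftrightarrow> q 0 = 1 \<and> (\<forall>j<J. q j < q (Suc j) \<and> q j dvd q (Suc j))"

text \<open>
  For lifts of functions on \<open>E \<times> E\<close> and exponent \<open>\<alpha> \<le> 1\<close> the supremum below, over pairs of points of the
  plane, is the one for the quotient distance, because the latter is the minimum over all lifts.
\<close>

definition sup_norm :: "(real \<times> real \<Rightarrow> real) \<Rightarrow> ennreal" where
  "sup_norm F = (SUP x. ennreal \<bar>F x\<bar>)"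

definition holder_seminorm :: "real \<Rightarrow> (real \<times> real \<Rightarrow> real) \<Rightarrow> ennreal" where
  "holder_seminorm \<alpha> F =
     (SUP (x, y) \<in> {(x, y). x \<noteq> y}. ennreal (\<bar>F x - F y\<bar> / dist x y powr \<alpha>))"

definition partial1 :: "(real \<times> real \<Rightarrow> real) \<Rightarrow> real \<times> real \<Rightarrow> real" where
  "partial1 F = (\<lambda>(s, t). deriv (\<lambda>u. F (u, t)) s)"

definition partial2 :: "(real \<times> real \<Rightarrow> real) \<Rightarrow> real \<times> real \<Rightarrow> real" where
  "partial2 F = (\<lambda>(s, t). deriv (\<lambda>u. F (s, u)) t)"

definition has_partials :: "(real \<times> real \<Rightarrow> real) \<Rightarrow> bool" where
  "has_partials F \<longleftrightarrow>
     (\<forall>s t. (\<lambda>u. F (u, t)) differentiable (at s) \<and> (\<lambda>u. F (s, u)) differentiable (at t))"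

text \<open>
  The \<open>C\<^sup>\<beta>\<close> norm for \<open>0 < \<beta> \<le> 2\<close>, with the usual convention that the top derivatives, of order
  \<open>\<lceil>\<beta>\<rceil> - 1\<close>, are Hoelder of the remaining order in \<open>(0,1]\<close>; so \<open>\<beta> = 1\<close> is Lipschitz and
  \<open>\<beta> = 2\<close> means a Lipschitz gradient.
\<close>

definition holder_norm :: "real \<Rightarrow> (real \<times> real \<Rightarrow> real) \<Rightarrow> ennreal" where
  "holder_norm \<beta> F =
     (if \<beta> \<le> 1 then sup_norm F + holder_seminorm \<beta> F
      else if has_partials F then
        sup_norm F + sup_norm (partial1 F) + sup_norm (partial2 F)
          + holder_seminorm (\<beta> - 1) (partial1 F) + holder_seminorm (\<beta> - 1) (partial2 F)
      else \<infinity>)"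

definition Lp_norm :: "'w measure \<Rightarrow> real \<Rightarrow> ('w \<Rightarrow> real) \<Rightarrow> ennreal" where
  "Lp_norm M p Z =
     (if integrable M (\<lambda>\<omega>. \<bar>Z \<omega>\<bar> powr p)
      then ennreal ((LINT \<omega>|M. \<bar>Z \<omega>\<bar> powr p) powr (1 / p)) else \<infinity>)"

definition centred_normal :: "real \<Rightarrow> real measure" where
  "centred_normal \<tau> =
     (if \<tau> = 0 then return borel 0 else density lborel (\<lambda>x. ennreal (normal_density 0 \<tau> x)))"

definition centred_gaussian :: "'w measure \<Rightarrow> ('w \<Rightarrow> real) \<Rightarrow> bool" where
  "centred_gaussian M Z \<longleftrightarrow>
     Z \<in> borel_measurable M \<and> (\<exists>\<tau>\<ge>0. distr M borel Z = centred_normal \<tau>)"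

text \<open>
  A centred Gaussian element of \<open>L\<^sup>2(E)\<close> that is also a stochastic process with pointwise values: it is
  jointly measurable, its sample paths are in \<open>L\<^sup>2(E)\<close>, all its \<open>L\<^sup>2(E)\<close> functionals are centred Gaussian,
  and so are all its finite-dimensional marginals.
\<close>

definition centred_gaussian_process :: "'w measure \<Rightarrow> ('w \<Rightarrow> real \<Rightarrow> real) \<Rightarrow> bool" where
  "centred_gaussian_process M X \<longleftrightarrow>
     (\<lambda>(\<omega>, t). X \<omega> t) \<in> borel_measurable (M \<Otimes>\<^sub>M borel) \<and>
     (\<forall>\<omega>. periodic (X \<omega>)) \<and>
     (AE \<omega> in M. integrable circle (\<lambda>t. (X \<omega> t)\<^sup>2)) \<and>
     (\<forall>g. g \<in> borel_measurable borel \<longrightarrow> integrable circle (\<lambda>t. (g t)\<^sup>2) \<longrightarrow>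
        centred_gaussian M (\<lambda>\<omega>. LINT t|circle. X \<omega> t * g t)) \<and>
     (\<forall>I w. finite I \<longrightarrow> centred_gaussian M (\<lambda>\<omega>. \<Sum>t\<in>I. w t * X \<omega> t))"

definition process_cov :: "'w measure \<Rightarrow> ('w \<Rightarrow> real \<Rightarrow> real) \<Rightarrow> real \<times> real \<Rightarrow> real" where
  "process_cov M X = (\<lambda>(s, t).
     LINT \<omega>|M. (X \<omega> s - (LINT \<omega>'|M. X \<omega>' s)) * (X \<omega> t - (LINT \<omega>'|M. X \<omega>' t)))"

text \<open>
  A joint distribution \<open>P\<close> is given by its independent ingredients: the law of the process, the design
  density, the law of the errors and the law of the number of observations per subject. The process \<open>X\<close>
  lives on an auxiliary probability space \<open>path_space P\<close>, and \<open>path P \<omega> t\<close> is the value \<open>X(t)\<close>.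
  The type \<^typ>\<open>nat \<Rightarrow> real\<close> of sample points loses no generality: up to modification, every process with
  continuous covariance and paths in \<open>L\<^sup>2(E)\<close> can be realised on this standard Borel space.
\<close>

record fda_model =
  path_space :: "(nat \<Rightarrow> real) measure"
  path :: "(nat \<Rightarrow> real) \<Rightarrow> real \<Rightarrow> real"
  design :: "real \<Rightarrow> real"
  err_law :: "real measure"
  count_law :: "nat pmf"

definition model_cov :: "fda_model \<Rightarrow> real \<times> real \<Rightarrow> real" where
  "model_cov P = process_cov (path_space P) (path P)"

definition design_law :: "fda_model \<Rightarrow> real measure" where
  "design_law P = density circle (\<lambda>t. ennreal (design P t))"

definition fda_valid :: "fda_model \<Rightarrow> bool" where
  "fda_valid P \<longleftrightarrow>
     prob_space (path_space P) \<and>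
     centred_gaussian_process (path_space P) (path P) \<and>
     design P \<in> borel_measurable borel \<and> periodic (design P) \<and> (\<forall>t. 0 \<le> design P t) \<and>
     prob_space (design_law P) \<and>
     prob_space (err_law P) \<and> sets (err_law P) = sets borel \<and>
     integrable (err_law P) (\<lambda>x. x\<^sup>2) \<and> (LINT x|err_law P. x) = 0"

text \<open>
  The law of one subject: path, number of observations, and infinite sequences of times and errors, of which
  only the first \<open>N\<close> are used. Different subjects are independent.
\<close>

type_synonym subject = "(nat \<Rightarrow> real) \<times> nat \<times> (nat \<Rightarrow> real) \<times> (nat \<Rightarrow> real)"

definition subject_law :: "fda_model \<Rightarrow> subject measure" where
  "subject_law P =
     path_space P \<Otimes>\<^sub>M (measure_pmf (count_law P) \<Otimes>\<^sub>M
       ((\<Pi>\<^sub>M j\<in>UNIV. design_law P) \<Otimes>\<^sub>M (\<Pi>\<^sub>M j\<in>UNIV. err_law P)))"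

definition joint_law :: "fda_model \<Rightarrow> nat \<Rightarrow> (nat \<Rightarrow> subject) measure" where
  "joint_law P n = (\<Pi>\<^sub>M i\<in>{..<n}. subject_law P)"

text \<open>
  The data of a subject are \<open>N\<close> and the pairs \<open>(T\<^sub>j, Y\<^sub>j)\<close>, \<open>Y\<^sub>j = X(T\<^sub>j) + \<epsilon>\<^sub>j\<close>, for \<open>j < N\<close>, padded with
  zeros, which carry no information since \<open>N\<close> is part of the data.
\<close>

type_synonym subject_data = "nat \<times> (nat \<Rightarrow> real \<times> real)"

definition subject_obs :: "fda_model \<Rightarrow> subject \<Rightarrow> subject_data" where
  "subject_obs P = (\<lambda>(\<omega>, N, T, \<epsilon>).
     (N, \<lambda>j. if j < N then (T j, path P \<omega> (T j) + \<epsilon> j) else (0, 0)))"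

definition observations :: "fda_model \<Rightarrow> nat \<Rightarrow> (nat \<Rightarrow> subject) \<Rightarrow> (nat \<Rightarrow> subject_data)" where
  "observations P n x = (\<lambda>i\<in>{..<n}. subject_obs P (x i))"

definition data_space :: "nat \<Rightarrow> (nat \<Rightarrow> subject_data) measure" where
  "data_space n =
     (\<Pi>\<^sub>M i\<in>{..<n}. count_space UNIV \<Otimes>\<^sub>M (\<Pi>\<^sub>M j\<in>UNIV. (borel :: (real \<times> real) measure)))"

definition estimators :: "nat \<Rightarrow> ((nat \<Rightarrow> subject_data) \<Rightarrow> real \<times> real \<Rightarrow> real) set" where
  "estimators n = {est. (\<lambda>(d, z). est d z) \<in> borel_measurable (data_space n \<Otimes>\<^sub>M borel)}"

definition L2_dist_sq :: "(real \<times> real \<Rightarrow> real) \<Rightarrow> (real \<times> real \<Rightarrow> real) \<Rightarrow> ennreal" where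
  "L2_dist_sq F G = (\<integral>\<^sup>+ z. ennreal ((F z - G z)\<^sup>2) \<partial>(circle \<Otimes>\<^sub>M circle))"

definition risk ::
  "fda_model \<Rightarrow> nat \<Rightarrow> ((nat \<Rightarrow> subject_data) \<Rightarrow> real \<times> real \<Rightarrow> real) \<Rightarrow> ennreal" where
  "risk P n est =
     (\<integral>\<^sup>+ x. L2_dist_sq (est (observations P n x)) (model_cov P) \<partial>joint_law P n)"

text \<open>
  The constants hidden in the assumptions: \<open>a \<le> f \<le> b\<close>; \<open>K\<^sub>0\<close>; and, for the counts,
  \<open>\<kappa>\<^sub>1 m \<le> E N \<le> \<kappa>\<^sub>2 m\<close>, \<open>\<lambda>\<^sub>1 (E N)\<^sup>2 \<le> E[N(N-1)] \<le> \<lambda>\<^sub>2 (E N)\<^sup>2\<close>, \<open>E[N\<^sup>4] \<le> \<mu>\<^sub>4 (E N)\<^sup>4\<close>.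
\<close>

record fda_consts =
  dens_lo :: real  dens_hi :: real
  mom_const :: real
  mean_lo :: real  mean_hi :: real
  pair_lo :: real  pair_hi :: real
  fourth_hi :: real

definition consts_ok :: "fda_consts \<Rightarrow> bool" where
  "consts_ok k \<longleftrightarrow>
     0 < dens_lo k \<and> dens_lo k \<le> dens_hi k \<and> 0 < mom_const k \<and>
     0 < mean_lo k \<and> mean_lo k \<le> mean_hi k \<and> 0 < pair_lo k \<and> pair_lo k \<le> pair_hi k \<and>
     0 < fourth_hi k"

definition A1 :: "real \<Rightarrow> real \<Rightarrow> fda_model \<Rightarrow> bool" where
  "A1 \<beta> R P \<longleftrightarrow> holder_norm \<beta> (model_cov P) \<le> ennreal R"

definition A2 :: "fda_consts \<Rightarrow> fda_model \<Rightarrow> bool" where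
  "A2 k P \<longleftrightarrow> (\<forall>t. dens_lo k \<le> design P t \<and> design P t \<le> dens_hi k)"

definition A3 :: "fda_consts \<Rightarrow> fda_model \<Rightarrow> bool" where
  "A3 k P \<longleftrightarrow>
     (let \<nu> = measure_pmf (count_law P); EN = (LINT N|\<nu>. real N);
          EN2 = (LINT N|\<nu>. real N * (real N - 1)) in
      integrable \<nu> (\<lambda>N. real N ^ 4) \<and>
      pair_lo k * EN\<^sup>2 \<le> EN2 \<and> EN2 \<le> pair_hi k * EN\<^sup>2 \<and>
      (LINT N|\<nu>. real N ^ 4) \<le> fourth_hi k * EN ^ 4)"

definition intensity :: "fda_consts \<Rightarrow> real \<Rightarrow> fda_model \<Rightarrow> bool" where
  "intensity k m P \<longleftrightarrow>
     mean_lo k * m \<le> (LINT N|measure_pmf (count_law P). real N) \<and>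
     (LINT N|measure_pmf (count_law P). real N) \<le> mean_hi k * m"

definition A4 :: "fda_consts \<Rightarrow> fda_model \<Rightarrow> bool" where
  "A4 k P \<longleftrightarrow>
     (\<forall>p\<ge>1. (\<forall>t. Lp_norm (path_space P) p (\<lambda>\<omega>. path P \<omega> t) \<le> ennreal (mom_const k * sqrt p)) \<and>
             Lp_norm (err_law P) p (\<lambda>x. x) \<le> ennreal (mom_const k * sqrt p))"

definition A5 :: "nat set \<Rightarrow> fda_model \<Rightarrow> bool" where
  "A5 Q P \<longleftrightarrow> (\<forall>q\<in>Q. invariant_density q (design P))"

definition A6 :: "(real \<Rightarrow> real) \<Rightarrow> bool" where
  "A6 K \<longleftrightarrow>
     (\<forall>x. K (- x) = K x) \<and> (\<exists>L. L-lipschitz_on UNIV K) \<and> (\<forall>x. x \<notin> {-1..1} \<longrightarrow> K x = 0) \<and>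
     (LBINT x. K x) = 1"

text \<open>
  The class \<open>P\<^sub>q(\<beta>, R, m)\<close>. The kernel condition \<open>A6\<close> does not involve the distribution of the data and
  is kept separate.
\<close>

definition model_class ::
  "fda_consts \<Rightarrow> nat set \<Rightarrow> nat \<Rightarrow> real \<Rightarrow> real \<Rightarrow> real \<Rightarrow> fda_model set" where
  "model_class k Q q \<beta> R m =
     {P. fda_valid P \<and> A1 \<beta> R P \<and> A2 k P \<and> A3 k P \<and> A4 k P \<and> A5 Q P \<and>
         intensity k m P \<and> invariant_cov q (model_cov P)}"

definition minimax_risk :: "fda_model set \<Rightarrow> nat \<Rightarrow> ennreal" where
  "minimax_risk \<P> n = (INF est \<in> estimators n. SUP P \<in> \<P>. risk P n est)"

text \<open>
  The constants are not assumed to be compatible with each other, so the class may be empty. For natural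
  choices it is not; e.g. it contains the model without any signal or noise, whose counts are all \<open>m\<close>.
\<close>

lemma circle_simps [simp]:
  "space circle = UNIV" "sets circle = sets borel" "emeasure circle UNIV = 1"
  by (simp_all add: circle_def emeasure_density)

lemma model_class_nonempty:
  assumes k: "consts_ok k" "dens_lo k \<le> 1" "1 \<le> dens_hi k" "mean_lo k \<le> 1" "1 \<le> mean_hi k"
      "pair_lo k \<le> 1 / 2" "1 \<le> pair_hi k" "1 \<le> fourth_hi k"
    and m: "2 \<le> (m :: nat)"
  shows "model_class k Q q \<beta> R (real m) \<noteq> {}"
proof -
  define P where "P = \<lparr>path_space = return borel (\<lambda>_. 0), path = (\<lambda>_ _. 0), design = (\<lambda>_. 1),
    err_law = return borel 0, count_law = return_pmf m\<rparr>"
  have P [simp]: "path_space P = return borel (\<lambda>_. 0)" "path P = (\<lambda>_ _. 0)" "design P = (\<lambda>_. 1)"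
    "err_law P = return borel 0" "count_law P = return_pmf m"
    by (simp_all add: P_def)
  interpret S: prob_space "return borel (\<lambda>_. 0) :: (nat \<Rightarrow> real) measure"
    by (rule prob_space_return) simp
  have [simp]: "model_cov P = (\<lambda>_. 0)"
    by (simp add: model_cov_def process_cov_def fun_eq_iff)
  have gauss: "centred_gaussian (return borel (\<lambda>_. 0) :: (nat \<Rightarrow> real) measure) (\<lambda>_. 0)"
    unfolding centred_gaussian_def centred_normal_def
    by (auto intro!: exI[of _ 0] simp: S.distr_const)
  have proc: "centred_gaussian_process (return borel (\<lambda>_. 0) :: (nat \<Rightarrow> real) measure) (\<lambda>_ _. 0)"
    using gauss by (simp add: centred_gaussian_process_def periodic_def)
  have err: "prob_space (return borel (0 :: real))"
    by (rule prob_space_return) simp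
  have "design_law P = circle"
    by (simp add: design_law_def density_1)
  hence design: "prob_space (design_law P)"
    by (auto intro!: prob_spaceI)
  have valid: "fda_valid P"
    using proc err design S.prob_space_axioms
    by (auto simp: fda_valid_def periodic_def integral_return integrable_iff_bounded nn_integral_return)
  have "holder_seminorm \<alpha> (\<lambda>_. 0) \<le> 0" "holder_seminorm \<alpha> (\<lambda>(s, t). 0) \<le> 0" for \<alpha>
    unfolding holder_seminorm_def by (intro SUP_least; auto)+
  hence a1: "A1 \<beta> R P"
    by (auto simp: A1_def holder_norm_def sup_norm_def partial1_def partial2_def has_partials_def
        split_beta)
  have "integrable (return borel 0) (\<lambda>x. \<bar>x :: real\<bar> powr p)" for p
    by (intro integrableI_bounded) (simp_all add: nn_integral_return)
  hence a4: "A4 k P"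
    using k(1) by (auto simp: A4_def Lp_norm_def integral_return consts_ok_def)
  have a3: "A3 k P"
  proof -
    have "1 / 2 * (real m)\<^sup>2 \<le> real m * (real m - 1)"
      using m by (simp add: power2_eq_square field_simps)
    moreover have "pair_lo k * (real m)\<^sup>2 \<le> 1 / 2 * (real m)\<^sup>2"
      using k by (intro mult_right_mono) auto
    moreover have "real m * (real m - 1) \<le> 1 * (real m)\<^sup>2"
      by (simp add: power2_eq_square algebra_simps)
    moreover have "1 * (real m)\<^sup>2 \<le> pair_hi k * (real m)\<^sup>2" "1 * real m ^ 4 \<le> fourth_hi k * real m ^ 4"
      using k by (intro mult_right_mono; simp)+
    ultimately show ?thesis
      by (simp add: A3_def Let_def integrable_measure_pmf_finite)
  qed
  have "intensity k (real m) P"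
    using k m by (auto simp: intensity_def intro: mult_left_le_one_le mult_le_cancel_right1)
  with valid a1 a3 a4 k have "P \<in> model_class k Q q \<beta> R (real m)"
    by (auto simp: model_class_def A2_def A5_def invariant_density_def invariant_cov_def)
  thus ?thesis by blast
qed

end

theory Submission
  imports Defs
begin

text \<open>
  The bound is already attained by stationary covariances, which are invariant under every rotation; this is
  why the constant does not depend on \<open>q\<close>. For the nonparametric term take the spectrum to be any subset of the
  frequencies \<open>1, \<dots>, M\<close>, each with the same weight \<open>e M\<^bsup>-\<beta>-1\<^esup>\<close>; the exponent is forced by the Hoelder
  bound, since the weights are nonnegative and add up at the diagonal. Adding one frequency to the spectrum adds
  to the data of a subject a random wave in Gaussian noise, whose likelihood ratio is explicit and has chi-square
  distance of order \<open>N\<^sup>2\<close> times the squared weight, on the event that \<open>N\<close> is not too large. With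
  \<open>M\<^bsup>2\<beta>+2\<^esup> \<approx> n m\<^sup>2\<close> no frequency can be detected from \<open>n\<close> subjects, and Bessel's inequality sums up the errors
  over the frequencies (Assouad's method). The parametric term \<open>1/n\<close> comes from constant processes \<open>b \<xi>\<close> and
  \<open>b (1 + \<delta>)\<^bsup>1/2\<^esup> \<xi>\<close> with \<open>\<delta> \<approx> n\<^bsup>-1/2\<^esup>\<close>. Counts, design and all other constants are inherited from an
  arbitrary member of the class.
\<close>

section \<open>Gaussian integrals and change of measure on products\<close>

text \<open>Likelihood ratios are taken on the sample space, not on the data. The models of a family
  share the law of coefficients, counts, times and errors and differ only in the map to the data;
  the change of measure has a weight \<open>L\<close> in these latent variables. In effect the
  statistician is also shown the other waves of the spectrum, which are then a known shift and drop
  out of \<open>L\<close>, whereas the likelihood ratio of the data would involve inverses of random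
  covariance matrices. Extra information only helps testing, so the lower bound stays valid. The
  second obstacle: the counts have just four moments, while the second moment of \<open>L\<close>
  given \<open>N\<close> is bounded only for x N < 1, where x = a^2 / \<sigma>^2. Discarding x N >
  1/2 loses probability at most 4 x^2 E N^2, the order of the chi-square distance itself, so that n
  x^2 m^2 being small controls both. The rate: M undetected weights a^2, with a^4 of order 1 / (n
  m^2), leave a squared error of order M a^4, that is M^(-2\<beta>-1).\<close>

definition gauss :: "real \<Rightarrow> real measure" where
  "gauss \<sigma> = density lborel (\<lambda>x. ennreal (normal_density 0 \<sigma> x))"

lemma sets_gauss [simp, measurable_cong]: "sets (gauss \<sigma>) = sets borel"
  and space_gauss [simp]: "space (gauss \<sigma>) = UNIV"
  by (simp_all add: gauss_def)

lemma prob_space_gauss: "0 < \<sigma> \<Longrightarrow> prob_space (gauss \<sigma>)"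
  unfolding gauss_def by (rule prob_space_normal_density)

lemma nn_integral_normal_density: "0 < \<sigma> \<Longrightarrow> (\<integral>\<^sup>+x. ennreal (normal_density \<mu> \<sigma> x) \<partial>lborel) = 1"
  by (simp add: nn_integral_eq_integral)

lemma nn_integral_gauss:
  assumes [measurable]: "f \<in> borel_measurable borel"
  shows "(\<integral>\<^sup>+x. f x \<partial>gauss \<sigma>) = (\<integral>\<^sup>+x. ennreal (normal_density 0 \<sigma> x) * f x \<partial>lborel)"
  unfolding gauss_def by (rule nn_integral_density) simp_all

lemma nn_integral_gauss_exp:
  assumes "0 < \<sigma>"
  shows "(\<integral>\<^sup>+x. ennreal (exp (b * x)) \<partial>gauss \<sigma>) = ennreal (exp (\<sigma>\<^sup>2 * b\<^sup>2 / 2))"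
proof -
  have eq: "normal_density 0 \<sigma> x * exp (b * x) = exp (\<sigma>\<^sup>2 * b\<^sup>2 / 2) * normal_density (\<sigma>\<^sup>2 * b) \<sigma> x" for x
  proof -
    have "- x\<^sup>2 / (2 * \<sigma>\<^sup>2) + b * x = \<sigma>\<^sup>2 * b\<^sup>2 / 2 + (- (x - \<sigma>\<^sup>2 * b)\<^sup>2 / (2 * \<sigma>\<^sup>2))"
      using assms by (simp add: field_simps power2_eq_square)
    thus ?thesis
      unfolding normal_density_def by (simp add: exp_add[symmetric] mult_ac)
  qed
  have "(\<integral>\<^sup>+x. ennreal (exp (b * x)) \<partial>gauss \<sigma>) =
      (\<integral>\<^sup>+x. ennreal (exp (\<sigma>\<^sup>2 * b\<^sup>2 / 2)) * ennreal (normal_density (\<sigma>\<^sup>2 * b) \<sigma> x) \<partial>lborel)"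
    by (simp add: nn_integral_gauss ennreal_mult[symmetric] eq)
  also have "\<dots> = ennreal (exp (\<sigma>\<^sup>2 * b\<^sup>2 / 2))"
    using assms by (simp add: nn_integral_cmult nn_integral_normal_density)
  finally show ?thesis .
qed

text \<open>The integrand is an unnormalised normal density of variance 1 / (1 - y). The formula
  serves three times: for the moments (y = 1/2), for the averaged likelihood ratio of a wave, and
  for the second moment of a change of scale.\<close>

lemma nn_integral_gauss_exp_square:
  assumes "y < 1"
  shows "(\<integral>\<^sup>+x. ennreal (exp (y * x\<^sup>2 / 2)) \<partial>gauss 1) = ennreal (1 / sqrt (1 - y))"
proof -
  define \<tau> where "\<tau> = 1 / sqrt (1 - y)"
  have \<tau>: "0 < \<tau>" "\<tau>\<^sup>2 = 1 / (1 - y)" using assms by (auto simp: \<tau>_def power_divide)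
  have eq: "normal_density 0 1 x * exp (y * x\<^sup>2 / 2) = \<tau> * normal_density 0 \<tau> x" for x
  proof -
    have "- x\<^sup>2 / 2 + y * x\<^sup>2 / 2 = - x\<^sup>2 / (2 * \<tau>\<^sup>2)"
      using assms by (simp add: \<tau>(2) field_simps)
    moreover have "sqrt (2 * pi * \<tau>\<^sup>2) = sqrt (2 * pi) * \<tau>"
      using \<tau>(1) by (simp add: real_sqrt_mult)
    ultimately show ?thesis
      using \<tau>(1) unfolding normal_density_def by (simp add: exp_add[symmetric])
  qed
  have "(\<integral>\<^sup>+x. ennreal (exp (y * x\<^sup>2 / 2)) \<partial>gauss 1) =
      (\<integral>\<^sup>+x. ennreal \<tau> * ennreal (normal_density 0 \<tau> x) \<partial>lborel)"
    using \<tau>(1) by (simp add: nn_integral_gauss ennreal_mult[symmetric] eq)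
  also have "\<dots> = ennreal \<tau>"
    using \<tau>(1) by (simp add: nn_integral_cmult nn_integral_normal_density)
  finally show ?thesis by (simp add: \<tau>_def)
qed

text \<open>One-dimensional Cameron-Martin formula. The weight is a function of the unshifted
  variable, so it can be kept on the sample space.\<close>

lemma nn_integral_gauss_shift:
  assumes "0 < \<sigma>" and [measurable]: "f \<in> borel_measurable borel"
  shows "(\<integral>\<^sup>+x. f (x + s) \<partial>gauss \<sigma>) =
    (\<integral>\<^sup>+x. f x * ennreal (exp (s * x / \<sigma>\<^sup>2 - s\<^sup>2 / (2 * \<sigma>\<^sup>2))) \<partial>gauss \<sigma>)"
proof -
  have eq: "normal_density 0 \<sigma> (x - s) = normal_density 0 \<sigma> x * exp (s * x / \<sigma>\<^sup>2 - s\<^sup>2 / (2 * \<sigma>\<^sup>2))" for x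
  proof -
    have "- (x - s)\<^sup>2 / (2 * \<sigma>\<^sup>2) = - x\<^sup>2 / (2 * \<sigma>\<^sup>2) + (s * x / \<sigma>\<^sup>2 - s\<^sup>2 / (2 * \<sigma>\<^sup>2))"
      using assms(1) by (simp add: field_simps power2_eq_square)
    thus ?thesis unfolding normal_density_def by (simp add: exp_add[symmetric] mult_ac)
  qed
  have "(\<integral>\<^sup>+x. f (x + s) \<partial>gauss \<sigma>) = (\<integral>\<^sup>+x. ennreal (normal_density 0 \<sigma> x) * f (x + s) \<partial>lborel)"
    by (simp add: nn_integral_gauss)
  also have "\<dots> = (\<integral>\<^sup>+x. ennreal (normal_density 0 \<sigma> (x - s)) * f x \<partial>lborel)"
    by (subst nn_integral_real_affine[where c=1 and t="-s"]) auto
  also have "\<dots> = (\<integral>\<^sup>+x. ennreal (normal_density 0 \<sigma> x) *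
      (f x * ennreal (exp (s * x / \<sigma>\<^sup>2 - s\<^sup>2 / (2 * \<sigma>\<^sup>2)))) \<partial>lborel)"
    by (simp add: eq ennreal_mult mult_ac)
  finally show ?thesis by (simp add: nn_integral_gauss)
qed

text \<open>The weight is the ratio of the N(0, s^2) density to the N(0, 1) density.\<close>

lemma nn_integral_gauss_scale:
  assumes "0 < s" and [measurable]: "f \<in> borel_measurable borel"
  shows "(\<integral>\<^sup>+x. f (s * x) \<partial>gauss 1) =
    (\<integral>\<^sup>+x. f x * ennreal (exp ((1 - 1 / s\<^sup>2) * x\<^sup>2 / 2) / s) \<partial>gauss 1)"
proof -
  have eq: "normal_density 0 1 x = normal_density 0 1 (s * x) * exp ((1 - 1 / s\<^sup>2) * (s * x)\<^sup>2 / 2)" for x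
  proof -
    have "- x\<^sup>2 / 2 = - (s * x)\<^sup>2 / 2 + (1 - 1 / s\<^sup>2) * (s * x)\<^sup>2 / 2"
      using assms(1) by (simp add: field_simps power2_eq_square)
    thus ?thesis unfolding normal_density_def by (simp add: exp_add[symmetric])
  qed
  have "(\<integral>\<^sup>+x. f x * ennreal (exp ((1 - 1 / s\<^sup>2) * x\<^sup>2 / 2) / s) \<partial>gauss 1) =
     (\<integral>\<^sup>+x. ennreal (normal_density 0 1 x) * (f x * ennreal (exp ((1 - 1 / s\<^sup>2) * x\<^sup>2 / 2) / s)) \<partial>lborel)"
    by (simp add: nn_integral_gauss)
  also have "\<dots> = ennreal s * (\<integral>\<^sup>+x. ennreal (normal_density 0 1 (s * x)) *
      (f (s * x) * ennreal (exp ((1 - 1 / s\<^sup>2) * (s * x)\<^sup>2 / 2) / s)) \<partial>lborel)"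
    using assms(1) by (subst nn_integral_real_affine[where c=s and t=0]) auto
  also have "\<dots> = (\<integral>\<^sup>+x. ennreal s * (ennreal (normal_density 0 1 (s * x)) *
      (f (s * x) * ennreal (exp ((1 - 1 / s\<^sup>2) * (s * x)\<^sup>2 / 2) / s))) \<partial>lborel)"
    by (rule nn_integral_cmult[symmetric]) measurable
  also have "\<dots> = (\<integral>\<^sup>+x. ennreal (normal_density 0 1 x) * f (s * x) \<partial>lborel)"
  proof (rule nn_integral_cong)
    fix x
    have "ennreal s * (ennreal (normal_density 0 1 (s * x)) *
      (f (s * x) * ennreal (exp ((1 - 1 / s\<^sup>2) * (s * x)\<^sup>2 / 2) / s))) =
      ennreal (s * (normal_density 0 1 (s * x) * (exp ((1 - 1 / s\<^sup>2) * (s * x)\<^sup>2 / 2) / s))) * f (s * x)"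
      using assms(1) by (subst ennreal_mult, simp, simp, subst ennreal_mult, simp, simp) (simp add: mult_ac)
    also have "s * (normal_density 0 1 (s * x) * (exp ((1 - 1 / s\<^sup>2) * (s * x)\<^sup>2 / 2) / s)) =
        normal_density 0 1 x"
      using assms(1) by (subst (2) eq) simp
    finally show "ennreal s * (ennreal (normal_density 0 1 (s * x)) *
      (f (s * x) * ennreal (exp ((1 - 1 / s\<^sup>2) * (s * x)\<^sup>2 / 2) / s))) =
      ennreal (normal_density 0 1 x) * f (s * x)" .
  qed
  also have "\<dots> = (\<integral>\<^sup>+x. f (s * x) \<partial>gauss 1)"
    by (simp add: nn_integral_gauss)
  finally show ?thesis by simp
qed

text \<open>Tensorisation, exchanging one coordinate at a time. \<open>F\<close> is arbitrary in the
  induction, because freezing coordinate \<open>i\<close> turns it, together with the weight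
  \<open>L i y\<close>, into another such function. The weight depends on the sample point and not
  only on \<open>g i x\<close>, which is what admits latent variables.\<close>

lemma nn_integral_PiM_change:
  assumes I: "finite I" and prob: "prob_space M"
    and [measurable]: "\<And>i. i \<in> I \<Longrightarrow> f i \<in> M \<rightarrow>\<^sub>M N" "\<And>i. i \<in> I \<Longrightarrow> g i \<in> M \<rightarrow>\<^sub>M N"
      "\<And>i. i \<in> I \<Longrightarrow> L i \<in> borel_measurable M"
    and change: "\<And>i G. i \<in> I \<Longrightarrow> G \<in> borel_measurable N \<Longrightarrow>
      (\<integral>\<^sup>+x. G (f i x) \<partial>M) = (\<integral>\<^sup>+x. G (g i x) * L i x \<partial>M)"
    and F: "F \<in> borel_measurable (\<Pi>\<^sub>M i\<in>I. N)"
  shows "(\<integral>\<^sup>+x. F (\<lambda>i\<in>I. f i (x i)) \<partial>(\<Pi>\<^sub>M i\<in>I. M)) =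
    (\<integral>\<^sup>+x. F (\<lambda>i\<in>I. g i (x i)) * (\<Prod>i\<in>I. L i (x i)) \<partial>(\<Pi>\<^sub>M i\<in>I. M))"
  using I assms(3-5) change F
proof (induction I arbitrary: F)
  case empty
  thus ?case by simp
next
  case (insert i I)
  note [measurable] = insert.prems(1-3,5)
  interpret prob_space M by fact
  interpret product_sigma_finite "\<lambda>_. M"
    by standard
  interpret PI: prob_space "\<Pi>\<^sub>M i\<in>I. M"
    by (rule prob_space_PiM) (rule prob)
  interpret PS: pair_sigma_finite M "\<Pi>\<^sub>M i\<in>I. M"
    by standard
  have mf: "f i \<in> M \<rightarrow>\<^sub>M N" "g i \<in> M \<rightarrow>\<^sub>M N" "L i \<in> borel_measurable M"
    using insert.prems by auto
  note [measurable] = mf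
  have mI: "(\<lambda>x. \<lambda>j\<in>I. f j (x j)) \<in> (\<Pi>\<^sub>M i\<in>I. M) \<rightarrow>\<^sub>M (\<Pi>\<^sub>M i\<in>I. N)"
    "(\<lambda>x. \<lambda>j\<in>I. g j (x j)) \<in> (\<Pi>\<^sub>M i\<in>I. M) \<rightarrow>\<^sub>M (\<Pi>\<^sub>M i\<in>I. N)"
    "(\<lambda>x. \<lambda>j\<in>insert i I. f j (x j)) \<in> (\<Pi>\<^sub>M i\<in>insert i I. M) \<rightarrow>\<^sub>M (\<Pi>\<^sub>M i\<in>insert i I. N)"
    "(\<lambda>x. \<lambda>j\<in>insert i I. g j (x j)) \<in> (\<Pi>\<^sub>M i\<in>insert i I. M) \<rightarrow>\<^sub>M (\<Pi>\<^sub>M i\<in>insert i I. N)"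
    by measurable
  note [measurable] = mI
  have pI: "(\<lambda>x. \<Prod>j\<in>I. L j (x j)) \<in> borel_measurable (\<Pi>\<^sub>M i\<in>I. M)"
    "(\<lambda>x. \<Prod>j\<in>insert i I. L j (x j)) \<in> borel_measurable (\<Pi>\<^sub>M i\<in>insert i I. M)"
    by measurable
  note [measurable] = pI
  have upd [measurable]: "(\<lambda>(x, y). (x(i := y))) \<in> ((\<Pi>\<^sub>M i\<in>I. N) \<Otimes>\<^sub>M N) \<rightarrow>\<^sub>M (\<Pi>\<^sub>M i\<in>insert i I. N)"
    using measurable_add_dim[of i I "\<lambda>_. N"] by simp
  have res: "(\<lambda>j\<in>insert i I. h j ((x(i := y)) j)) = (\<lambda>j\<in>I. h j (x j))(i := h i y)" for h :: "'a \<Rightarrow> 'b \<Rightarrow> 'c" and x y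
    using insert.hyps by (auto simp: fun_eq_iff)
  have "(\<integral>\<^sup>+x. F (\<lambda>j\<in>insert i I. f j (x j)) \<partial>(\<Pi>\<^sub>M i\<in>insert i I. M)) =
      (\<integral>\<^sup>+x. \<integral>\<^sup>+y. F (\<lambda>j\<in>insert i I. f j ((x(i := y)) j)) \<partial>M \<partial>(\<Pi>\<^sub>M i\<in>I. M))"
    using insert.hyps by (subst product_nn_integral_insert) auto
  also have "\<dots> = (\<integral>\<^sup>+x. \<integral>\<^sup>+y. F ((\<lambda>j\<in>I. f j (x j))(i := f i y)) \<partial>M \<partial>(\<Pi>\<^sub>M i\<in>I. M))"
    by (simp only: res)
  also have "\<dots> = (\<integral>\<^sup>+x. \<integral>\<^sup>+y. F ((\<lambda>j\<in>I. f j (x j))(i := g i y)) * L i y \<partial>M \<partial>(\<Pi>\<^sub>M i\<in>I. M))"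
  proof (rule nn_integral_cong)
    fix x assume x: "x \<in> space (\<Pi>\<^sub>M i\<in>I. M)"
    hence "(\<lambda>j\<in>I. f j (x j)) \<in> space (\<Pi>\<^sub>M i\<in>I. N)"
      by (rule measurable_space[OF mI(1)])
    hence "(\<lambda>z. F ((\<lambda>j\<in>I. f j (x j))(i := z))) \<in> borel_measurable N"
      by measurable
    thus "(\<integral>\<^sup>+y. F ((\<lambda>j\<in>I. f j (x j))(i := f i y)) \<partial>M) =
        (\<integral>\<^sup>+y. F ((\<lambda>j\<in>I. f j (x j))(i := g i y)) * L i y \<partial>M)"
      using insert.prems(4)[of i "\<lambda>z. F ((\<lambda>j\<in>I. f j (x j))(i := z))"] by simp
  qed
  \<comment> \<open>The induction hypothesis concerns the integral over the coordinates in
    \<open>I\<close>, so coordinate \<open>i\<close> moves outside for it and comes back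
    afterwards.\<close>
  also have "\<dots> = (\<integral>\<^sup>+y. \<integral>\<^sup>+x. F ((\<lambda>j\<in>I. f j (x j))(i := g i y)) * L i y \<partial>(\<Pi>\<^sub>M i\<in>I. M) \<partial>M)"
    by (rule PS.Fubini') measurable
  also have "\<dots> = (\<integral>\<^sup>+y. \<integral>\<^sup>+x. F ((\<lambda>j\<in>I. g j (x j))(i := g i y)) * L i y * (\<Prod>j\<in>I. L j (x j)) \<partial>(\<Pi>\<^sub>M i\<in>I. M) \<partial>M)"
  proof (rule nn_integral_cong)
    fix y assume y: "y \<in> space M"
    hence [simp]: "g i y \<in> space N"
      using measurable_space[OF mf(2)] by simp
    have [measurable]: "(\<lambda>d. F (d(i := g i y)) * L i y) \<in> borel_measurable (\<Pi>\<^sub>M i\<in>I. N)"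
      by measurable
    show "(\<integral>\<^sup>+x. F ((\<lambda>j\<in>I. f j (x j))(i := g i y)) * L i y \<partial>(\<Pi>\<^sub>M i\<in>I. M)) =
       (\<integral>\<^sup>+x. F ((\<lambda>j\<in>I. g j (x j))(i := g i y)) * L i y * (\<Prod>j\<in>I. L j (x j)) \<partial>(\<Pi>\<^sub>M i\<in>I. M))"
      by (rule insert.IH[of "\<lambda>d. F (d(i := g i y)) * L i y"]) (simp_all add: insert.prems(4))
  qed
  also have "\<dots> = (\<integral>\<^sup>+x. \<integral>\<^sup>+y. F ((\<lambda>j\<in>I. g j (x j))(i := g i y)) * L i y * (\<Prod>j\<in>I. L j (x j)) \<partial>M \<partial>(\<Pi>\<^sub>M i\<in>I. M))"
    by (rule PS.Fubini'[symmetric]) measurable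
  also have "\<dots> = (\<integral>\<^sup>+x. \<integral>\<^sup>+y. F (\<lambda>j\<in>insert i I. g j ((x(i := y)) j)) * (\<Prod>j\<in>insert i I. L j ((x(i := y)) j)) \<partial>M \<partial>(\<Pi>\<^sub>M i\<in>I. M))"
  proof -
    have "(\<Prod>j\<in>insert i I. L j ((x(i := y)) j)) = L i y * (\<Prod>j\<in>I. L j (x j))" for x y
      using insert.hyps by (auto intro!: arg_cong[where f="(*) _"] prod.cong)
    thus ?thesis by (simp only: res mult.assoc)
  qed
  also have "\<dots> = (\<integral>\<^sup>+x. F (\<lambda>j\<in>insert i I. g j (x j)) * (\<Prod>j\<in>insert i I. L j (x j)) \<partial>(\<Pi>\<^sub>M i\<in>insert i I. M))"
    using insert.hyps by (subst product_nn_integral_insert) auto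
  finally show ?case .
qed

section \<open>Two-point lower bound\<close>

text \<open>
  Bounds the testing affinity \<open>E min 1 W\<close> of a likelihood ratio \<open>W\<close> from below by its first two moments on an
  event \<open>c\<close>. For a product of likelihood ratios and a product event these moments are \<open>n\<close>-th powers.
\<close>

lemma ennreal_min_one_bound:
  fixes W c :: ennreal
  assumes "c = 0 \<or> c = 1"
  shows "c * W \<le> min 1 W + ennreal (1/4) * (c * W\<^sup>2)"
proof (cases "c = 0")
  case False
  hence c: "c = 1" using assms by simp
  show ?thesis
  proof (cases W)
    case (real r)
    have "r \<le> min 1 r + 1/4 * r\<^sup>2"
    proof (cases "r \<le> 1")
      case False
      \<comment> \<open>This square gives r <= 1 + r^2 / 4 and hence the factor 1/4.\<close>
      have "0 \<le> (1 - r / 2)\<^sup>2" by simp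
      thus ?thesis using False by (simp add: power2_eq_square field_simps)
    qed simp
    hence "ennreal r \<le> ennreal (min 1 r + 1/4 * r\<^sup>2)"
      by (rule ennreal_leI)
    also have "\<dots> = min 1 W + ennreal (1/4) * (c * W\<^sup>2)"
      using real by (simp add: c ennreal_plus[symmetric] ennreal_mult[symmetric] ennreal_power min_def
          ennreal_1[symmetric] del: ennreal_plus ennreal_1)
    finally show ?thesis using real by (simp add: c)
  next
    case top
    thus ?thesis by (simp add: c ennreal_top_eq_mult_iff ennreal_mult_top power2_eq_square ennreal_top_mult)
  qed
qed simp

text \<open>Le Cam's method for two losses that cannot both be below D / 2. \<open>W\<close> is the
  likelihood ratio of the sample and \<open>c\<close> indicates that all subjects lie in
  \<open>B\<close>. Mass at least 3/4 and second moment at most 2 leave an affinity of 3/4 - 2/4 =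
  1/4, hence D / 4.\<close>

lemma two_point_bound:
  assumes prob: "prob_space S"
    and [measurable]: "f \<in> S \<rightarrow>\<^sub>M N" "g \<in> S \<rightarrow>\<^sub>M N" "L \<in> borel_measurable S" "B \<in> sets S"
      "G0 \<in> borel_measurable (\<Pi>\<^sub>M i\<in>{..<n}. N)" "G1 \<in> borel_measurable (\<Pi>\<^sub>M i\<in>{..<n}. N)"
    and change: "\<And>G. G \<in> borel_measurable N \<Longrightarrow> (\<integral>\<^sup>+x. G (f x) \<partial>S) = (\<integral>\<^sup>+x. G (g x) * L x \<partial>S)"
    and mass: "ennreal (3/4) \<le> (\<integral>\<^sup>+x. indicator B x * L x \<partial>S) ^ n"
    and square: "(\<integral>\<^sup>+x. indicator B x * (L x)\<^sup>2 \<partial>S) ^ n \<le> 2"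
    and D: "0 \<le> D" "\<And>d. d \<in> space (\<Pi>\<^sub>M i\<in>{..<n}. N) \<Longrightarrow> ennreal D \<le> G0 d + G1 d"
  shows "ennreal (D / 4) \<le> (\<integral>\<^sup>+x. G0 (\<lambda>i\<in>{..<n}. g (x i)) \<partial>(\<Pi>\<^sub>M i\<in>{..<n}. S)) +
    (\<integral>\<^sup>+x. G1 (\<lambda>i\<in>{..<n}. f (x i)) \<partial>(\<Pi>\<^sub>M i\<in>{..<n}. S))"
proof -
  interpret prob_space S by fact
  interpret product_sigma_finite "\<lambda>_::nat. S" by standard
  define P where "P = (\<Pi>\<^sub>M i\<in>{..<n}. S)"
  define W where "W x = (\<Prod>i<n. L (x i))" for x
  define c where "c x = (\<Prod>i<n. indicator B (x i) :: ennreal)" for x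
  have [measurable]: "W \<in> borel_measurable P" "c \<in> borel_measurable P"
    unfolding W_def[abs_def] c_def[abs_def] P_def by measurable
  have g [measurable]: "(\<lambda>x. \<lambda>i\<in>{..<n}. g (x i)) \<in> P \<rightarrow>\<^sub>M (\<Pi>\<^sub>M i\<in>{..<n}. N)"
    unfolding P_def by measurable
  have c01: "c x = 0 \<or> c x = 1" for x
    unfolding c_def by (induction n) (auto simp: indicator_def)
  have cW: "(\<integral>\<^sup>+x. c x * W x \<partial>P) = (\<integral>\<^sup>+x. indicator B x * L x \<partial>S) ^ n"
    unfolding P_def c_def W_def prod.distrib[symmetric]
    by (subst product_nn_integral_prod) auto
  have cW2: "(\<integral>\<^sup>+x. c x * (W x)\<^sup>2 \<partial>P) = (\<integral>\<^sup>+x. indicator B x * (L x)\<^sup>2 \<partial>S) ^ n"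
    unfolding P_def c_def W_def prod.distrib[symmetric] prod_power_distrib
    by (subst product_nn_integral_prod) auto
  have "ennreal (3/4) \<le> (\<integral>\<^sup>+x. c x * W x \<partial>P)"
    using mass cW by simp
  also have "\<dots> \<le> (\<integral>\<^sup>+x. min 1 (W x) + ennreal (1/4) * (c x * (W x)\<^sup>2) \<partial>P)"
    by (intro nn_integral_mono ennreal_min_one_bound c01)
  also have "\<dots> = (\<integral>\<^sup>+x. min 1 (W x) \<partial>P) + ennreal (1/4) * (\<integral>\<^sup>+x. c x * (W x)\<^sup>2 \<partial>P)"
    by (simp add: nn_integral_add nn_integral_cmult)
  also have "\<dots> \<le> (\<integral>\<^sup>+x. min 1 (W x) \<partial>P) + ennreal (1/4) * 2"
    using square cW2 by (intro add_left_mono mult_left_mono) auto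
  also have "ennreal (1/4) * 2 = ennreal (1/2)"
    by (simp add: ennreal_numeral[symmetric] ennreal_mult[symmetric] del: ennreal_numeral)
  finally have *: "ennreal (3/4) \<le> (\<integral>\<^sup>+x. min 1 (W x) \<partial>P) + ennreal (1/2)" .
  have min: "ennreal (1/4) \<le> (\<integral>\<^sup>+x. min 1 (W x) \<partial>P)"
  proof (cases "\<integral>\<^sup>+x. min 1 (W x) \<partial>P")
    case (real r)
    have "ennreal r + ennreal (1/2) = ennreal (r + 1/2)"
      using real by (intro ennreal_plus[symmetric]) auto
    hence "3/4 \<le> r + 1/2"
      using * real by (metis ennreal_le_iff add_nonneg_nonneg divide_nonneg_nonneg zero_le_one zero_le_numeral)
    thus ?thesis
      unfolding real(2) by (intro ennreal_leI) simp
  qed simp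
  have "ennreal (D / 4) = ennreal D * ennreal (1/4)"
    using D(1) by (simp add: ennreal_mult[symmetric])
  also have "\<dots> \<le> ennreal D * (\<integral>\<^sup>+x. min 1 (W x) \<partial>P)"
    using min by (intro mult_left_mono) auto
  also have "\<dots> = (\<integral>\<^sup>+x. ennreal D * min 1 (W x) \<partial>P)"
    by (simp add: nn_integral_cmult)
  also have "\<dots> \<le> (\<integral>\<^sup>+x. G0 (\<lambda>i\<in>{..<n}. g (x i)) + G1 (\<lambda>i\<in>{..<n}. g (x i)) * W x \<partial>P)"
  proof (rule nn_integral_mono)
    fix x assume x: "x \<in> space P"
    let ?d = "\<lambda>i\<in>{..<n}. g (x i)"
    have "ennreal D * min 1 (W x) \<le> (G0 ?d + G1 ?d) * min 1 (W x)"
      by (intro mult_right_mono D(2) measurable_space[OF g x]) auto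
    also have "\<dots> = G0 ?d * min 1 (W x) + G1 ?d * min 1 (W x)"
      by (rule distrib_right)
    also have "\<dots> \<le> G0 ?d * 1 + G1 ?d * W x"
      by (intro add_mono mult_left_mono) auto
    finally show "ennreal D * min 1 (W x) \<le> G0 ?d + G1 ?d * W x" by simp
  qed
  also have "\<dots> = (\<integral>\<^sup>+x. G0 (\<lambda>i\<in>{..<n}. g (x i)) \<partial>P) + (\<integral>\<^sup>+x. G1 (\<lambda>i\<in>{..<n}. g (x i)) * W x \<partial>P)"
    by (intro nn_integral_add) measurable
  also have "(\<integral>\<^sup>+x. G1 (\<lambda>i\<in>{..<n}. g (x i)) * W x \<partial>P) = (\<integral>\<^sup>+x. G1 (\<lambda>i\<in>{..<n}. f (x i)) \<partial>P)"
    unfolding P_def W_def using prob change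
    by (intro nn_integral_PiM_change[symmetric]) auto
  finally show ?thesis unfolding P_def .
qed

section \<open>Gaussian sequences and shifts of their first \<open>N\<close> coordinates\<close>

abbreviation gauss_seq :: "real \<Rightarrow> (nat \<Rightarrow> real) measure" where
  "gauss_seq \<sigma> \<equiv> (\<Pi>\<^sub>M i\<in>UNIV. gauss \<sigma>)"

lemma prob_space_gauss_seq: "0 < \<sigma> \<Longrightarrow> prob_space (gauss_seq \<sigma>)"
  by (intro prob_space_PiM prob_space_gauss)

text \<open>Redrawing one coordinate from its own law does not change an infinite product. This
  separates the coefficients of a single frequency from the rest of the path.\<close>

lemma nn_integral_PiM_resample:
  assumes "prob_space M" and [measurable]: "F \<in> borel_measurable (\<Pi>\<^sub>M i\<in>UNIV. M)"
  shows "(\<integral>\<^sup>+w. F w \<partial>(\<Pi>\<^sub>M i\<in>UNIV. M)) = (\<integral>\<^sup>+w. \<integral>\<^sup>+x. F (w(i := x)) \<partial>M \<partial>(\<Pi>\<^sub>M i\<in>UNIV. M))"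
proof -
  interpret M: prob_space M by fact
  interpret PI: prob_space "\<Pi>\<^sub>M i\<in>UNIV. M"
    by (rule prob_space_PiM) (rule assms(1))
  interpret PS: pair_sigma_finite M "\<Pi>\<^sub>M i\<in>UNIV. M"
    by standard
  have upd [measurable]: "(\<lambda>(x, X). X(i := x)) \<in> (M \<Otimes>\<^sub>M (\<Pi>\<^sub>M i\<in>UNIV. M)) \<rightarrow>\<^sub>M (\<Pi>\<^sub>M i\<in>UNIV. M)"
    by (rule measurable_PiM_single') (auto simp: space_pair_measure space_PiM split_beta fun_upd_def)
  have "(\<integral>\<^sup>+w. F w \<partial>(\<Pi>\<^sub>M i\<in>UNIV. M)) =
      (\<integral>\<^sup>+w. F w \<partial>(distr (M \<Otimes>\<^sub>M (\<Pi>\<^sub>M i\<in>UNIV. M)) (\<Pi>\<^sub>M i\<in>UNIV. M) (\<lambda>(x, X). X(i := x))))"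
    using distr_pair_PiM_eq_PiM[of UNIV "\<lambda>_. M" i] assms(1) by simp
  also have "\<dots> = (\<integral>\<^sup>+z. F ((\<lambda>(x, X). X(i := x)) z) \<partial>(M \<Otimes>\<^sub>M (\<Pi>\<^sub>M i\<in>UNIV. M)))"
    by (rule nn_integral_distr) measurable
  also have "\<dots> = (\<integral>\<^sup>+w. \<integral>\<^sup>+x. F ((\<lambda>(x, X). X(i := x)) (x, w)) \<partial>M \<partial>(\<Pi>\<^sub>M i\<in>UNIV. M))"
    by (rule PS.nn_integral_snd[symmetric]) measurable
  finally show ?thesis by simp
qed

lemma nn_integral_gauss_seq_restrict:
  assumes "0 < \<sigma>" and [measurable]: "H \<in> borel_measurable (\<Pi>\<^sub>M j\<in>{..<N::nat}. gauss \<sigma>)"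
  shows "(\<integral>\<^sup>+\<epsilon>. H (restrict \<epsilon> {..<N}) \<partial>gauss_seq \<sigma>) = (\<integral>\<^sup>+\<epsilon>. H \<epsilon> \<partial>(\<Pi>\<^sub>M j\<in>{..<N}. gauss \<sigma>))"
proof -
  interpret prob_space "gauss \<sigma>" using assms(1) by (rule prob_space_gauss)
  interpret product_prob_space "\<lambda>_::nat. gauss \<sigma>" UNIV by standard
  have "(\<integral>\<^sup>+\<epsilon>. H \<epsilon> \<partial>(\<Pi>\<^sub>M j\<in>{..<N}. gauss \<sigma>)) =
     (\<integral>\<^sup>+\<epsilon>. H \<epsilon> \<partial>(distr (gauss_seq \<sigma>) (\<Pi>\<^sub>M j\<in>{..<N}. gauss \<sigma>) (\<lambda>x. restrict x {..<N})))"
    by (subst distr_PiM_restrict_finite) auto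
  also have "\<dots> = (\<integral>\<^sup>+\<epsilon>. H (restrict \<epsilon> {..<N}) \<partial>gauss_seq \<sigma>)"
    by (rule nn_integral_distr) (auto intro!: measurable_restrict_subset)
  finally show ?thesis by simp
qed

text \<open>Cameron-Martin density for a shift by \<open>s\<close> of the first \<open>N\<close>
  errors. Only these enter the data, and a shift of the entire sequence need not be absolutely
  continuous.\<close>

definition shift_density :: "real \<Rightarrow> nat \<Rightarrow> (nat \<Rightarrow> real) \<Rightarrow> (nat \<Rightarrow> real) \<Rightarrow> ennreal" where
  "shift_density \<sigma> N s \<epsilon> = (\<Prod>j<N. ennreal (exp (s j * \<epsilon> j / \<sigma>\<^sup>2 - (s j)\<^sup>2 / (2 * \<sigma>\<^sup>2))))"

lemma nn_integral_gauss_seq_shift: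
  assumes "0 < \<sigma>" and [measurable]: "H \<in> borel_measurable (\<Pi>\<^sub>M j\<in>{..<N::nat}. borel)"
  shows "(\<integral>\<^sup>+\<epsilon>. H (\<lambda>j\<in>{..<N}. \<epsilon> j + s j) \<partial>gauss_seq \<sigma>) =
    (\<integral>\<^sup>+\<epsilon>. H (restrict \<epsilon> {..<N}) * shift_density \<sigma> N s \<epsilon> \<partial>gauss_seq \<sigma>)"
proof -
  let ?L = "\<lambda>j x. ennreal (exp (s j * x / \<sigma>\<^sup>2 - (s j)\<^sup>2 / (2 * \<sigma>\<^sup>2)))"
  have [measurable]: "H \<in> borel_measurable (\<Pi>\<^sub>M j\<in>{..<N::nat}. gauss \<sigma>)"
    using assms(2) by (simp cong: measurable_cong_sets sets_PiM_cong)
  have "(\<integral>\<^sup>+\<epsilon>. H (\<lambda>j\<in>{..<N}. restrict \<epsilon> {..<N} j + s j) \<partial>gauss_seq \<sigma>) =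
      (\<integral>\<^sup>+\<epsilon>. H (\<lambda>j\<in>{..<N}. \<epsilon> j + s j) \<partial>(\<Pi>\<^sub>M j\<in>{..<N}. gauss \<sigma>))"
    using assms(1) by (intro nn_integral_gauss_seq_restrict) measurable
  also have "\<dots> = (\<integral>\<^sup>+\<epsilon>. H (\<lambda>j\<in>{..<N}. \<epsilon> j) * (\<Prod>j<N. ?L j (\<epsilon> j)) \<partial>(\<Pi>\<^sub>M j\<in>{..<N}. gauss \<sigma>))"
    using assms(1)
    by (intro nn_integral_PiM_change[where N=borel] prob_space_gauss nn_integral_gauss_shift) auto
  also have "\<dots> = (\<integral>\<^sup>+\<epsilon>. H (\<lambda>j\<in>{..<N}. restrict \<epsilon> {..<N} j) * (\<Prod>j<N. ?L j (restrict \<epsilon> {..<N} j)) \<partial>gauss_seq \<sigma>)"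
    using assms(1) by (intro nn_integral_gauss_seq_restrict[symmetric]) measurable
  finally show ?thesis
    by (simp add: shift_density_def cong: restrict_cong)
qed

text \<open>Completing the square leaves only the cross term, so the correlation of two likelihood
  ratios is the exponential of the inner product of their shifts. With one shift equal to zero this
  is the total mass 1.\<close>

lemma nn_integral_shift_density_mult:
  assumes "0 < \<sigma>"
  shows "(\<integral>\<^sup>+\<epsilon>. shift_density \<sigma> N s \<epsilon> * shift_density \<sigma> N s' \<epsilon> \<partial>gauss_seq \<sigma>) =
    ennreal (exp ((\<Sum>j<N. s j * s' j) / \<sigma>\<^sup>2))"
proof -
  interpret prob_space "gauss \<sigma>" using assms by (rule prob_space_gauss)
  interpret product_sigma_finite "\<lambda>_::nat. gauss \<sigma>" by standard
  let ?l = "\<lambda>s j x. exp (s j * x / \<sigma>\<^sup>2 - (s j)\<^sup>2 / (2 * \<sigma>\<^sup>2)) :: real"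
  have one: "(\<integral>\<^sup>+x. ennreal (?l s j x) * ennreal (?l s' j x) \<partial>gauss \<sigma>) = ennreal (exp (s j * s' j / \<sigma>\<^sup>2))" for j
  proof -
    let ?b = "(s j + s' j) / \<sigma>\<^sup>2" and ?a = "- ((s j)\<^sup>2 + (s' j)\<^sup>2) / (2 * \<sigma>\<^sup>2)"
    have eq: "?l s j x * ?l s' j x = exp ?a * exp (?b * x)" for x
      using assms by (simp add: exp_add[symmetric] field_simps)
    have "(\<integral>\<^sup>+x. ennreal (?l s j x) * ennreal (?l s' j x) \<partial>gauss \<sigma>) =
      (\<integral>\<^sup>+x. ennreal (exp ?a) * ennreal (exp (?b * x)) \<partial>gauss \<sigma>)"
      by (simp only: ennreal_mult[symmetric] exp_ge_zero eq)
    also have "\<dots> = ennreal (exp ?a) * ennreal (exp (\<sigma>\<^sup>2 * ?b\<^sup>2 / 2))"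
      using assms by (subst nn_integral_cmult) (auto simp only: nn_integral_gauss_exp, measurable)
    also have "\<dots> = ennreal (exp (?a + \<sigma>\<^sup>2 * ?b\<^sup>2 / 2))"
      by (simp add: ennreal_mult[symmetric] exp_add[symmetric])
    also have "?a + \<sigma>\<^sup>2 * ?b\<^sup>2 / 2 = s j * s' j / \<sigma>\<^sup>2"
      using assms by (simp add: field_simps power2_eq_square)
    finally show ?thesis .
  qed
  have "(\<integral>\<^sup>+\<epsilon>. shift_density \<sigma> N s \<epsilon> * shift_density \<sigma> N s' \<epsilon> \<partial>gauss_seq \<sigma>) =
    (\<integral>\<^sup>+\<epsilon>. (\<Prod>j<N. ennreal (?l s j (restrict \<epsilon> {..<N} j)) * ennreal (?l s' j (restrict \<epsilon> {..<N} j))) \<partial>gauss_seq \<sigma>)"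
    by (simp add: shift_density_def prod.distrib)
  also have "\<dots> = (\<integral>\<^sup>+\<epsilon>. (\<Prod>j<N. ennreal (?l s j (\<epsilon> j)) * ennreal (?l s' j (\<epsilon> j))) \<partial>(\<Pi>\<^sub>M j\<in>{..<N}. gauss \<sigma>))"
    using assms by (intro nn_integral_gauss_seq_restrict) measurable
  also have "\<dots> = (\<Prod>j<N. \<integral>\<^sup>+x. ennreal (?l s j x) * ennreal (?l s' j x) \<partial>gauss \<sigma>)"
    by (subst product_nn_integral_prod) auto
  also have "\<dots> = (\<Prod>j<N. ennreal (exp (s j * s' j / \<sigma>\<^sup>2)))"
    by (simp only: one)
  also have "\<dots> = ennreal (exp (\<Sum>j<N. s j * s' j / \<sigma>\<^sup>2))"
    by (simp add: prod_ennreal exp_sum)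
  finally show ?thesis by (simp add: sum_divide_distrib)
qed

section \<open>Gaussian linear functionals and their moments\<close>

lemma distributed_gauss_seq_component:
  "distributed (gauss_seq 1) lborel (\<lambda>\<omega>. \<omega> i) (\<lambda>x. ennreal (normal_density 0 1 x))"
proof -
  have "distr (gauss_seq 1) lborel (\<lambda>\<omega>. \<omega> i) = distr (gauss_seq 1) (gauss 1) (\<lambda>\<omega>. \<omega> i)"
    by (rule distr_cong) simp_all
  also have "\<dots> = gauss 1"
    using distr_PiM_component[of UNIV "\<lambda>_. gauss 1" i] prob_space_gauss[of 1] by simp
  finally show ?thesis
    by (simp add: distributed_def gauss_def)
qed

lemma indep_vars_gauss_seq:
  assumes "finite J" "J \<noteq> {}"
  shows "prob_space.indep_vars (gauss_seq 1) (\<lambda>_. borel) (\<lambda>i \<omega>. \<omega> i) J"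
proof -
  interpret prob_space "gauss_seq 1" by (rule prob_space_gauss_seq) simp
  interpret G: prob_space "gauss 1" by (rule prob_space_gauss) simp
  interpret product_prob_space "\<lambda>_::nat. gauss 1" UNIV by standard
  have comp: "distr (gauss_seq 1) borel (\<lambda>\<omega>. \<omega> i) = gauss 1" for i
    using distributed_gauss_seq_component[of i] unfolding distributed_def gauss_def
    by (metis distr_cong sets_lborel)
  have "distr (gauss_seq 1) (\<Pi>\<^sub>M i\<in>J. borel) (\<lambda>x. \<lambda>i\<in>J. x i) =
      distr (gauss_seq 1) (\<Pi>\<^sub>M i\<in>J. gauss 1) (\<lambda>x. restrict x J)"
    by (rule distr_cong) (auto intro!: sets_PiM_cong)
  also have "\<dots> = (\<Pi>\<^sub>M i\<in>J. gauss 1)"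
    using assms by (intro distr_PiM_restrict_finite) auto
  finally show ?thesis
    using assms by (subst indep_vars_iff_distr_eq_PiM') (simp_all add: comp)
qed

lemma distr_gauss_seq_linear:
  "distr (gauss_seq 1) borel (\<lambda>\<omega>. \<Sum>i<K. b i * \<omega> i) = centred_normal (sqrt (\<Sum>i<K. (b i)\<^sup>2))"
proof -
  interpret prob_space "gauss_seq 1" by (rule prob_space_gauss_seq) simp
  \<comment> \<open>Vanishing coefficients are removed, since a normal density needs a positive
    standard deviation; if none is left, the law is the point mass at 0.\<close>
  define J where "J = {i \<in> {..<K}. b i \<noteq> 0}"
  have J: "finite J" "(\<Sum>i<K. b i * \<omega> i) = (\<Sum>i\<in>J. b i * \<omega> i)" "(\<Sum>i<K. (b i)\<^sup>2) = (\<Sum>i\<in>J. \<bar>b i\<bar>\<^sup>2)"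
    for \<omega> :: "nat \<Rightarrow> real"
    by (auto simp: J_def intro!: sum.mono_neutral_cong_right)
  show ?thesis
  proof (cases "J = {}")
    case True
    thus ?thesis using J by (simp add: centred_normal_def distr_const)
  next
    case False
    have "indep_vars (\<lambda>_. borel) (\<lambda>i. (\<lambda>x. b i * x) \<circ> (\<lambda>\<omega>. \<omega> i)) J"
      by (rule indep_vars_compose[OF indep_vars_gauss_seq]) (use J False in auto)
    hence ind: "indep_vars (\<lambda>_. borel) (\<lambda>i \<omega>. b i * \<omega> i) J"
      by (simp add: comp_def)
    have nor: "distributed (gauss_seq 1) lborel (\<lambda>\<omega>. b i * \<omega> i) (normal_density 0 \<bar>b i\<bar>)" if "i \<in> J" for i
      using normal_density_affine[OF distributed_gauss_seq_component, of "b i" 0 i] that by (simp add: J_def)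
    have "distributed (gauss_seq 1) lborel (\<lambda>\<omega>. \<Sum>i\<in>J. b i * \<omega> i)
        (normal_density (\<Sum>i\<in>J. 0) (sqrt (\<Sum>i\<in>J. \<bar>b i\<bar>\<^sup>2)))"
      by (rule sum_indep_normal[OF J(1) False ind _ nor]) (auto simp: J_def)
    hence "distr (gauss_seq 1) lborel (\<lambda>\<omega>. \<Sum>i\<in>J. b i * \<omega> i) =
        density lborel (normal_density 0 (sqrt (\<Sum>i\<in>J. \<bar>b i\<bar>\<^sup>2)))"
      by (simp add: distributed_def)
    moreover have "distr (gauss_seq 1) borel (\<lambda>\<omega>. \<Sum>i\<in>J. b i * \<omega> i) =
        distr (gauss_seq 1) lborel (\<lambda>\<omega>. \<Sum>i\<in>J. b i * \<omega> i)"
      by (rule distr_cong) simp_all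
    moreover have "0 < (\<Sum>i\<in>J. \<bar>b i\<bar>\<^sup>2)"
      using J(1) False by (intro sum_pos) (auto simp: J_def)
    ultimately show ?thesis by (simp add: centred_normal_def J)
  qed
qed

lemma centred_gaussian_linear: "centred_gaussian (gauss_seq 1) (\<lambda>\<omega>. \<Sum>i<K. b i * \<omega> i)"
  unfolding centred_gaussian_def distr_gauss_seq_linear
  by (auto intro!: exI[of _ "sqrt (\<Sum>i<K. (b i)\<^sup>2)"] sum_nonneg)

lemma integrable_gauss_moment: "0 < \<sigma> \<Longrightarrow> integrable (gauss \<sigma>) (\<lambda>x. x ^ k)"
  unfolding gauss_def using integrable_normal_moment[of \<sigma> 0 k]
  by (subst integrable_density) auto

lemma integral_gauss_id: "0 < \<sigma> \<Longrightarrow> (LINT x|gauss \<sigma>. x) = 0"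
  unfolding gauss_def using integral_normal_moment_odd[of \<sigma> 0 0]
  by (subst integral_density) auto

lemma integral_gauss_square: "0 < \<sigma> \<Longrightarrow> (LINT x|gauss \<sigma>. x\<^sup>2) = \<sigma>\<^sup>2"
  unfolding gauss_def using integral_normal_moment_even[of \<sigma> 0 1]
  by (subst integral_density) auto

lemma centred_normal_gauss: "centred_normal \<tau> = (if \<tau> = 0 then return borel 0 else gauss \<tau>)"
  by (simp add: centred_normal_def gauss_def)

lemma centred_normal_moments:
  assumes "0 \<le> \<tau>"
  shows "integrable (centred_normal \<tau>) (\<lambda>x. x)" "integrable (centred_normal \<tau>) (\<lambda>x. x\<^sup>2)"
    "(LINT x|centred_normal \<tau>. x) = 0" "(LINT x|centred_normal \<tau>. x\<^sup>2) = \<tau>\<^sup>2"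
  using assms integrable_gauss_moment[of \<tau> 1] integrable_gauss_moment[of \<tau> 2]
  by (auto simp: centred_normal_gauss integral_return integral_gauss_id integral_gauss_square
      integrable_iff_bounded nn_integral_return)

lemma linear_moments:
  shows "integrable (gauss_seq 1) (\<lambda>\<omega>. \<Sum>i<K. b i * \<omega> i)"
    "integrable (gauss_seq 1) (\<lambda>\<omega>. (\<Sum>i<K. b i * \<omega> i)\<^sup>2)"
    "(LINT \<omega>|gauss_seq 1. (\<Sum>i<K. b i * \<omega> i)) = 0"
    "(LINT \<omega>|gauss_seq 1. (\<Sum>i<K. b i * \<omega> i)\<^sup>2) = (\<Sum>i<K. (b i)\<^sup>2)"
proof -
  let ?Z = "\<lambda>\<omega>. \<Sum>i<K. b i * \<omega> i" and ?\<tau> = "sqrt (\<Sum>i<K. (b i)\<^sup>2)"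
  have [measurable]: "?Z \<in> borel_measurable (gauss_seq 1)" by measurable
  have \<tau>: "0 \<le> ?\<tau>" by (simp add: sum_nonneg)
  note m = centred_normal_moments[OF \<tau>, folded distr_gauss_seq_linear]
  show "integrable (gauss_seq 1) ?Z" using m(1) by (subst (asm) integrable_distr_eq) auto
  show "integrable (gauss_seq 1) (\<lambda>\<omega>. (?Z \<omega>)\<^sup>2)" using m(2) by (subst (asm) integrable_distr_eq) auto
  show "(LINT \<omega>|gauss_seq 1. ?Z \<omega>) = 0" using m(3) by (subst (asm) integral_distr) auto
  show "(LINT \<omega>|gauss_seq 1. (?Z \<omega>)\<^sup>2) = (\<Sum>i<K. (b i)\<^sup>2)"
    using m(4) by (subst (asm) integral_distr) (auto simp: sum_nonneg)
qed

lemma linear_covariance: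
  "(LINT \<omega>|gauss_seq 1. (\<Sum>i<K. b i * \<omega> i) * (\<Sum>i<K. c i * \<omega> i)) = (\<Sum>i<K. b i * c i)"
proof -
  \<comment> \<open>Polarisation reduces covariances to variances.\<close>
  have eq: "(\<Sum>i<K. b i * \<omega> i) * (\<Sum>i<K. c i * \<omega> i) =
    1 / 4 * ((\<Sum>i<K. (b i + c i) * \<omega> i)\<^sup>2 - (\<Sum>i<K. (b i - c i) * \<omega> i)\<^sup>2)" for \<omega> :: "nat \<Rightarrow> real"
    by (simp add: distrib_right left_diff_distrib sum.distrib sum_subtractf power2_eq_square algebra_simps)
  have "(LINT \<omega>|gauss_seq 1. (\<Sum>i<K. b i * \<omega> i) * (\<Sum>i<K. c i * \<omega> i)) =
      1 / 4 * ((\<Sum>i<K. (b i + c i)\<^sup>2) - (\<Sum>i<K. (b i - c i)\<^sup>2))"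
    unfolding eq
    by (subst integral_mult_right_zero, subst Bochner_Integration.integral_diff) (simp_all only: linear_moments)
  also have "\<dots> = (\<Sum>i<K. b i * c i)"
    by (simp add: sum_subtractf[symmetric] sum_distrib_left power2_eq_square algebra_simps)
  finally show ?thesis .
qed

text \<open>\<open>z\<^sup>r \<le> (r/e)\<^sup>r e\<^sup>z\<close>, applied to \<open>z = x\<^sup>2 / 4\<close> and \<open>r = p / 2\<close>, turns moments into the exponential moment \<open>E exp (x\<^sup>2 / 4)\<close>.\<close>

lemma abs_powr_le_exp_square:
  assumes "1 \<le> p"
  shows "\<bar>x::real\<bar> powr p \<le> (2 * p) powr (p / 2) * exp (x\<^sup>2 / 4 - p / 2)"
proof (cases "x = 0")
  case False
  define r where "r = p / 2"
  have r: "0 < r" using assms by (simp add: r_def)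
  define u where "u = x\<^sup>2 / 4 / r"
  have u: "0 < u" using False r by (simp add: u_def)
  have "u \<le> exp (u - 1)" using exp_ge_add_one_self[of "u - 1"] by simp
  hence "u powr r \<le> exp (u - 1) powr r" using u r by (intro powr_mono2) auto
  also have "\<dots> = exp (x\<^sup>2 / 4 - p / 2)"
    using r by (simp add: powr_def u_def r_def field_simps)
  finally have *: "u powr r \<le> exp (x\<^sup>2 / 4 - p / 2)" .
  have "\<bar>x\<bar> powr p = (\<bar>x\<bar> powr 2) powr r"
    by (subst powr_powr) (simp add: r_def)
  also have "\<bar>x\<bar> powr 2 = x\<^sup>2" using False by (simp add: powr_numeral)
  also have "x\<^sup>2 = 2 * p * u" using assms by (simp add: u_def r_def)
  also have "(2 * p * u) powr r = (2 * p) powr r * u powr r"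
    using assms u by (simp add: powr_mult)
  also have "\<dots> \<le> (2 * p) powr r * exp (x\<^sup>2 / 4 - p / 2)"
    using * by (intro mult_left_mono) auto
  finally show ?thesis by (simp add: r_def)
qed simp

text \<open>Integrating the preceding pointwise bound costs the factor E exp (x^2 / 4) = sqrt 2. For
  p >= 1 it is absorbed by 2^(p/2), which gives the constant 2 in front of sqrt p.\<close>

lemma nn_integral_gauss_abs_powr:
  assumes "1 \<le> p"
  shows "(\<integral>\<^sup>+x. ennreal (\<bar>x\<bar> powr p) \<partial>gauss 1) \<le> ennreal ((2 * sqrt p) powr p)"
proof -
  let ?c = "(2 * p) powr (p / 2) * exp (- p / 2)"
  have "(\<integral>\<^sup>+x. ennreal (\<bar>x\<bar> powr p) \<partial>gauss 1) \<le> (\<integral>\<^sup>+x. ennreal ?c * ennreal (exp ((1/2) * x\<^sup>2 / 2)) \<partial>gauss 1)"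
  proof (rule nn_integral_mono)
    fix x :: real
    have "(2 * p) powr (p / 2) * exp (x\<^sup>2 / 4 - p / 2) = ?c * exp ((1/2) * x\<^sup>2 / 2)"
      unfolding mult.assoc exp_add[symmetric] by (simp add: algebra_simps)
    hence "\<bar>x\<bar> powr p \<le> ?c * exp ((1/2) * x\<^sup>2 / 2)"
      using abs_powr_le_exp_square[OF assms, of x] by (simp only:)
    thus "ennreal (\<bar>x\<bar> powr p) \<le> ennreal ?c * ennreal (exp ((1/2) * x\<^sup>2 / 2))"
      by (subst ennreal_mult[symmetric]) (auto intro: ennreal_leI)
  qed
  also have "\<dots> = ennreal (?c * (1 / sqrt (1 - 1/2)))"
    by (subst nn_integral_cmult) (auto simp only: nn_integral_gauss_exp_square, measurable, simp add: nn_integral_gauss_exp_square ennreal_mult[symmetric])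
  also have "\<dots> \<le> ennreal ((2 * sqrt p) powr p)"
  proof (rule ennreal_leI)
    have "sqrt 2 \<le> 2 powr (p / 2)"
      using assms powr_mono[of "1/2" "p/2" "2::real"] by (simp add: powr_half_sqrt)
    moreover have "exp (- p / 2) \<le> 1" using assms by simp
    ultimately have "exp (- p / 2) * sqrt 2 \<le> 1 * 2 powr (p / 2)"
      by (intro mult_mono) auto
    hence "(2 * p) powr (p / 2) * (exp (- p / 2) * sqrt 2) \<le> (2 * p) powr (p / 2) * 2 powr (p / 2)"
      by (intro mult_left_mono) auto
    also have "\<dots> = (4 * p) powr (p / 2)" using assms by (subst powr_mult[symmetric]) auto
    also have "\<dots> = (sqrt (4 * p)) powr p" using assms by (simp add: powr_half_sqrt[symmetric] powr_powr)
    also have "sqrt (4 * p) = 2 * sqrt p" by (simp add: real_sqrt_mult)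
    finally show "?c * (1 / sqrt (1 - 1/2)) \<le> (2 * sqrt p) powr p"
      by (simp add: mult.assoc real_sqrt_divide)
  qed
  finally show ?thesis .
qed

text \<open>This is how \<open>A4\<close> is verified: a standard deviation of at most half the
  moment constant suffices. The positive case scales the standard normal law; \<tau> = 0 is a point
  mass.\<close>

lemma Lp_norm_centred_normal:
  assumes [measurable]: "Z \<in> borel_measurable M" and Z: "distr M borel Z = centred_normal \<tau>"
    and \<tau>: "0 \<le> \<tau>" "2 * \<tau> \<le> K" and p: "1 \<le> p"
  shows "Lp_norm M p Z \<le> ennreal (K * sqrt p)"
proof -
  have K: "0 \<le> K" using \<tau> by simp
  have "(\<integral>\<^sup>+\<omega>. ennreal (\<bar>Z \<omega>\<bar> powr p) \<partial>M) = (\<integral>\<^sup>+x. ennreal (\<bar>x\<bar> powr p) \<partial>centred_normal \<tau>)"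
    unfolding Z[symmetric] by (subst nn_integral_distr) auto
  also have "\<dots> \<le> ennreal ((\<tau> * (2 * sqrt p)) powr p)"
  proof (cases "\<tau> = 0")
    case True
    thus ?thesis by (simp add: centred_normal_gauss nn_integral_return)
  next
    case False
    hence pos: "0 < \<tau>" using \<tau> by simp
    have "gauss \<tau> = distr (gauss 1) borel (\<lambda>x. \<tau> * x)"
    proof -
      interpret prob_space "gauss 1" by (rule prob_space_gauss) simp
      have "distributed (gauss 1) lborel (\<lambda>x. x) (\<lambda>x. ennreal (normal_density 0 1 x))"
        by (auto simp: distributed_def gauss_def intro!: distr_id2)
      from normal_density_affine[OF this, of \<tau> 0] pos
      have "distr (gauss 1) lborel (\<lambda>x. \<tau> * x) = gauss \<tau>"
        by (simp add: distributed_def gauss_def)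
      moreover have "distr (gauss 1) lborel (\<lambda>x. \<tau> * x) = distr (gauss 1) borel (\<lambda>x. \<tau> * x)"
        by (rule distr_cong) simp_all
      ultimately show ?thesis by simp
    qed
    hence "(\<integral>\<^sup>+x. ennreal (\<bar>x\<bar> powr p) \<partial>centred_normal \<tau>) = (\<integral>\<^sup>+x. ennreal (\<bar>\<tau> * x\<bar> powr p) \<partial>gauss 1)"
      using False by (simp add: centred_normal_gauss nn_integral_distr)
    also have "\<dots> = ennreal (\<tau> powr p) * (\<integral>\<^sup>+x. ennreal (\<bar>x\<bar> powr p) \<partial>gauss 1)"
      using pos by (simp add: abs_mult powr_mult ennreal_mult nn_integral_cmult)
    also have "\<dots> \<le> ennreal (\<tau> powr p) * ennreal ((2 * sqrt p) powr p)"
      using p by (intro mult_left_mono nn_integral_gauss_abs_powr) auto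
    also have "\<dots> = ennreal ((\<tau> * (2 * sqrt p)) powr p)"
      using pos p by (simp add: ennreal_mult[symmetric] powr_mult)
    finally show ?thesis .
  qed
  also have "\<dots> \<le> ennreal ((K * sqrt p) powr p)"
    using \<tau> p mult_right_mono[of "2 * \<tau>" K "sqrt p"]
    by (intro ennreal_leI powr_mono2) (auto simp: mult_ac)
  finally have bound: "(\<integral>\<^sup>+\<omega>. ennreal (\<bar>Z \<omega>\<bar> powr p) \<partial>M) \<le> ennreal ((K * sqrt p) powr p)" .
  hence int: "integrable M (\<lambda>\<omega>. \<bar>Z \<omega>\<bar> powr p)"
    by (intro integrableI_bounded) (auto intro: le_less_trans)
  have "ennreal (LINT \<omega>|M. \<bar>Z \<omega>\<bar> powr p) \<le> ennreal ((K * sqrt p) powr p)"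
    using bound nn_integral_eq_integral[OF int] by simp
  hence "(LINT \<omega>|M. \<bar>Z \<omega>\<bar> powr p) \<le> (K * sqrt p) powr p"
    by (subst (asm) ennreal_le_iff) auto
  hence "(LINT \<omega>|M. \<bar>Z \<omega>\<bar> powr p) powr (1 / p) \<le> ((K * sqrt p) powr p) powr (1 / p)"
    using p by (intro powr_mono2) auto
  also have "\<dots> = K * sqrt p" using p K by (simp add: powr_powr)
  finally show ?thesis using int by (simp add: Lp_norm_def ennreal_leI)
qed

section \<open>Stationary trigonometric processes\<close>

lemma sum_lessThan_double: "(\<Sum>i<2 * M. f i) = (\<Sum>k<M. f (2 * k) + f (Suc (2 * k)))"
  for f :: "nat \<Rightarrow> 'a::comm_monoid_add"
  by (induction M) (simp_all add: add.assoc)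

text \<open>Coordinates \<open>2 * k\<close> and \<open>2 * k + 1\<close> carry the cosine and the
  sine of frequency \<open>k\<close>. Their common amplitude \<open>A k\<close> makes the covariance
  a function of s - t. At frequency 0 the sine vanishes and a constant process remains.\<close>

definition trig_coeff :: "(nat \<Rightarrow> real) \<Rightarrow> nat \<Rightarrow> real \<Rightarrow> real" where
  "trig_coeff A i t = A (i div 2) *
     (if even i then cos (2 * pi * real (i div 2) * t) else sin (2 * pi * real (i div 2) * t))"

definition trig_path :: "nat \<Rightarrow> (nat \<Rightarrow> real) \<Rightarrow> (nat \<Rightarrow> real) \<Rightarrow> real \<Rightarrow> real" where
  "trig_path M A \<omega> t = (\<Sum>i<2 * M. trig_coeff A i t * \<omega> i)"

definition trig_cov :: "nat \<Rightarrow> (nat \<Rightarrow> real) \<Rightarrow> real \<times> real \<Rightarrow> real" where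
  "trig_cov M A = (\<lambda>(s, t). \<Sum>k<M. (A k)\<^sup>2 * cos (2 * pi * real k * (s - t)))"

lemma borel_measurable_trig_coeff [measurable]: "trig_coeff A i \<in> borel_measurable borel"
  unfolding trig_coeff_def[abs_def] by (cases "even i") simp_all

lemma abs_trig_coeff_le: "\<bar>trig_coeff A i t\<bar> \<le> \<bar>A (i div 2)\<bar>"
  by (auto simp: trig_coeff_def abs_mult intro: mult_left_le)

lemma trig_coeff_periodic: "trig_coeff A i (t + 1) = trig_coeff A i t"
proof -
  have "2 * pi * real (i div 2) * (t + 1) = 2 * pi * real (i div 2) * t + 2 * real (i div 2) * pi"
    by (simp add: algebra_simps)
  thus ?thesis
    using sin.plus_of_nat[of "2 * pi * real (i div 2) * t" "i div 2"]
      cos.plus_of_nat[of "2 * pi * real (i div 2) * t" "i div 2"]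
    by (simp add: trig_coeff_def mult_ac)
qed

lemma sum_trig_coeff_mult: "(\<Sum>i<2 * M. trig_coeff A i s * trig_coeff A i t) = trig_cov M A (s, t)"
  unfolding sum_lessThan_double trig_cov_def
  by (auto simp: trig_coeff_def power2_eq_square cos_diff right_diff_distrib algebra_simps intro!: sum.cong)

lemma sum_trig_coeff_square: "(\<Sum>i<2 * M. (trig_coeff A i t)\<^sup>2) = (\<Sum>k<M. (A k)\<^sup>2)"
  using sum_trig_coeff_mult[of A t t M] by (simp add: power2_eq_square trig_cov_def)

lemma trig_path_eq:
  "trig_path M A \<omega> t = (\<Sum>k<M. A k * (\<omega> (2 * k) * cos (2 * pi * real k * t) + \<omega> (Suc (2 * k)) * sin (2 * pi * real k * t)))"
  unfolding trig_path_def sum_lessThan_double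
  by (auto simp: trig_coeff_def algebra_simps intro!: sum.cong)

lemma borel_measurable_trig_path [measurable]:
  "(\<lambda>(\<omega>, t). trig_path M A \<omega> t) \<in> borel_measurable (gauss_seq 1 \<Otimes>\<^sub>M borel)"
  unfolding trig_path_def split_beta by measurable

lemma prob_space_circle: "prob_space circle"
  by (rule prob_spaceI) simp

lemma sets_circle [measurable_cong]: "sets circle = sets borel"
  by simp

lemma centred_gaussian_process_trig: "centred_gaussian_process (gauss_seq 1) (trig_path M A)"
  unfolding centred_gaussian_process_def
proof (intro conjI allI impI)
  interpret C: prob_space circle by (rule prob_space_circle)
  show "(\<lambda>(\<omega>, t). trig_path M A \<omega> t) \<in> borel_measurable (gauss_seq 1 \<Otimes>\<^sub>M borel)"
    by measurable
  show "periodic (trig_path M A \<omega>)" for \<omega>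
    by (simp add: periodic_def trig_path_def trig_coeff_periodic)
  show "AE \<omega> in gauss_seq 1. integrable circle (\<lambda>t. (trig_path M A \<omega> t)\<^sup>2)"
  proof (intro AE_I2 C.integrable_const_bound[of _ "(\<Sum>i<2 * M. \<bar>A (i div 2)\<bar> * \<bar>\<omega> i\<bar>)\<^sup>2" for \<omega>] AE_I2)
    fix \<omega> :: "nat \<Rightarrow> real" and t
    have "\<bar>trig_path M A \<omega> t\<bar> \<le> (\<Sum>i<2 * M. \<bar>A (i div 2)\<bar> * \<bar>\<omega> i\<bar>)"
      unfolding trig_path_def
      by (rule order_trans[OF sum_abs]) (auto simp: abs_mult intro!: sum_mono mult_right_mono abs_trig_coeff_le)
    thus "norm ((trig_path M A \<omega> t)\<^sup>2) \<le> (\<Sum>i<2 * M. \<bar>A (i div 2)\<bar> * \<bar>\<omega> i\<bar>)\<^sup>2"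
      by (simp add: abs_le_square_iff[symmetric] sum_nonneg)
  qed (simp add: trig_path_def)
  show "centred_gaussian (gauss_seq 1) (\<lambda>\<omega>. LINT t|circle. trig_path M A \<omega> t * g t)"
    if g: "g \<in> borel_measurable borel" "integrable circle (\<lambda>t. (g t)\<^sup>2)" for g
  proof -
    have [measurable]: "g \<in> borel_measurable circle" using g(1) by simp
    have "integrable circle g"
      by (rule C.square_integrable_imp_integrable[OF _ g(2)]) measurable
    hence "integrable circle (\<lambda>t. \<bar>A (i div 2)\<bar> * g t)" for i by simp
    hence int: "integrable circle (\<lambda>t. trig_coeff A i t * g t)" for i
      by (rule Bochner_Integration.integrable_bound)
        (auto simp: abs_mult intro!: mult_right_mono abs_trig_coeff_le)
    \<comment> \<open>Every linear functional of the path is a finite linear form in the Gaussian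
      coefficients.\<close>
    have "(LINT t|circle. trig_path M A \<omega> t * g t) = (\<Sum>i<2 * M. (LINT t|circle. trig_coeff A i t * g t) * \<omega> i)" for \<omega>
    proof -
      have "(LINT t|circle. trig_path M A \<omega> t * g t) = (LINT t|circle. (\<Sum>i<2 * M. trig_coeff A i t * g t * \<omega> i))"
        unfolding trig_path_def sum_distrib_right by (simp add: mult_ac)
      also have "\<dots> = (\<Sum>i<2 * M. LINT t|circle. trig_coeff A i t * g t * \<omega> i)"
        using int by (intro Bochner_Integration.integral_sum) auto
      finally show ?thesis by simp
    qed
    thus ?thesis by (simp add: centred_gaussian_linear)
  qed
  show "centred_gaussian (gauss_seq 1) (\<lambda>\<omega>. \<Sum>t\<in>I. w t * trig_path M A \<omega> t)" for I w
  proof -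
    have "(\<Sum>t\<in>I. w t * trig_path M A \<omega> t) = (\<Sum>i<2 * M. (\<Sum>t\<in>I. w t * trig_coeff A i t) * \<omega> i)" for \<omega>
      unfolding trig_path_def sum_distrib_left sum_distrib_right
      by (subst sum.swap) (simp add: mult_ac)
    thus ?thesis by (simp add: centred_gaussian_linear)
  qed
qed

lemma process_cov_trig: "process_cov (gauss_seq 1) (trig_path M A) = trig_cov M A"
proof (rule ext, clarify)
  fix s t
  show "process_cov (gauss_seq 1) (trig_path M A) (s, t) = trig_cov M A (s, t)"
    by (simp add: process_cov_def trig_path_def linear_moments linear_covariance sum_trig_coeff_mult)
qed

section \<open>Hoelder norms of trigonometric sums\<close>

lemma abs_sin_diff_le: "\<bar>sin x - sin y\<bar> \<le> \<bar>x - y :: real\<bar>"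
proof -
  have "\<bar>sin x - sin y\<bar> = 2 * (\<bar>sin ((x - y) / 2)\<bar> * \<bar>cos ((x + y) / 2)\<bar>)"
    by (simp add: sin_diff_sin abs_mult)
  also have "\<dots> \<le> 2 * (\<bar>(x - y) / 2\<bar> * 1)"
    by (intro mult_left_mono mult_mono abs_sin_x_le_abs_x) auto
  finally show ?thesis by simp
qed

text \<open>The phase \<open>\<phi>\<close> covers sines and cosines at once.\<close>

lemma abs_trig_sum_le: "\<bar>\<Sum>k<M. c k * sin (u k + \<phi>)\<bar> \<le> (\<Sum>k<M. \<bar>c k\<bar>)"
  for c :: "nat \<Rightarrow> real"
  by (rule order_trans[OF sum_abs]) (auto simp: abs_mult intro!: sum_mono mult_left_le)

text \<open>Interpolation between the Lipschitz bound 2 F d and the trivial bound 2, by min 1 z <=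
  z^\<alpha>. The difference of \<open>u\<close> and \<open>v\<close> may reach \<open>2 * d\<close>
  because both will be values of s - t at points of distance d.\<close>

lemma sin_oscillation:
  fixes \<alpha> \<kappa> F d u v \<phi> :: real
  assumes \<alpha>: "0 < \<alpha>" "\<alpha> \<le> 1" and \<kappa>: "0 \<le> \<kappa>" "\<kappa> \<le> F" and d: "0 < d" "\<bar>u - v\<bar> \<le> 2 * d" and F: "0 < F"
  shows "\<bar>sin (\<kappa> * u + \<phi>) - sin (\<kappa> * v + \<phi>)\<bar> \<le> 2 * F powr \<alpha> * d powr \<alpha>"
proof -
  have "\<bar>sin (\<kappa> * u + \<phi>) - sin (\<kappa> * v + \<phi>)\<bar> \<le> \<kappa> * \<bar>u - v\<bar>"
    using abs_sin_diff_le[of "\<kappa> * u + \<phi>" "\<kappa> * v + \<phi>"] \<kappa> by (simp add: right_diff_distrib[symmetric] abs_mult)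
  also have "\<dots> \<le> F * (2 * d)"
    using \<kappa> d by (intro mult_mono) auto
  finally have 1: "\<bar>sin (\<kappa> * u + \<phi>) - sin (\<kappa> * v + \<phi>)\<bar> \<le> 2 * (F * d)" by simp
  have 2: "\<bar>sin (\<kappa> * u + \<phi>) - sin (\<kappa> * v + \<phi>)\<bar> \<le> 2"
    using sin_le_one[of "\<kappa> * u + \<phi>"] sin_le_one[of "\<kappa> * v + \<phi>"]
      sin_ge_minus_one[of "\<kappa> * u + \<phi>"] sin_ge_minus_one[of "\<kappa> * v + \<phi>"] by linarith
  have "min 1 (F * d) \<le> (F * d) powr \<alpha>"
  proof (cases "F * d \<le> 1")
    case True
    have "(F * d) powr 1 \<le> (F * d) powr \<alpha>"
      using \<alpha> True F d by (intro powr_mono') auto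
    thus ?thesis using F d by simp
  next
    case False
    hence "1 \<le> (F * d) powr \<alpha>" using \<alpha> by (intro ge_one_powr_ge_zero) auto
    thus ?thesis by simp
  qed
  thus ?thesis using 1 2 F d by (simp add: powr_mult min_def split: if_splits)
qed

lemma
  fixes c \<kappa> :: "nat \<Rightarrow> real" and \<phi> :: real and M :: nat
  defines "G \<equiv> \<lambda>(s, t). \<Sum>k<M. c k * sin (\<kappa> k * (s - t) + \<phi>)"
  shows sup_norm_trig_sum: "sup_norm G \<le> ennreal (\<Sum>k<M. \<bar>c k\<bar>)"
    and holder_seminorm_trig_sum: "0 < \<alpha> \<Longrightarrow> \<alpha> \<le> 1 \<Longrightarrow> 0 < F \<Longrightarrow> (\<And>k. k < M \<Longrightarrow> 0 \<le> \<kappa> k \<and> \<kappa> k \<le> F) \<Longrightarrow>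
      holder_seminorm \<alpha> G \<le> ennreal (2 * F powr \<alpha> * (\<Sum>k<M. \<bar>c k\<bar>))"
proof -
  show "sup_norm G \<le> ennreal (\<Sum>k<M. \<bar>c k\<bar>)"
    unfolding sup_norm_def G_def
    by (intro SUP_least ennreal_leI) (auto simp: split_beta intro!: abs_trig_sum_le)
  assume a: "0 < \<alpha>" "\<alpha> \<le> 1" "0 < F" and \<kappa>: "\<And>k. k < M \<Longrightarrow> 0 \<le> \<kappa> k \<and> \<kappa> k \<le> F"
  show "holder_seminorm \<alpha> G \<le> ennreal (2 * F powr \<alpha> * (\<Sum>k<M. \<bar>c k\<bar>))"
    unfolding holder_seminorm_def
  proof (rule SUP_least)
    fix z :: "(real \<times> real) \<times> (real \<times> real)" assume "z \<in> {(x, y). x \<noteq> y}"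
    then obtain s t s' t' where z: "z = ((s, t), (s', t'))" and ne: "(s, t) \<noteq> (s', t')"
      by auto
    define d where "d = dist (s, t) (s', t')"
    have d: "0 < d" using ne by (simp only: d_def zero_less_dist_iff not_False_eq_True)
    have "\<bar>s - s'\<bar> \<le> d" "\<bar>t - t'\<bar> \<le> d"
      using dist_fst_le[of "(s, t)" "(s', t')"] dist_snd_le[of "(s, t)" "(s', t')"]
      by (auto simp: d_def dist_real_def)
    hence st: "\<bar>(s - t) - (s' - t')\<bar> \<le> 2 * d" by linarith
    have "\<bar>G (s, t) - G (s', t')\<bar> =
        \<bar>\<Sum>k<M. c k * (sin (\<kappa> k * (s - t) + \<phi>) - sin (\<kappa> k * (s' - t') + \<phi>))\<bar>"
      by (simp add: G_def sum_subtractf[symmetric] right_diff_distrib)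
    also have "\<dots> \<le> (\<Sum>k<M. \<bar>c k\<bar> * (2 * F powr \<alpha> * d powr \<alpha>))"
      using a \<kappa> d st
      by (intro order_trans[OF sum_abs] sum_mono)
        (auto simp: abs_mult intro!: mult_left_mono sin_oscillation)
    finally have "\<bar>G (s, t) - G (s', t')\<bar> \<le> 2 * F powr \<alpha> * (\<Sum>k<M. \<bar>c k\<bar>) * d powr \<alpha>"
      by (simp add: sum_distrib_right[symmetric] mult_ac)
    hence "\<bar>G (s, t) - G (s', t')\<bar> / d powr \<alpha> \<le> 2 * F powr \<alpha> * (\<Sum>k<M. \<bar>c k\<bar>)"
      using d by (simp add: pos_divide_le_eq)
    thus "(case z of (x, y) \<Rightarrow> ennreal (\<bar>G x - G y\<bar> / dist x y powr \<alpha>)) \<le>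
        ennreal (2 * F powr \<alpha> * (\<Sum>k<M. \<bar>c k\<bar>))"
      unfolding z split d_def by (rule ennreal_leI)
  qed
qed

text \<open>A derivative costs a factor F, and the remaining order \<beta> - 1 a factor 2
  F^(\<beta>-1). As F >= 1, each term is at most a multiple of F^\<beta> times the total weight; 7 =
  1 + 1 + 1 + 2 + 2 counts the function, its two partial derivatives and their two
  seminorms.\<close>

lemma holder_norm_trig_cov:
  assumes \<beta>: "0 < \<beta>" "\<beta> \<le> 2" and F: "1 \<le> F" "\<And>k. k < M \<Longrightarrow> 2 * pi * real k \<le> F"
  shows "holder_norm \<beta> (trig_cov M A) \<le> ennreal (7 * F powr \<beta> * (\<Sum>k<M. (A k)\<^sup>2))"
proof -
  define w where "w = (\<Sum>k<M. (A k)\<^sup>2)"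
  define \<kappa> where "\<kappa> k = 2 * pi * real k" for k
  have w: "0 \<le> w" by (simp add: w_def sum_nonneg)
  have \<kappa>: "0 \<le> \<kappa> k" "k < M \<Longrightarrow> \<kappa> k \<le> F" for k using F by (simp_all add: \<kappa>_def)
  have F\<beta>: "1 \<le> F powr \<beta>" using F \<beta> by (intro ge_one_powr_ge_zero) auto
  \<comment> \<open>A cosine is a sine with phase pi/2, so one estimate serves the covariance and,
    with phase 0, its partial derivatives.\<close>
  have C: "trig_cov M A = (\<lambda>(s, t). \<Sum>k<M. (A k)\<^sup>2 * sin (\<kappa> k * (s - t) + pi / 2))"
    by (simp add: trig_cov_def \<kappa>_def sin_add)
  have sup0: "sup_norm (trig_cov M A) \<le> ennreal w"
    unfolding C using sup_norm_trig_sum[where M=M and c="\<lambda>k. (A k)\<^sup>2" and \<kappa>=\<kappa> and \<phi>="pi/2"] by (simp add: w_def)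
  show ?thesis
  proof (cases "\<beta> \<le> 1")
    case True
    have "holder_seminorm \<beta> (trig_cov M A) \<le> ennreal (2 * F powr \<beta> * w)"
      unfolding C using holder_seminorm_trig_sum[where \<alpha>=\<beta> and F=F and M=M and c="\<lambda>k. (A k)\<^sup>2" and \<kappa>=\<kappa> and \<phi>="pi/2"] \<beta> True F \<kappa>
      by (simp add: w_def)
    hence "holder_norm \<beta> (trig_cov M A) \<le> ennreal w + ennreal (2 * F powr \<beta> * w)"
      using True sup0 by (simp add: holder_norm_def add_mono)
    also have "\<dots> = ennreal (w + 2 * F powr \<beta> * w)"
      using w by simp
    also have "\<dots> \<le> ennreal (7 * F powr \<beta> * w)"
      using w mult_right_mono[OF F\<beta> w] unfolding mult.assoc mult_1 by (intro ennreal_leI) linarith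
    finally show ?thesis by (simp add: w_def)
  next
    case False
    have d1: "((\<lambda>u. trig_cov M A (u, t)) has_real_derivative
        (\<Sum>k<M. (- (A k)\<^sup>2 * \<kappa> k) * sin (\<kappa> k * (s - t) + 0))) (at s)" for s t
      unfolding trig_cov_def split \<kappa>_def[symmetric]
    proof (rule DERIV_sum)
      fix k
      show "((\<lambda>u. (A k)\<^sup>2 * cos (\<kappa> k * (u - t))) has_real_derivative
          (- (A k)\<^sup>2 * \<kappa> k) * sin (\<kappa> k * (s - t) + 0)) (at s)"
        by (rule derivative_eq_intros refl | simp)+
    qed
    have d2: "((\<lambda>u. trig_cov M A (s, u)) has_real_derivative
        (\<Sum>k<M. ((A k)\<^sup>2 * \<kappa> k) * sin (\<kappa> k * (s - t) + 0))) (at t)" for s t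
      unfolding trig_cov_def split \<kappa>_def[symmetric]
    proof (rule DERIV_sum)
      fix k
      show "((\<lambda>u. (A k)\<^sup>2 * cos (\<kappa> k * (s - u))) has_real_derivative
          ((A k)\<^sup>2 * \<kappa> k) * sin (\<kappa> k * (s - t) + 0)) (at t)"
        by (rule derivative_eq_intros refl | simp)+
    qed
    have hp: "has_partials (trig_cov M A)"
      using d1 d2 unfolding has_partials_def real_differentiable_def by blast
    have p1: "partial1 (trig_cov M A) = (\<lambda>(s, t). \<Sum>k<M. (- (A k)\<^sup>2 * \<kappa> k) * sin (\<kappa> k * (s - t) + 0))"
      unfolding partial1_def by (intro ext) (clarsimp simp only: DERIV_imp_deriv[OF d1] split)
    have p2: "partial2 (trig_cov M A) = (\<lambda>(s, t). \<Sum>k<M. ((A k)\<^sup>2 * \<kappa> k) * sin (\<kappa> k * (s - t) + 0))"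
      unfolding partial2_def by (intro ext) (clarsimp simp only: DERIV_imp_deriv[OF d2] split)
    have wF: "(\<Sum>k<M. \<bar>- (A k)\<^sup>2 * \<kappa> k\<bar>) \<le> w * F" "(\<Sum>k<M. \<bar>(A k)\<^sup>2 * \<kappa> k\<bar>) \<le> w * F"
      unfolding w_def sum_distrib_right using \<kappa> by (auto simp: abs_mult intro!: sum_mono mult_left_mono)
    have s1: "sup_norm (partial1 (trig_cov M A)) \<le> ennreal (w * F)"
      unfolding p1 by (rule order_trans[OF sup_norm_trig_sum ennreal_leI[OF wF(1)]])
    have s2: "sup_norm (partial2 (trig_cov M A)) \<le> ennreal (w * F)"
      unfolding p2 by (rule order_trans[OF sup_norm_trig_sum ennreal_leI[OF wF(2)]])
    let ?h = "2 * F powr (\<beta> - 1) * (w * F)"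
    have h1: "holder_seminorm (\<beta> - 1) (partial1 (trig_cov M A)) \<le> ennreal ?h"
      unfolding p1 by (rule order_trans[OF holder_seminorm_trig_sum[where F=F] ennreal_leI[OF mult_left_mono[OF wF(1)]]])
        (use False \<beta> F \<kappa> in auto)
    have h2: "holder_seminorm (\<beta> - 1) (partial2 (trig_cov M A)) \<le> ennreal ?h"
      unfolding p2 by (rule order_trans[OF holder_seminorm_trig_sum[where F=F] ennreal_leI[OF mult_left_mono[OF wF(2)]]])
        (use False \<beta> F \<kappa> in auto)
    have "F powr (\<beta> - 1) * F = F powr \<beta>" using F by (simp add: powr_diff)
    hence h: "?h = 2 * (F powr \<beta> * w)" by (metis mult.assoc mult.commute)
    have "F powr 1 \<le> F powr \<beta>" using False F by (intro powr_mono) auto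
    hence "w * F \<le> F powr \<beta> * w" using F w by (subst mult.commute) (auto intro!: mult_right_mono)
    moreover have "w \<le> F powr \<beta> * w" using mult_right_mono[OF F\<beta> w] by simp
    ultimately have le: "w + w * F + w * F + ?h + ?h \<le> 7 * F powr \<beta> * w"
      unfolding h unfolding mult.assoc by linarith
    have "holder_norm \<beta> (trig_cov M A) = sup_norm (trig_cov M A) + sup_norm (partial1 (trig_cov M A)) +
        sup_norm (partial2 (trig_cov M A)) + holder_seminorm (\<beta> - 1) (partial1 (trig_cov M A)) +
        holder_seminorm (\<beta> - 1) (partial2 (trig_cov M A))"
      using False hp by (simp only: holder_norm_def if_False if_True)
    also have "\<dots> \<le> ennreal w + ennreal (w * F) + ennreal (w * F) + ennreal ?h + ennreal ?h"
      by (intro add_mono sup0 s1 s2 h1 h2)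
    also have "\<dots> = ennreal (w + w * F + w * F + ?h + ?h)"
    proof -
      have "0 \<le> w * F" "0 \<le> ?h" using w F by simp_all
      thus ?thesis using w by (simp only: ennreal_plus add_nonneg_nonneg)
    qed
    also have "\<dots> \<le> ennreal (7 * F powr \<beta> * w)"
      by (rule ennreal_leI[OF le])
    finally show ?thesis by (simp add: w_def)
  qed
qed

section \<open>Membership of trigonometric models in the class\<close>

definition trig_model :: "fda_model \<Rightarrow> real \<Rightarrow> nat \<Rightarrow> (nat \<Rightarrow> real) \<Rightarrow> fda_model" where
  "trig_model P \<sigma> M A = P\<lparr>path_space := gauss_seq 1, path := trig_path M A, err_law := gauss \<sigma>\<rparr>"

lemma trig_model_simps [simp]:
  "path_space (trig_model P \<sigma> M A) = gauss_seq 1" "path (trig_model P \<sigma> M A) = trig_path M A"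
  "err_law (trig_model P \<sigma> M A) = gauss \<sigma>" "design (trig_model P \<sigma> M A) = design P"
  "count_law (trig_model P \<sigma> M A) = count_law P"
  by (simp_all add: trig_model_def)

lemma model_cov_trig_model [simp]: "model_cov (trig_model P \<sigma> M A) = trig_cov M A"
  by (simp add: model_cov_def process_cov_trig)

text \<open>The hypotheses are budgets: \<open>A4\<close> limits the noise level and the total
  weight, \<open>A1\<close> limits the weight times F^\<beta>. Stationarity gives the invariance for
  every \<open>q\<close>.\<close>

lemma trig_model_in_class:
  assumes P: "P \<in> model_class k Q q \<beta> R m" and \<beta>: "0 < \<beta>" "\<beta> \<le> 2"
    and \<sigma>: "0 < \<sigma>" "2 * \<sigma> \<le> mom_const k" and w: "4 * (\<Sum>k<M. (A k)\<^sup>2) \<le> (mom_const k)\<^sup>2"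
    and F: "1 \<le> F" "\<And>k. k < M \<Longrightarrow> 2 * pi * real k \<le> F" "7 * F powr \<beta> * (\<Sum>k<M. (A k)\<^sup>2) \<le> R"
  shows "trig_model P \<sigma> M A \<in> model_class k Q q \<beta> R m"
proof -
  let ?P = "trig_model P \<sigma> M A" and ?w = "\<Sum>k<M. (A k)\<^sup>2"
  have des: "design_law ?P = design_law P" by (simp add: design_law_def)
  have P': "fda_valid P" "A2 k P" "A3 k P" "A4 k P" "A5 Q P" "intensity k m P"
    using P by (auto simp: model_class_def)
  have "fda_valid ?P"
    using P'(1) \<sigma> prob_space_gauss[of \<sigma>] prob_space_gauss_seq[of 1] integrable_gauss_moment[of \<sigma> 2]
    by (simp add: fda_valid_def des centred_gaussian_process_trig integral_gauss_id)
  moreover have "A1 \<beta> R ?P"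
    using order_trans[OF holder_norm_trig_cov[OF \<beta> F(1,2)] ennreal_leI[OF F(3)]] by (simp add: A1_def)
  moreover have "A2 k ?P" "A3 k ?P" "A5 Q ?P" "intensity k m ?P"
    using P' by (simp_all add: A2_def A3_def A5_def intensity_def)
  moreover have "A4 k ?P"
    unfolding A4_def
  proof (intro allI impI conjI)
    fix p :: real assume p: "1 \<le> p"
    have "2 * sqrt ?w \<le> mom_const k"
    proof (rule power2_le_imp_le)
      have "0 \<le> ?w" by (rule sum_nonneg) simp
      hence "(2 * sqrt ?w)\<^sup>2 = 4 * ?w" by (simp only: power_mult_distrib real_sqrt_pow2) simp
      thus "(2 * sqrt ?w)\<^sup>2 \<le> (mom_const k)\<^sup>2" using w by (simp only:)
      show "0 \<le> mom_const k" using \<sigma> by linarith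
    qed
    thus "Lp_norm (path_space ?P) p (\<lambda>\<omega>. path ?P \<omega> t) \<le> ennreal (mom_const k * sqrt p)" for t
      using p distr_gauss_seq_linear[of "\<lambda>i. trig_coeff A i t" "2 * M"]
      by (intro Lp_norm_centred_normal[where \<tau>="sqrt ?w"])
        (simp_all add: trig_path_def sum_trig_coeff_square sum_nonneg)
    have "distr (gauss \<sigma>) borel (\<lambda>x. x) = gauss \<sigma>"
      by (rule distr_id2) simp
    thus "Lp_norm (err_law ?P) p (\<lambda>x. x) \<le> ennreal (mom_const k * sqrt p)"
      using p \<sigma> by (intro Lp_norm_centred_normal[where \<tau>=\<sigma>]) (simp_all add: centred_normal_gauss)
  qed
  moreover have "invariant_cov q (trig_cov M A)"
    by (simp add: invariant_cov_def trig_cov_def)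
  ultimately show ?thesis by (simp add: model_class_def)
qed

section \<open>Likelihood ratio of a random wave in noise\<close>

text \<open>Used for the cosine and sine coefficients of one frequency, redrawn together as a point
  of the plane.\<close>

lemma nn_integral_PiM_resample2:
  fixes i j :: 'i and F :: "('i \<Rightarrow> 'a) \<Rightarrow> ennreal"
  assumes "prob_space M" and [measurable]: "F \<in> borel_measurable (\<Pi>\<^sub>M i\<in>(UNIV :: 'i set). M)"
  shows "(\<integral>\<^sup>+w. F w \<partial>(\<Pi>\<^sub>M i\<in>(UNIV :: 'i set). M)) =
    (\<integral>\<^sup>+w. \<integral>\<^sup>+z. F (w(j := snd z, i := fst z)) \<partial>(M \<Otimes>\<^sub>M M) \<partial>(\<Pi>\<^sub>M i\<in>(UNIV :: 'i set). M))"
proof -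
  interpret M: prob_space M by fact
  interpret PS: pair_sigma_finite M M by standard
  have upd [measurable]: "(\<lambda>(w, x). w(l := x)) \<in> ((\<Pi>\<^sub>M i\<in>(UNIV :: 'i set). M) \<Otimes>\<^sub>M M) \<rightarrow>\<^sub>M (\<Pi>\<^sub>M i\<in>(UNIV :: 'i set). M)" for l
    by (rule measurable_PiM_single') (auto simp: space_pair_measure space_PiM split_beta fun_upd_def)
  have "(\<integral>\<^sup>+w. F w \<partial>(\<Pi>\<^sub>M i\<in>(UNIV :: 'i set). M)) = (\<integral>\<^sup>+w. \<integral>\<^sup>+x. F (w(i := x)) \<partial>M \<partial>(\<Pi>\<^sub>M i\<in>(UNIV :: 'i set). M))"
    using assms by (rule nn_integral_PiM_resample)
  also have "\<dots> = (\<integral>\<^sup>+w. \<integral>\<^sup>+y. \<integral>\<^sup>+x. F ((w(j := y))(i := x)) \<partial>M \<partial>M \<partial>(\<Pi>\<^sub>M i\<in>(UNIV :: 'i set). M))"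
    by (rule nn_integral_PiM_resample[OF assms(1)]) measurable
  also have "\<dots> = (\<integral>\<^sup>+w. \<integral>\<^sup>+z. F (w(j := snd z, i := fst z)) \<partial>(M \<Otimes>\<^sub>M M) \<partial>(\<Pi>\<^sub>M i\<in>(UNIV :: 'i set). M))"
  proof (rule nn_integral_cong)
    fix w assume [measurable]: "w \<in> space (\<Pi>\<^sub>M i\<in>(UNIV :: 'i set). M)"
    have "(\<lambda>z. F (w(j := snd z, i := fst z))) \<in> borel_measurable (M \<Otimes>\<^sub>M M)"
      by measurable
    from PS.nn_integral_snd[OF this]
    show "(\<integral>\<^sup>+y. \<integral>\<^sup>+x. F ((w(j := y))(i := x)) \<partial>M \<partial>M) =
        (\<integral>\<^sup>+z. F (w(j := snd z, i := fst z)) \<partial>(M \<Otimes>\<^sub>M M))" by simp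
  qed
  finally show ?thesis .
qed

lemma nn_integral_pair_mult:
  assumes "sigma_finite_measure N" and [measurable]: "f \<in> borel_measurable M" "g \<in> borel_measurable N"
  shows "(\<integral>\<^sup>+z. f (fst z) * g (snd z) \<partial>(M \<Otimes>\<^sub>M N)) = (\<integral>\<^sup>+x. f x \<partial>M) * (\<integral>\<^sup>+y. g y \<partial>N)"
proof -
  interpret sigma_finite_measure N by fact
  have "(\<integral>\<^sup>+z. f (fst z) * g (snd z) \<partial>(M \<Otimes>\<^sub>M N)) = (\<integral>\<^sup>+x. \<integral>\<^sup>+y. f x * g y \<partial>N \<partial>M)"
    by (subst nn_integral_fst[symmetric]) auto
  also have "\<dots> = (\<integral>\<^sup>+x. f x * (\<integral>\<^sup>+y. g y \<partial>N) \<partial>M)"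
    by (intro nn_integral_cong nn_integral_cmult) simp
  also have "\<dots> = (\<integral>\<^sup>+x. f x \<partial>M) * (\<integral>\<^sup>+y. g y \<partial>N)"
    by (rule nn_integral_multc) simp
  finally show ?thesis .
qed

definition wave :: "nat \<Rightarrow> real \<times> real \<Rightarrow> real \<Rightarrow> real" where
  "wave k \<theta> t = fst \<theta> * cos (2 * pi * real k * t) + snd \<theta> * sin (2 * pi * real k * t)"

abbreviation gauss_pair :: "(real \<times> real) measure" where
  "gauss_pair \<equiv> gauss 1 \<Otimes>\<^sub>M gauss 1"

lemma prob_space_gauss_pair: "prob_space gauss_pair"
  by (intro prob_space_pair prob_space_gauss) simp_all

text \<open>The left-hand side is the squared modulus of the sum of
  \<open>wave k \<theta> (T j)\<close> times the unit vector of angle 2 pi k \<open>T j\<close>.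
  Each term has modulus at most that of \<theta>, so the triangle inequality suffices, for arbitrary
  sampling times. Bounding the two sums separately would lose a factor 2.\<close>

lemma sum_wave_mult_square_le:
  "(\<Sum>j<N. cos (2 * pi * real k * T j) * wave k \<theta> (T j))\<^sup>2 + (\<Sum>j<N. sin (2 * pi * real k * T j) * wave k \<theta> (T j))\<^sup>2
    \<le> (real N)\<^sup>2 * ((fst \<theta>)\<^sup>2 + (snd \<theta>)\<^sup>2)"
proof -
  define z where "z = Complex (fst \<theta>) (snd \<theta>)"
  have "\<bar>wave k \<theta> t\<bar> \<le> cmod z" for t
  proof -
    have "wave k \<theta> t = Re (z * cnj (cis (2 * pi * real k * t)))"
      by (simp add: wave_def z_def)
    also have "\<bar>\<dots>\<bar> \<le> cmod (z * cnj (cis (2 * pi * real k * t)))"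
      by (rule abs_Re_le_cmod)
    also have "\<dots> = cmod z" by (simp add: norm_mult)
    finally show ?thesis .
  qed
  hence "cmod (\<Sum>j<N. complex_of_real (wave k \<theta> (T j)) * cis (2 * pi * real k * T j)) \<le> (\<Sum>j<N. cmod z)"
    by (intro order_trans[OF norm_sum] sum_mono) (simp add: norm_mult)
  hence "(cmod (\<Sum>j<N. complex_of_real (wave k \<theta> (T j)) * cis (2 * pi * real k * T j)))\<^sup>2 \<le> (real N * cmod z)\<^sup>2"
    by (intro power_mono) simp_all
  thus ?thesis
    by (simp add: cmod_power2 z_def power_mult_distrib mult.commute)
qed

text \<open>
  No term linear in \<open>a\<^sup>2 N / \<sigma>\<^sup>2\<close> appears, because the likelihood ratio is averaged over \<open>\<theta>\<close> before it is
  squared; this is what produces \<open>n m\<^sup>2\<close> rather than \<open>n m\<close> in the rate.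
\<close>

lemma wave_chi_square:
  assumes "0 < \<sigma>" and x: "x = a\<^sup>2 / \<sigma>\<^sup>2" "x * real N < 1"
  shows "(\<integral>\<^sup>+\<theta>. \<integral>\<^sup>+\<theta>'. ennreal (exp ((\<Sum>j<N. (a * wave k \<theta> (T j)) * (a * wave k \<theta>' (T j))) / \<sigma>\<^sup>2)) \<partial>gauss_pair \<partial>gauss_pair)
    \<le> ennreal (1 / (1 - (x * real N)\<^sup>2))"
proof -
  interpret prob_space "gauss 1" by (rule prob_space_gauss) simp
  define g1 where "g1 \<theta> = (\<Sum>j<N. cos (2 * pi * real k * T j) * wave k \<theta> (T j))" for \<theta>
  define g2 where "g2 \<theta> = (\<Sum>j<N. sin (2 * pi * real k * T j) * wave k \<theta> (T j))" for \<theta>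
  define y where "y = (x * real N)\<^sup>2"
  have "0 \<le> x" using x by simp
  hence y: "y < 1" "0 \<le> y" using x by (simp_all add: y_def power_less_one_iff abs_square_less_1)
  \<comment> \<open>For fixed \<theta> the exponent is linear in \<theta>', so the inner integral is
    a Gaussian Laplace transform. Its bound is the exponential of a multiple of |\<theta>|^2,
    integrable because y < 1.\<close>
  have inner: "(\<integral>\<^sup>+\<theta>'. ennreal (exp ((\<Sum>j<N. (a * wave k \<theta> (T j)) * (a * wave k \<theta>' (T j))) / \<sigma>\<^sup>2)) \<partial>gauss_pair)
      \<le> ennreal (exp (y * (fst \<theta>)\<^sup>2 / 2)) * ennreal (exp (y * (snd \<theta>)\<^sup>2 / 2))" for \<theta>
  proof -
    have eq: "(\<Sum>j<N. (a * wave k \<theta> (T j)) * (a * wave k \<theta>' (T j))) / \<sigma>\<^sup>2 =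
        (x * g1 \<theta>) * fst \<theta>' + (x * g2 \<theta>) * snd \<theta>'" for \<theta>'
    proof -
      have "(\<Sum>j<N. (a * wave k \<theta> (T j)) * (a * wave k \<theta>' (T j))) = a\<^sup>2 * (g1 \<theta> * fst \<theta>' + g2 \<theta> * snd \<theta>')"
        unfolding g1_def g2_def sum_distrib_right sum.distrib[symmetric] sum_distrib_left
        by (intro sum.cong) (simp_all add: wave_def[of _ \<theta>'] power2_eq_square algebra_simps)
      thus ?thesis by (simp add: x algebra_simps add_divide_distrib)
    qed
    have "(\<integral>\<^sup>+\<theta>'. ennreal (exp ((\<Sum>j<N. (a * wave k \<theta> (T j)) * (a * wave k \<theta>' (T j))) / \<sigma>\<^sup>2)) \<partial>gauss_pair) =
        (\<integral>\<^sup>+\<theta>'. ennreal (exp ((x * g1 \<theta>) * fst \<theta>')) * ennreal (exp ((x * g2 \<theta>) * snd \<theta>')) \<partial>gauss_pair)"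
      by (simp only: eq exp_add ennreal_mult exp_ge_zero)
    also have "\<dots> = ennreal (exp (1\<^sup>2 * (x * g1 \<theta>)\<^sup>2 / 2)) * ennreal (exp (1\<^sup>2 * (x * g2 \<theta>)\<^sup>2 / 2))"
      by (subst nn_integral_pair_mult[OF sigma_finite_measure_axioms]) (simp_all only: nn_integral_gauss_exp zero_less_one, measurable)
    also have "\<dots> = ennreal (exp (x\<^sup>2 * ((g1 \<theta>)\<^sup>2 + (g2 \<theta>)\<^sup>2) / 2))"
      by (simp add: ennreal_mult[symmetric] exp_add[symmetric] power_mult_distrib distrib_left add_divide_distrib)
    also have "\<dots> \<le> ennreal (exp (x\<^sup>2 * ((real N)\<^sup>2 * ((fst \<theta>)\<^sup>2 + (snd \<theta>)\<^sup>2)) / 2))"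
      using sum_wave_mult_square_le[of k T \<theta> N] unfolding g1_def g2_def
      by (intro ennreal_leI) (simp add: mult_left_mono)
    also have "\<dots> = ennreal (exp (y * (fst \<theta>)\<^sup>2 / 2)) * ennreal (exp (y * (snd \<theta>)\<^sup>2 / 2))"
      by (simp add: ennreal_mult[symmetric] exp_add[symmetric] y_def power_mult_distrib distrib_left add_divide_distrib mult.assoc)
    finally show ?thesis .
  qed
  have "(\<integral>\<^sup>+\<theta>. \<integral>\<^sup>+\<theta>'. ennreal (exp ((\<Sum>j<N. (a * wave k \<theta> (T j)) * (a * wave k \<theta>' (T j))) / \<sigma>\<^sup>2)) \<partial>gauss_pair \<partial>gauss_pair)
      \<le> (\<integral>\<^sup>+\<theta>. ennreal (exp (y * (fst \<theta>)\<^sup>2 / 2)) * ennreal (exp (y * (snd \<theta>)\<^sup>2 / 2)) \<partial>gauss_pair)"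
    by (intro nn_integral_mono inner)
  \<comment> \<open>One root for each of the two coefficients; the product is rational in y.\<close>
  also have "\<dots> = ennreal (1 / sqrt (1 - y)) * ennreal (1 / sqrt (1 - y))"
    using y by (subst nn_integral_pair_mult[OF sigma_finite_measure_axioms]) (simp_all only: nn_integral_gauss_exp_square, measurable)
  also have "\<dots> = ennreal (1 / (1 - y))"
    using y by (simp add: ennreal_mult[symmetric])
  finally show ?thesis by (simp add: y_def)
qed

section \<open>Likelihood ratio of a single subject\<close>

definition noise_law :: "fda_model \<Rightarrow> real \<Rightarrow> (nat \<times> (nat \<Rightarrow> real) \<times> (nat \<Rightarrow> real)) measure" where
  "noise_law P \<sigma> = measure_pmf (count_law P) \<Otimes>\<^sub>M ((\<Pi>\<^sub>M j\<in>UNIV. design_law P) \<Otimes>\<^sub>M gauss_seq \<sigma>)"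

lemma subject_law_trig_model: "subject_law (trig_model P \<sigma> M A) = gauss_seq 1 \<Otimes>\<^sub>M noise_law P \<sigma>"
  by (simp add: subject_law_def noise_law_def design_law_def)

lemma sets_design_law [simp, measurable_cong]: "sets (design_law P) = sets borel"
  and space_design_law [simp]: "space (design_law P) = UNIV"
  by (simp_all add: design_law_def)

definition wave_density :: "real \<Rightarrow> real \<Rightarrow> nat \<Rightarrow> real \<times> real \<Rightarrow> nat \<times> (nat \<Rightarrow> real) \<times> (nat \<Rightarrow> real) \<Rightarrow> ennreal" where
  "wave_density \<sigma> a k \<theta> r = shift_density \<sigma> (fst r) (\<lambda>j. a * wave k \<theta> (fst (snd r) j)) (snd (snd r))"

text \<open>Mixture over the coefficients of the added wave. The amplitudes of the other waves do
  not occur: on the sample space those waves are a known shift.\<close>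

definition wave_likelihood :: "real \<Rightarrow> real \<Rightarrow> nat \<Rightarrow> nat \<times> (nat \<Rightarrow> real) \<times> (nat \<Rightarrow> real) \<Rightarrow> ennreal" where
  "wave_likelihood \<sigma> a k r = (\<integral>\<^sup>+\<theta>. wave_density \<sigma> a k \<theta> r \<partial>gauss_pair)"

definition subject_data_space :: "subject_data measure" where
  "subject_data_space = count_space UNIV \<Otimes>\<^sub>M (\<Pi>\<^sub>M j\<in>UNIV. (borel :: (real \<times> real) measure))"

lemma borel_measurable_wave_density_fixed [measurable (raw)]:
  assumes [measurable]: "f \<in> M \<rightarrow>\<^sub>M borel \<Otimes>\<^sub>M borel" "g \<in> M \<rightarrow>\<^sub>M (\<Pi>\<^sub>M j\<in>UNIV. borel)"
  shows "(\<lambda>x. wave_density \<sigma> a k (f x) (N, T, g x)) \<in> borel_measurable M"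
  unfolding wave_density_def shift_density_def wave_def by simp

lemma trig_path_upd:
  assumes "k < M" "A k = 0"
  shows "trig_path M (A(k := a)) \<omega> t = trig_path M A \<omega> t + a * wave k (\<omega> (2 * k), \<omega> (Suc (2 * k))) t"
proof -
  let ?f = "\<lambda>A i. A i * (\<omega> (2 * i) * cos (2 * pi * real i * t) + \<omega> (Suc (2 * i)) * sin (2 * pi * real i * t))"
  have "trig_path M (A(k := a)) \<omega> t = (\<Sum>i<M. ?f A i + (if i = k then a * wave k (\<omega> (2 * k), \<omega> (Suc (2 * k))) t else 0))"
    unfolding trig_path_eq using assms by (intro sum.cong) (auto simp: wave_def)
  thus ?thesis
    using assms by (simp add: sum.distrib trig_path_eq)
qed

text \<open>A frequency of amplitude 0 leaves its two coefficients out of the path, so they are free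
  to drive the wave that is added.\<close>

lemma trig_path_indep:
  assumes "A k = 0"
  shows "trig_path M A (w(Suc (2 * k) := y, 2 * k := x)) t = trig_path M A w t"
proof -
  have "A i * ((w(Suc (2 * k) := y, 2 * k := x)) (2 * i) * c + (w(Suc (2 * k) := y, 2 * k := x)) (Suc (2 * i)) * s) =
      A i * (w (2 * i) * c + w (Suc (2 * i)) * s)" for i c s
    using assms by (cases "i = k") (auto simp: Suc_double_not_eq_double double_not_eq_Suc_double)
  thus ?thesis by (simp only: trig_path_eq)
qed

context
  fixes P :: fda_model and \<sigma> :: real
  assumes P: "prob_space (design_law P)" and \<sigma>: "0 < \<sigma>"
begin

lemma prob_space_noise_law: "prob_space (noise_law P \<sigma>)"
  unfolding noise_law_def using P \<sigma>
  by (intro prob_space_pair prob_space_PiM prob_space_gauss measure_pmf.prob_space_axioms) auto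

lemma borel_measurable_wave_density [measurable]:
  "(\<lambda>z. wave_density \<sigma> a k (fst z) (snd z)) \<in> borel_measurable (gauss_pair \<Otimes>\<^sub>M noise_law P \<sigma>)"
proof -
  \<comment> \<open>The number of factors varies with the count; since the count is discrete, it may
    be fixed first.\<close>
  have "(\<lambda>z. shift_density \<sigma> N (\<lambda>j. a * wave k (fst z) (fst (snd (snd z)) j)) (snd (snd (snd z))))
      \<in> borel_measurable (gauss_pair \<Otimes>\<^sub>M noise_law P \<sigma>)" for N
    unfolding shift_density_def noise_law_def wave_def by measurable
  moreover have "(\<lambda>z. fst (snd z)) \<in> gauss_pair \<Otimes>\<^sub>M noise_law P \<sigma> \<rightarrow>\<^sub>M count_space UNIV"
    unfolding noise_law_def by measurable
  ultimately show ?thesis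
    unfolding wave_density_def by (rule measurable_compose_countable)
qed

lemma measurable_wave_density_compose:
  assumes "f \<in> M \<rightarrow>\<^sub>M gauss_pair" "g \<in> M \<rightarrow>\<^sub>M noise_law P \<sigma>"
  shows "(\<lambda>x. wave_density \<sigma> a k (f x) (g x)) \<in> borel_measurable M"
  using measurable_compose[OF measurable_Pair[OF assms] borel_measurable_wave_density] by simp

lemma borel_measurable_wave_likelihood [measurable]:
  "wave_likelihood \<sigma> a k \<in> borel_measurable (noise_law P \<sigma>)"
proof -
  interpret prob_space gauss_pair by (rule prob_space_gauss_pair)
  have "(\<lambda>z. wave_density \<sigma> a k (snd z) (fst z)) \<in> borel_measurable (noise_law P \<sigma> \<Otimes>\<^sub>M gauss_pair)"
    by (intro measurable_wave_density_compose measurable_fst measurable_snd)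
  thus ?thesis unfolding wave_likelihood_def[abs_def]
    by (intro borel_measurable_nn_integral) (simp add: split_beta)
qed

lemma measurable_subject_obs [measurable]:
  "subject_obs (trig_model P \<sigma> M A) \<in> gauss_seq 1 \<Otimes>\<^sub>M noise_law P \<sigma> \<rightarrow>\<^sub>M subject_data_space"
proof -
  have 1: "(\<lambda>z. (N, \<lambda>j. if j < N then (fst (snd (snd z)) j, trig_path M A (fst z) (fst (snd (snd z)) j) + snd (snd (snd z)) j) else (0, 0)))
      \<in> gauss_seq 1 \<Otimes>\<^sub>M noise_law P \<sigma> \<rightarrow>\<^sub>M subject_data_space" for N :: nat
    unfolding subject_data_space_def
  proof (intro measurable_Pair measurable_PiM_single')
    fix j
    show "(\<lambda>z. if j < N then (fst (snd (snd z)) j, trig_path M A (fst z) (fst (snd (snd z)) j) + snd (snd (snd z)) j) else (0, 0))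
      \<in> borel_measurable (gauss_seq 1 \<Otimes>\<^sub>M noise_law P \<sigma>)"
      unfolding trig_path_def noise_law_def by measurable
  qed auto
  have "(\<lambda>z. fst (snd z)) \<in> gauss_seq 1 \<Otimes>\<^sub>M noise_law P \<sigma> \<rightarrow>\<^sub>M count_space UNIV"
    unfolding noise_law_def by measurable
  from measurable_compose_countable[where f="\<lambda>N z. (N, \<lambda>j. if j < N then (fst (snd (snd z)) j, trig_path M A (fst z) (fst (snd (snd z)) j) + snd (snd (snd z)) j) else (0, 0))",
    OF 1 this]
  show ?thesis by (simp add: subject_obs_def split_beta' cong: if_cong)
qed

lemma nn_integral_noise_law:
  assumes [measurable]: "F \<in> borel_measurable (noise_law P \<sigma>)"
  shows "(\<integral>\<^sup>+r. F r \<partial>noise_law P \<sigma>) =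
    (\<integral>\<^sup>+N. \<integral>\<^sup>+T. \<integral>\<^sup>+\<epsilon>. F (N, T, \<epsilon>) \<partial>gauss_seq \<sigma> \<partial>(\<Pi>\<^sub>M j\<in>UNIV. design_law P) \<partial>measure_pmf (count_law P))"
proof -
  interpret E: prob_space "gauss_seq \<sigma>" using \<sigma> by (rule prob_space_gauss_seq)
  interpret T: prob_space "\<Pi>\<^sub>M j\<in>(UNIV :: nat set). design_law P" using P by (intro prob_space_PiM)
  interpret TE: pair_sigma_finite "\<Pi>\<^sub>M j\<in>(UNIV :: nat set). design_law P" "gauss_seq \<sigma>" by standard
  interpret TE': prob_space "(\<Pi>\<^sub>M j\<in>(UNIV :: nat set). design_law P) \<Otimes>\<^sub>M gauss_seq \<sigma>"
    by (intro prob_space_pair T.prob_space_axioms E.prob_space_axioms)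
  have F [measurable]: "F \<in> borel_measurable (measure_pmf (count_law P) \<Otimes>\<^sub>M ((\<Pi>\<^sub>M j\<in>UNIV. design_law P) \<Otimes>\<^sub>M gauss_seq \<sigma>))"
    using assms by (simp add: noise_law_def)
  have "(\<integral>\<^sup>+r. F r \<partial>noise_law P \<sigma>) =
    (\<integral>\<^sup>+N. \<integral>\<^sup>+z. F (N, z) \<partial>((\<Pi>\<^sub>M j\<in>UNIV. design_law P) \<Otimes>\<^sub>M gauss_seq \<sigma>) \<partial>measure_pmf (count_law P))"
    unfolding noise_law_def by (rule sigma_finite_measure.nn_integral_fst[OF prob_space_imp_sigma_finite[OF TE'.prob_space_axioms], symmetric]) (rule F)
  also have "\<dots> = (\<integral>\<^sup>+N. \<integral>\<^sup>+T. \<integral>\<^sup>+\<epsilon>. F (N, T, \<epsilon>) \<partial>gauss_seq \<sigma> \<partial>(\<Pi>\<^sub>M j\<in>UNIV. design_law P) \<partial>measure_pmf (count_law P))"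
    by (intro nn_integral_cong E.nn_integral_fst[symmetric]) simp
  finally show ?thesis .
qed

lemma nn_integral_wave_likelihood:
  "(\<integral>\<^sup>+\<epsilon>. wave_likelihood \<sigma> a k (N, T, \<epsilon>) \<partial>gauss_seq \<sigma>) = 1"
proof -
  interpret E: prob_space "gauss_seq \<sigma>" using \<sigma> by (rule prob_space_gauss_seq)
  interpret G: prob_space gauss_pair by (rule prob_space_gauss_pair)
  interpret EG: pair_sigma_finite "gauss_seq \<sigma>" gauss_pair by standard
  have "(\<lambda>z. wave_density \<sigma> a k (snd z) (N, T, fst z)) \<in> borel_measurable (gauss_seq \<sigma> \<Otimes>\<^sub>M gauss_pair)"
    unfolding wave_density_def shift_density_def wave_def by simp
  hence "(\<integral>\<^sup>+\<epsilon>. wave_likelihood \<sigma> a k (N, T, \<epsilon>) \<partial>gauss_seq \<sigma>) =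
      (\<integral>\<^sup>+\<theta>. \<integral>\<^sup>+\<epsilon>. wave_density \<sigma> a k \<theta> (N, T, \<epsilon>) \<partial>gauss_seq \<sigma> \<partial>gauss_pair)"
    unfolding wave_likelihood_def by (intro EG.Fubini'[symmetric]) (simp add: split_beta)
  \<comment> \<open>The zero shift has density 1, so the product formula with a second shift of zero
    computes the mass.\<close>
  also have "\<dots> = (\<integral>\<^sup>+\<theta>. 1 \<partial>gauss_pair)"
    using nn_integral_shift_density_mult[OF \<sigma>, of N _ "\<lambda>_. 0"]
    by (intro nn_integral_cong) (simp add: wave_density_def shift_density_def[of _ _ "\<lambda>_. 0"])
  finally show ?thesis by (simp add: G.emeasure_space_1)
qed

text \<open>The square of a mixture is a double integral over independent copies \<theta> and
  \<theta>'. Integrating out the errors first leaves the exponential of an inner product, which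
  \<open>wave_chi_square\<close> bounds.\<close>

lemma nn_integral_wave_likelihood_square:
  assumes x: "x = a\<^sup>2 / \<sigma>\<^sup>2" "x * real N < 1"
  shows "(\<integral>\<^sup>+\<epsilon>. (wave_likelihood \<sigma> a k (N, T, \<epsilon>))\<^sup>2 \<partial>gauss_seq \<sigma>) \<le> ennreal (1 / (1 - (x * real N)\<^sup>2))"
proof -
  interpret E: prob_space "gauss_seq \<sigma>" using \<sigma> by (rule prob_space_gauss_seq)
  interpret G: prob_space gauss_pair by (rule prob_space_gauss_pair)
  interpret EG: pair_sigma_finite "gauss_seq \<sigma>" gauss_pair by standard
  let ?w = "\<lambda>\<theta> \<epsilon>. wave_density \<sigma> a k \<theta> (N, T, \<epsilon>)"
  have "(wave_likelihood \<sigma> a k (N, T, \<epsilon>))\<^sup>2 = (\<integral>\<^sup>+\<theta>. \<integral>\<^sup>+\<theta>'. ?w \<theta> \<epsilon> * ?w \<theta>' \<epsilon> \<partial>gauss_pair \<partial>gauss_pair)" for \<epsilon>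
  proof -
    have [measurable]: "(\<lambda>\<theta>. ?w \<theta> \<epsilon>) \<in> borel_measurable gauss_pair"
      unfolding wave_density_def shift_density_def wave_def by simp
    show ?thesis
      by (simp add: wave_likelihood_def power2_eq_square nn_integral_cmult nn_integral_multc)
  qed
  hence "(\<integral>\<^sup>+\<epsilon>. (wave_likelihood \<sigma> a k (N, T, \<epsilon>))\<^sup>2 \<partial>gauss_seq \<sigma>) =
      (\<integral>\<^sup>+\<epsilon>. \<integral>\<^sup>+\<theta>. \<integral>\<^sup>+\<theta>'. ?w \<theta> \<epsilon> * ?w \<theta>' \<epsilon> \<partial>gauss_pair \<partial>gauss_pair \<partial>gauss_seq \<sigma>)"
    by simp
  also have "\<dots> = (\<integral>\<^sup>+\<theta>. \<integral>\<^sup>+\<epsilon>. \<integral>\<^sup>+\<theta>'. ?w \<theta> \<epsilon> * ?w \<theta>' \<epsilon> \<partial>gauss_pair \<partial>gauss_seq \<sigma> \<partial>gauss_pair)"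
    by (rule EG.Fubini'[symmetric]) measurable
  also have "\<dots> = (\<integral>\<^sup>+\<theta>. \<integral>\<^sup>+\<theta>'. \<integral>\<^sup>+\<epsilon>. ?w \<theta> \<epsilon> * ?w \<theta>' \<epsilon> \<partial>gauss_seq \<sigma> \<partial>gauss_pair \<partial>gauss_pair)"
  proof (rule nn_integral_cong)
    fix \<theta>
    have [measurable]: "(\<lambda>\<epsilon>. ?w \<theta> \<epsilon>) \<in> borel_measurable (gauss_seq \<sigma>)"
      unfolding wave_density_def shift_density_def wave_def by simp
    show "(\<integral>\<^sup>+\<epsilon>. \<integral>\<^sup>+\<theta>'. ?w \<theta> \<epsilon> * ?w \<theta>' \<epsilon> \<partial>gauss_pair \<partial>gauss_seq \<sigma>) =
        (\<integral>\<^sup>+\<theta>'. \<integral>\<^sup>+\<epsilon>. ?w \<theta> \<epsilon> * ?w \<theta>' \<epsilon> \<partial>gauss_seq \<sigma> \<partial>gauss_pair)"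
      by (rule EG.Fubini'[symmetric]) measurable
  qed
  also have "\<dots> = (\<integral>\<^sup>+\<theta>. \<integral>\<^sup>+\<theta>'. ennreal (exp ((\<Sum>j<N. (a * wave k \<theta> (T j)) * (a * wave k \<theta>' (T j))) / \<sigma>\<^sup>2)) \<partial>gauss_pair \<partial>gauss_pair)"
    by (simp add: wave_density_def nn_integral_shift_density_mult[OF \<sigma>])
  also have "\<dots> \<le> ennreal (1 / (1 - (x * real N)\<^sup>2))"
    using \<sigma> x by (rule wave_chi_square)
  finally show ?thesis .
qed

text \<open>Given the coefficients, the count and the times, the added wave is a deterministic shift
  of the errors, with weight \<open>wave_density\<close>. The base observations ignore the two
  coefficients of frequency \<open>k\<close>, so the weight can be averaged over them.\<close>

lemma subject_wave_change:
  assumes k: "k < M" "A k = 0" and [measurable]: "G \<in> borel_measurable subject_data_space"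
  shows "(\<integral>\<^sup>+x. G (subject_obs (trig_model P \<sigma> M (A(k := a))) x) \<partial>(gauss_seq 1 \<Otimes>\<^sub>M noise_law P \<sigma>)) =
    (\<integral>\<^sup>+x. G (subject_obs (trig_model P \<sigma> M A) x) * wave_likelihood \<sigma> a k (snd x) \<partial>(gauss_seq 1 \<Otimes>\<^sub>M noise_law P \<sigma>))"
proof -
  interpret W: prob_space "gauss_seq 1" by (rule prob_space_gauss_seq) simp
  interpret R: prob_space "noise_law P \<sigma>" by (rule prob_space_noise_law)
  interpret G: prob_space gauss_pair by (rule prob_space_gauss_pair)
  interpret RG: pair_sigma_finite "noise_law P \<sigma>" gauss_pair by standard
  let ?obs = "subject_obs (trig_model P \<sigma> M A)" and ?obs' = "subject_obs (trig_model P \<sigma> M (A(k := a)))"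
  let ?\<theta> = "\<lambda>\<omega>. (\<omega> (2 * k), \<omega> (Suc (2 * k)))"
  have m0: "(\<lambda>r. (\<omega>, r)) \<in> noise_law P \<sigma> \<rightarrow>\<^sub>M gauss_seq 1 \<Otimes>\<^sub>M noise_law P \<sigma>" for \<omega>
    by (auto simp: space_PiM)
  have m1 [measurable]: "(\<lambda>r. G (subject_obs (trig_model P \<sigma> M A) (\<omega>, r))) \<in> borel_measurable (noise_law P \<sigma>)" for \<omega> A
    using m0 by measurable
  have m2 [measurable]: "(\<lambda>r. wave_density \<sigma> a k \<theta> r) \<in> borel_measurable (noise_law P \<sigma>)" for \<theta>
    by (intro measurable_wave_density_compose measurable_const measurable_ident) (auto simp: space_pair_measure)
  have step: "(\<integral>\<^sup>+r. G (?obs' (\<omega>, r)) \<partial>noise_law P \<sigma>) =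
      (\<integral>\<^sup>+r. G (?obs (\<omega>, r)) * wave_density \<sigma> a k (?\<theta> \<omega>) r \<partial>noise_law P \<sigma>)" for \<omega>
  proof -
    have *: "(\<integral>\<^sup>+\<epsilon>. G (?obs' (\<omega>, N, T, \<epsilon>)) \<partial>gauss_seq \<sigma>) =
        (\<integral>\<^sup>+\<epsilon>. G (?obs (\<omega>, N, T, \<epsilon>)) * wave_density \<sigma> a k (?\<theta> \<omega>) (N, T, \<epsilon>) \<partial>gauss_seq \<sigma>)" for N T
    proof -
      \<comment> \<open>\<open>H\<close> rebuilds the base data from the errors; the model with the
        added wave evaluates the same \<open>H\<close> at shifted errors.\<close>
      define H where "H e = G (N, \<lambda>j. if j < N then (T j, trig_path M A \<omega> (T j) + e j) else (0, 0))" for e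
      have "(\<lambda>e. (N, \<lambda>j. if j < N then (T j, trig_path M A \<omega> (T j) + e j) else (0, 0)))
          \<in> (\<Pi>\<^sub>M j\<in>{..<N}. borel) \<rightarrow>\<^sub>M subject_data_space"
        unfolding subject_data_space_def
      proof (intro measurable_Pair measurable_PiM_single')
        fix j
        show "(\<lambda>e. if j < N then (T j, trig_path M A \<omega> (T j) + e j) else (0, 0))
          \<in> borel_measurable (\<Pi>\<^sub>M j\<in>{..<N}. borel)"
          by (cases "j < N") simp_all
      qed auto
      hence H: "H \<in> borel_measurable (\<Pi>\<^sub>M j\<in>{..<N}. borel)"
        unfolding H_def by measurable
      have "(\<integral>\<^sup>+\<epsilon>. G (?obs' (\<omega>, N, T, \<epsilon>)) \<partial>gauss_seq \<sigma>) =
          (\<integral>\<^sup>+\<epsilon>. H (\<lambda>j\<in>{..<N}. \<epsilon> j + a * wave k (?\<theta> \<omega>) (T j)) \<partial>gauss_seq \<sigma>)"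
        using k by (intro nn_integral_cong) (simp add: H_def subject_obs_def trig_path_upd add_ac cong: if_cong)
      also have "\<dots> = (\<integral>\<^sup>+\<epsilon>. H (restrict \<epsilon> {..<N}) * shift_density \<sigma> N (\<lambda>j. a * wave k (?\<theta> \<omega>) (T j)) \<epsilon> \<partial>gauss_seq \<sigma>)"
        using \<sigma> H by (rule nn_integral_gauss_seq_shift)
      also have "\<dots> = (\<integral>\<^sup>+\<epsilon>. G (?obs (\<omega>, N, T, \<epsilon>)) * wave_density \<sigma> a k (?\<theta> \<omega>) (N, T, \<epsilon>) \<partial>gauss_seq \<sigma>)"
        by (intro nn_integral_cong) (simp add: H_def subject_obs_def wave_density_def cong: if_cong)
      finally show ?thesis .
    qed
    have "(\<integral>\<^sup>+r. G (?obs' (\<omega>, r)) \<partial>noise_law P \<sigma>) =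
        (\<integral>\<^sup>+N. \<integral>\<^sup>+T. \<integral>\<^sup>+\<epsilon>. G (?obs' (\<omega>, N, T, \<epsilon>)) \<partial>gauss_seq \<sigma> \<partial>(\<Pi>\<^sub>M j\<in>UNIV. design_law P) \<partial>measure_pmf (count_law P))"
      by (rule nn_integral_noise_law) measurable
    also have "\<dots> = (\<integral>\<^sup>+N. \<integral>\<^sup>+T. \<integral>\<^sup>+\<epsilon>. G (?obs (\<omega>, N, T, \<epsilon>)) * wave_density \<sigma> a k (?\<theta> \<omega>) (N, T, \<epsilon>)
        \<partial>gauss_seq \<sigma> \<partial>(\<Pi>\<^sub>M j\<in>UNIV. design_law P) \<partial>measure_pmf (count_law P))"
      by (simp only: *)
    also have "\<dots> = (\<integral>\<^sup>+r. G (?obs (\<omega>, r)) * wave_density \<sigma> a k (?\<theta> \<omega>) r \<partial>noise_law P \<sigma>)"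
      by (rule nn_integral_noise_law[symmetric]) measurable
    finally show ?thesis .
  qed
  have obs_indep: "?obs (w(Suc (2 * k) := y, 2 * k := x), r) = ?obs (w, r)" for w x y r
    using k by (cases r) (simp add: subject_obs_def trig_path_indep cong: if_cong)
  have [measurable]: "(\<lambda>\<omega>. \<integral>\<^sup>+r. G (?obs (\<omega>, r)) * wave_density \<sigma> a k (?\<theta> \<omega>) r \<partial>noise_law P \<sigma>) \<in> borel_measurable (gauss_seq 1)"
  proof -
    have [measurable]: "(\<lambda>z. wave_density \<sigma> a k (?\<theta> (fst z)) (snd z)) \<in> borel_measurable (gauss_seq 1 \<Otimes>\<^sub>M noise_law P \<sigma>)"
      by (intro measurable_wave_density_compose) measurable
    have "(\<lambda>z. G (?obs z) * wave_density \<sigma> a k (?\<theta> (fst z)) (snd z)) \<in> borel_measurable (gauss_seq 1 \<Otimes>\<^sub>M noise_law P \<sigma>)"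
      by measurable
    thus ?thesis
      by (intro R.borel_measurable_nn_integral) (simp add: split_beta)
  qed
  have "(\<integral>\<^sup>+x. G (?obs' x) \<partial>(gauss_seq 1 \<Otimes>\<^sub>M noise_law P \<sigma>)) =
      (\<integral>\<^sup>+\<omega>. \<integral>\<^sup>+r. G (?obs' (\<omega>, r)) \<partial>noise_law P \<sigma> \<partial>gauss_seq 1)"
    by (rule R.nn_integral_fst[symmetric]) measurable
  also have "\<dots> = (\<integral>\<^sup>+\<omega>. \<integral>\<^sup>+r. G (?obs (\<omega>, r)) * wave_density \<sigma> a k (?\<theta> \<omega>) r \<partial>noise_law P \<sigma> \<partial>gauss_seq 1)"
    by (simp only: step)
  \<comment> \<open>Both coefficients of frequency \<open>k\<close> are redrawn; by
    \<open>obs_indep\<close> only the density notices.\<close>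
  also have "\<dots> = (\<integral>\<^sup>+w. \<integral>\<^sup>+\<theta>. \<integral>\<^sup>+r. G (?obs (w(Suc (2 * k) := snd \<theta>, 2 * k := fst \<theta>), r)) *
        wave_density \<sigma> a k (?\<theta> (w(Suc (2 * k) := snd \<theta>, 2 * k := fst \<theta>))) r \<partial>noise_law P \<sigma> \<partial>gauss_pair \<partial>gauss_seq 1)"
    by (rule nn_integral_PiM_resample2[OF prob_space_gauss]) (simp, measurable)
  also have "\<dots> = (\<integral>\<^sup>+\<omega>. \<integral>\<^sup>+\<theta>. \<integral>\<^sup>+r. G (?obs (\<omega>, r)) * wave_density \<sigma> a k \<theta> r \<partial>noise_law P \<sigma> \<partial>gauss_pair \<partial>gauss_seq 1)"
    unfolding obs_indep by simp
  also have "\<dots> = (\<integral>\<^sup>+\<omega>. \<integral>\<^sup>+r. \<integral>\<^sup>+\<theta>. G (?obs (\<omega>, r)) * wave_density \<sigma> a k \<theta> r \<partial>gauss_pair \<partial>noise_law P \<sigma> \<partial>gauss_seq 1)"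
  proof (rule nn_integral_cong)
    fix \<omega> :: "nat \<Rightarrow> real"
    have [measurable]: "(\<lambda>z. wave_density \<sigma> a k (snd z) (fst z)) \<in> borel_measurable (noise_law P \<sigma> \<Otimes>\<^sub>M gauss_pair)"
      by (intro measurable_wave_density_compose measurable_fst measurable_snd)
    have "(\<lambda>z. G (?obs (\<omega>, fst z)) * wave_density \<sigma> a k (snd z) (fst z)) \<in> borel_measurable (noise_law P \<sigma> \<Otimes>\<^sub>M gauss_pair)"
      by measurable
    thus "(\<integral>\<^sup>+\<theta>. \<integral>\<^sup>+r. G (?obs (\<omega>, r)) * wave_density \<sigma> a k \<theta> r \<partial>noise_law P \<sigma> \<partial>gauss_pair) =
        (\<integral>\<^sup>+r. \<integral>\<^sup>+\<theta>. G (?obs (\<omega>, r)) * wave_density \<sigma> a k \<theta> r \<partial>gauss_pair \<partial>noise_law P \<sigma>)"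
      by (intro RG.Fubini') (simp add: split_beta)
  qed
  also have "\<dots> = (\<integral>\<^sup>+\<omega>. \<integral>\<^sup>+r. G (?obs (\<omega>, r)) * wave_likelihood \<sigma> a k r \<partial>noise_law P \<sigma> \<partial>gauss_seq 1)"
  proof -
    have "(\<lambda>\<theta>. wave_density \<sigma> a k \<theta> r) \<in> borel_measurable gauss_pair" for r
      unfolding wave_density_def shift_density_def wave_def by simp
    thus ?thesis by (simp add: nn_integral_cmult wave_likelihood_def)
  qed
  also have "\<dots> = (\<integral>\<^sup>+x. G (?obs x) * wave_likelihood \<sigma> a k (snd x) \<partial>(gauss_seq 1 \<Otimes>\<^sub>M noise_law P \<sigma>))"
    by (subst R.nn_integral_fst[symmetric]) (simp_all, measurable)
  finally show ?thesis .
qed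

end

section \<open>Indistinguishable models\<close>

context
  fixes P :: fda_model and \<sigma> :: real
  assumes P: "prob_space (design_law P)" and \<sigma>: "0 < \<sigma>"
begin

lemma nn_integral_subject_noise:
  assumes [measurable]: "F \<in> borel_measurable (noise_law P \<sigma>)"
  shows "(\<integral>\<^sup>+z. F (snd z) \<partial>(gauss_seq 1 \<Otimes>\<^sub>M noise_law P \<sigma>)) = (\<integral>\<^sup>+r. F r \<partial>noise_law P \<sigma>)"
proof -
  interpret W: prob_space "gauss_seq 1" by (rule prob_space_gauss_seq) simp
  interpret R: prob_space "noise_law P \<sigma>" using P \<sigma> by (rule prob_space_noise_law)
  have "(\<integral>\<^sup>+z. F (snd z) \<partial>(gauss_seq 1 \<Otimes>\<^sub>M noise_law P \<sigma>)) = (\<integral>\<^sup>+\<omega>. \<integral>\<^sup>+r. F r \<partial>noise_law P \<sigma> \<partial>gauss_seq 1)"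
    by (subst R.nn_integral_fst[symmetric]) (simp_all, measurable)
  thus ?thesis by (simp add: W.emeasure_space_1)
qed

text \<open>Two trigonometric models with the same \<open>P\<close> and \<sigma> have the same
  subject law and differ in \<open>subject_obs\<close> alone, which puts them in the setting of
  \<open>two_point_bound\<close>.\<close>

lemma model_two_point:
  assumes L [measurable]: "L \<in> borel_measurable (gauss_seq 1 \<Otimes>\<^sub>M noise_law P \<sigma>)"
    and B [measurable]: "B \<in> sets (gauss_seq 1 \<Otimes>\<^sub>M noise_law P \<sigma>)"
    and change: "\<And>G. G \<in> borel_measurable subject_data_space \<Longrightarrow>
      (\<integral>\<^sup>+x. G (subject_obs (trig_model P \<sigma> M A') x) \<partial>(gauss_seq 1 \<Otimes>\<^sub>M noise_law P \<sigma>)) =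
      (\<integral>\<^sup>+x. G (subject_obs (trig_model P \<sigma> M A) x) * L x \<partial>(gauss_seq 1 \<Otimes>\<^sub>M noise_law P \<sigma>))"
    and mass: "ennreal (3/4) \<le> (\<integral>\<^sup>+x. indicator B x * L x \<partial>(gauss_seq 1 \<Otimes>\<^sub>M noise_law P \<sigma>)) ^ n"
    and square: "(\<integral>\<^sup>+x. indicator B x * (L x)\<^sup>2 \<partial>(gauss_seq 1 \<Otimes>\<^sub>M noise_law P \<sigma>)) ^ n \<le> 2"
    and G: "G0 \<in> borel_measurable (data_space n)" "G1 \<in> borel_measurable (data_space n)"
    and D: "0 \<le> D" "\<And>d. d \<in> space (data_space n) \<Longrightarrow> ennreal D \<le> G0 d + G1 d"
  shows "ennreal (D / 4) \<le>
    (\<integral>\<^sup>+x. G0 (observations (trig_model P \<sigma> M A) n x) \<partial>joint_law (trig_model P \<sigma> M A) n) +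
    (\<integral>\<^sup>+x. G1 (observations (trig_model P \<sigma> M A') n x) \<partial>joint_law (trig_model P \<sigma> M A') n)"
proof -
  have ds: "data_space n = (\<Pi>\<^sub>M i\<in>{..<n}. subject_data_space)"
    by (simp add: data_space_def subject_data_space_def)
  have "prob_space (gauss_seq 1 \<Otimes>\<^sub>M noise_law P \<sigma>)"
    using P \<sigma> by (intro prob_space_pair prob_space_gauss_seq prob_space_noise_law) auto
  from two_point_bound[OF this measurable_subject_obs[OF P \<sigma>] measurable_subject_obs[OF P \<sigma>] L B G[unfolded ds] change mass square D[unfolded ds]]
  show ?thesis
    by (simp add: observations_def joint_law_def subject_law_trig_model)
qed

text \<open>With y = 4 x^2 m2 the smallness condition reads n y <= 1/4. On the event x N <= 1/2 one
  subject keeps mass at least 1 - y and has second moment at most 1 + y / 2. The n-th powers are at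
  least 1 - n y >= 3/4 by Bernoulli and at most exp (1/8) < 2.\<close>

lemma wave_two_point:
  assumes k: "k < M" "A k = 0"
    and x: "x = a\<^sup>2 / \<sigma>\<^sup>2"
    and m2: "(\<integral>\<^sup>+N. ennreal ((real N)\<^sup>2) \<partial>measure_pmf (count_law P)) \<le> ennreal m2" "0 \<le> m2"
    and small: "real n * (16 * x\<^sup>2 * m2) \<le> 1"
    and n: "1 \<le> n"
    and G: "G0 \<in> borel_measurable (data_space n)" "G1 \<in> borel_measurable (data_space n)"
    and D: "0 \<le> D" "\<And>d. d \<in> space (data_space n) \<Longrightarrow> ennreal D \<le> G0 d + G1 d"
  shows "ennreal (D / 4) \<le>
    (\<integral>\<^sup>+x. G0 (observations (trig_model P \<sigma> M A) n x) \<partial>joint_law (trig_model P \<sigma> M A) n) +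
    (\<integral>\<^sup>+x. G1 (observations (trig_model P \<sigma> M (A(k := a))) n x) \<partial>joint_law (trig_model P \<sigma> M (A(k := a))) n)"
proof -
  define S where "S = gauss_seq 1 \<Otimes>\<^sub>M noise_law P \<sigma>"
  interpret E: prob_space "gauss_seq \<sigma>" using \<sigma> by (rule prob_space_gauss_seq)
  interpret T: prob_space "\<Pi>\<^sub>M j\<in>(UNIV :: nat set). design_law P" using P by (intro prob_space_PiM)
  note [measurable] = borel_measurable_wave_likelihood[OF P \<sigma>]
  let ?L = "wave_likelihood \<sigma> a k"
  let ?I = "\<lambda>N. indicator {N. x * real N \<le> 1/2} N :: ennreal"
  define B where "B = {z \<in> space S. x * real (fst (snd z)) \<le> 1/2}"
  define y where "y = 4 * x\<^sup>2 * m2"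
  have y: "0 \<le> y" "real n * y \<le> 1/4" using m2(2) small by (simp_all add: y_def)
  have "1 * y \<le> real n * y" using y n by (intro mult_right_mono) auto
  hence y1: "y \<le> 1/4" using y by simp
  have [measurable]: "(\<lambda>z. fst (snd z)) \<in> S \<rightarrow>\<^sub>M count_space UNIV" "(\<lambda>r. fst r) \<in> noise_law P \<sigma> \<rightarrow>\<^sub>M count_space UNIV"
    unfolding S_def noise_law_def by measurable
  have B: "B \<in> sets S" unfolding B_def by measurable
  have iB: "indicator B z = ?I (fst (snd z))" if "z \<in> space S" for z
    using that by (simp add: B_def indicator_def)
  have mF: "(\<lambda>r. ?I (fst r)) \<in> borel_measurable (noise_law P \<sigma>)"
    by (rule measurable_compose[where N="count_space UNIV"]) measurable
  note [measurable] = mF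
  \<comment> \<open>p = 1 gives the mass and p = 2 the second moment. The event depends on the count
    alone, so its indicator leaves the inner integrals.\<close>
  have red: "(\<integral>\<^sup>+z. indicator B z * ?L (snd z) ^ p \<partial>S) =
    (\<integral>\<^sup>+N. ?I N * (\<integral>\<^sup>+T. \<integral>\<^sup>+\<epsilon>. ?L (N, T, \<epsilon>) ^ p \<partial>gauss_seq \<sigma> \<partial>(\<Pi>\<^sub>M j\<in>UNIV. design_law P)) \<partial>measure_pmf (count_law P))" for p
  proof -
    have "(\<integral>\<^sup>+z. indicator B z * ?L (snd z) ^ p \<partial>S) = (\<integral>\<^sup>+z. ?I (fst (snd z)) * ?L (snd z) ^ p \<partial>S)"
      by (intro nn_integral_cong) (simp add: iB)
    also have "\<dots> = (\<integral>\<^sup>+r. ?I (fst r) * ?L r ^ p \<partial>noise_law P \<sigma>)"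
      unfolding S_def by (rule nn_integral_subject_noise) measurable
    also have "\<dots> = (\<integral>\<^sup>+N. \<integral>\<^sup>+T. \<integral>\<^sup>+\<epsilon>. ?I N * ?L (N, T, \<epsilon>) ^ p \<partial>gauss_seq \<sigma> \<partial>(\<Pi>\<^sub>M j\<in>UNIV. design_law P) \<partial>measure_pmf (count_law P))"
      by (subst nn_integral_noise_law[OF P \<sigma>]) simp_all
    also have "\<dots> = (\<integral>\<^sup>+N. ?I N * (\<integral>\<^sup>+T. \<integral>\<^sup>+\<epsilon>. ?L (N, T, \<epsilon>) ^ p \<partial>gauss_seq \<sigma> \<partial>(\<Pi>\<^sub>M j\<in>UNIV. design_law P)) \<partial>measure_pmf (count_law P))"
      by (intro nn_integral_cong) (auto split: split_indicator)
    finally show ?thesis .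
  qed
  let ?mass = "\<integral>\<^sup>+z. indicator B z * ?L (snd z) \<partial>S"
  have "1 = (\<integral>\<^sup>+N. 1 \<partial>measure_pmf (count_law P))"
    by (simp add: measure_pmf.emeasure_space_1[simplified])
  \<comment> \<open>Chebyshev's inequality: off the event, 4 x^2 N^2 is at least 1.\<close>
  also have "\<dots> \<le> (\<integral>\<^sup>+N. ?I N + ennreal (4 * x\<^sup>2) * ennreal ((real N)\<^sup>2) \<partial>measure_pmf (count_law P))"
  proof (rule nn_integral_mono)
    fix N :: nat
    show "1 \<le> ?I N + ennreal (4 * x\<^sup>2) * ennreal ((real N)\<^sup>2)"
    proof (cases "x * real N \<le> 1/2")
      case False
      hence "(1/2)\<^sup>2 \<le> (x * real N)\<^sup>2" by (intro power_mono) auto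
      hence "1 \<le> 4 * x\<^sup>2 * (real N)\<^sup>2" by (simp add: power_mult_distrib power2_eq_square mult_ac)
      hence "ennreal 1 \<le> ennreal (4 * x\<^sup>2 * (real N)\<^sup>2)" by (rule ennreal_leI)
      thus ?thesis using False by (simp add: ennreal_mult)
    qed simp
  qed
  also have "\<dots> = (\<integral>\<^sup>+N. ?I N \<partial>measure_pmf (count_law P)) + ennreal (4 * x\<^sup>2) * (\<integral>\<^sup>+N. ennreal ((real N)\<^sup>2) \<partial>measure_pmf (count_law P))"
    by (simp add: nn_integral_add nn_integral_cmult)
  also have "\<dots> \<le> (\<integral>\<^sup>+N. ?I N \<partial>measure_pmf (count_law P)) + ennreal (4 * x\<^sup>2) * ennreal m2"
    using m2 by (intro add_left_mono mult_left_mono) auto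
  also have "(\<integral>\<^sup>+N. ?I N \<partial>measure_pmf (count_law P)) = ?mass"
    using red[of 1] by (simp add: nn_integral_wave_likelihood[OF P \<sigma>] T.emeasure_space_1[simplified])
  also have "ennreal (4 * x\<^sup>2) * ennreal m2 = ennreal y"
    using m2 by (simp add: ennreal_mult y_def)
  finally have le: "1 \<le> ?mass + ennreal y" .
  have mass1: "ennreal (1 - y) \<le> ?mass"
  proof (cases ?mass)
    case (real r)
    have "ennreal 1 \<le> ennreal (r + y)"
      using le real y by simp
    hence "1 \<le> r + y" using real y by (subst (asm) ennreal_le_iff) auto
    thus ?thesis unfolding real(2) by (intro ennreal_leI) simp
  qed simp
  have "3/4 \<le> (1 - y) ^ n"
    using Bernoulli_inequality[of "- y" n] y y1 by simp
  hence "ennreal (3/4) \<le> ennreal ((1 - y) ^ n)" by (rule ennreal_leI)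
  also have "\<dots> = ennreal (1 - y) ^ n" using y1 by (simp add: ennreal_power)
  also have "\<dots> \<le> ?mass ^ n" by (intro power_mono mass1) simp
  finally have mass: "ennreal (3/4) \<le> ?mass ^ n" .
  have x0: "0 \<le> x" by (simp add: x)
  have "(\<integral>\<^sup>+z. indicator B z * (?L (snd z))\<^sup>2 \<partial>S) \<le> (\<integral>\<^sup>+N. 1 + ennreal (2 * x\<^sup>2) * ennreal ((real N)\<^sup>2) \<partial>measure_pmf (count_law P))"
    unfolding red
  proof (rule nn_integral_mono)
    fix N :: nat
    show "?I N * (\<integral>\<^sup>+T. \<integral>\<^sup>+\<epsilon>. (?L (N, T, \<epsilon>))\<^sup>2 \<partial>gauss_seq \<sigma> \<partial>(\<Pi>\<^sub>M j\<in>UNIV. design_law P)) \<le>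
        1 + ennreal (2 * x\<^sup>2) * ennreal ((real N)\<^sup>2)"
    proof (cases "x * real N \<le> 1/2")
      case True
      define v where "v = (x * real N)\<^sup>2"
      have "v \<le> (1/2)\<^sup>2" unfolding v_def using True x0 by (intro power_mono) auto
      hence v: "v \<le> 1/4" "0 \<le> v" by (auto simp: power2_eq_square v_def)
      have "v * v \<le> 1/4 * v" using v by (intro mult_right_mono) auto
      \<comment> \<open>For v <= 1/4 the chi-square bound is at most linear in v = x^2 N^2, so a
        second moment of the count is enough.\<close>
      hence "1 \<le> (1 + 2 * v) * (1 - v)" using v by (simp add: algebra_simps)
      hence v2: "1 / (1 - v) \<le> 1 + 2 * v" using v by (simp add: pos_divide_le_eq)
      have "(\<integral>\<^sup>+T. \<integral>\<^sup>+\<epsilon>. (?L (N, T, \<epsilon>))\<^sup>2 \<partial>gauss_seq \<sigma> \<partial>(\<Pi>\<^sub>M j\<in>UNIV. design_law P)) \<le>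
          (\<integral>\<^sup>+T. ennreal (1 / (1 - v)) \<partial>(\<Pi>\<^sub>M j\<in>(UNIV :: nat set). design_law P))"
        unfolding v_def using True by (intro nn_integral_mono nn_integral_wave_likelihood_square[OF P \<sigma> x]) linarith
      also have "\<dots> = ennreal (1 / (1 - v))"
        by (simp add: T.emeasure_space_1[simplified])
      also have "\<dots> \<le> ennreal (1 + 2 * v)" using v2 by (rule ennreal_leI)
      also have "\<dots> = 1 + ennreal (2 * x\<^sup>2) * ennreal ((real N)\<^sup>2)"
        using v by (simp add: ennreal_mult[symmetric] v_def power_mult_distrib mult.assoc)
      finally show ?thesis using True by simp
    qed simp
  qed
  also have "\<dots> = 1 + ennreal (2 * x\<^sup>2) * (\<integral>\<^sup>+N. ennreal ((real N)\<^sup>2) \<partial>measure_pmf (count_law P))"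
    by (simp add: nn_integral_add nn_integral_cmult measure_pmf.emeasure_space_1[simplified])
  also have "\<dots> \<le> 1 + ennreal (2 * x\<^sup>2) * ennreal m2"
    using m2 by (intro add_left_mono mult_left_mono) auto
  also have "\<dots> = ennreal (1 + y / 2)"
    using m2 y by (simp add: ennreal_mult[symmetric] y_def)
  finally have "(\<integral>\<^sup>+z. indicator B z * (?L (snd z))\<^sup>2 \<partial>S) ^ n \<le> ennreal (1 + y / 2) ^ n"
    by (intro power_mono) auto
  also have "\<dots> = ennreal ((1 + y / 2) ^ n)" using y(1) by (intro ennreal_power) simp
  also have "\<dots> \<le> ennreal 2"
  proof (rule ennreal_leI)
    have "(1 + y / 2) ^ n \<le> exp (y / 2) ^ n" using y by (intro power_mono exp_ge_add_one_self) auto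
    also have "\<dots> = exp (real n * (y / 2))" by (rule exp_of_nat_mult[symmetric])
    also have "\<dots> \<le> exp (ln 2)" using y ln2_ge_two_thirds by (simp only: exp_le_cancel_iff)
    finally show "(1 + y / 2) ^ n \<le> 2" by simp
  qed
  finally have square: "(\<integral>\<^sup>+z. indicator B z * (?L (snd z))\<^sup>2 \<partial>S) ^ n \<le> 2" by simp
  have "?L \<circ> snd \<in> borel_measurable (gauss_seq 1 \<Otimes>\<^sub>M noise_law P \<sigma>)"
    by (rule measurable_comp[OF measurable_snd]) measurable
  thus ?thesis
    by (intro model_two_point[where B=B and L="\<lambda>z. ?L (snd z)", OF _ B[unfolded S_def]
          subject_wave_change[where A=A, OF P \<sigma> k] mass[unfolded S_def] square[unfolded S_def] G D])
      (simp_all add: comp_def)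
qed

text \<open>Here the statistician may see the random level of the constant path itself, so sampling
  more densely within a subject cannot help. The weight is the density ratio of the scaled to the
  unscaled level, with second moment 1 / sqrt (1 - \<delta>^2). Bernoulli and n \<delta>^2 <= 3/4
  give (1 - \<delta>^2)^n >= 1/4, hence the bound 2.\<close>

lemma scale_two_point:
  assumes \<delta>: "0 < \<delta>" "real n * \<delta>\<^sup>2 \<le> 3/4" and s: "s = sqrt (1 + \<delta>)" and n: "1 \<le> n"
    and G: "G0 \<in> borel_measurable (data_space n)" "G1 \<in> borel_measurable (data_space n)"
    and D: "0 \<le> D" "\<And>d. d \<in> space (data_space n) \<Longrightarrow> ennreal D \<le> G0 d + G1 d"
  shows "ennreal (D / 4) \<le>
    (\<integral>\<^sup>+x. G0 (observations (trig_model P \<sigma> 1 (\<lambda>_. b)) n x) \<partial>joint_law (trig_model P \<sigma> 1 (\<lambda>_. b)) n) +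
    (\<integral>\<^sup>+x. G1 (observations (trig_model P \<sigma> 1 (\<lambda>_. s * b)) n x) \<partial>joint_law (trig_model P \<sigma> 1 (\<lambda>_. s * b)) n)"
proof -
  define S where "S = gauss_seq 1 \<Otimes>\<^sub>M noise_law P \<sigma>"
  interpret W: prob_space "gauss_seq 1" by (rule prob_space_gauss_seq) simp
  interpret R: prob_space "noise_law P \<sigma>" using P \<sigma> by (rule prob_space_noise_law)
  have s2: "s\<^sup>2 = 1 + \<delta>" "0 < s" using \<delta> by (auto simp: s)
  have "1 * \<delta>\<^sup>2 \<le> real n * \<delta>\<^sup>2" using n by (intro mult_right_mono) auto
  hence \<delta>1: "\<delta>\<^sup>2 \<le> 3/4" using \<delta>(2) by linarith
  define r where "r x = ennreal (exp ((1 - 1 / s\<^sup>2) * x\<^sup>2 / 2) / s)" for x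
  have [measurable]: "r \<in> borel_measurable borel" unfolding r_def by measurable
  have const: "trig_path (Suc 0) (\<lambda>_. b) w t = b * w 0" for b w t
    by (simp add: trig_path_eq)
  have coord: "(\<integral>\<^sup>+w. F (w 0) \<partial>gauss_seq 1) = (\<integral>\<^sup>+x. F x \<partial>gauss 1)"
    if [measurable]: "F \<in> borel_measurable borel" for F :: "real \<Rightarrow> ennreal"
  proof -
    have "(\<integral>\<^sup>+w. F (w 0) \<partial>gauss_seq 1) = (\<integral>\<^sup>+x. F x \<partial>distr (gauss_seq 1) (gauss 1) (\<lambda>\<omega>. \<omega> 0))"
      by (rule nn_integral_distr[symmetric]) measurable
    also have "distr (gauss_seq 1) (gauss 1) (\<lambda>\<omega>. \<omega> 0) = gauss 1"
      using distr_PiM_component[of UNIV "\<lambda>_. gauss 1" 0] prob_space_gauss[of 1] by simp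
    finally show ?thesis .
  qed
  have comp: "(\<integral>\<^sup>+z. F (fst z 0) \<partial>S) = (\<integral>\<^sup>+x. F x \<partial>gauss 1)"
    if [measurable]: "F \<in> borel_measurable borel" for F :: "real \<Rightarrow> ennreal"
  proof -
    have "(\<integral>\<^sup>+z. F (fst z 0) \<partial>S) = (\<integral>\<^sup>+w. F (w 0) \<partial>gauss_seq 1)"
      unfolding S_def by (subst R.nn_integral_fst[symmetric]) (simp_all add: R.emeasure_space_1)
    thus ?thesis by (simp only: coord that)
  qed
  have change: "(\<integral>\<^sup>+x. G (subject_obs (trig_model P \<sigma> 1 (\<lambda>_. s * b)) x) \<partial>S) =
      (\<integral>\<^sup>+x. G (subject_obs (trig_model P \<sigma> 1 (\<lambda>_. b)) x) * r (fst x 0) \<partial>S)"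
    if [measurable]: "G \<in> borel_measurable subject_data_space" for G
  proof -
    note [measurable] = measurable_subject_obs[OF P \<sigma>]
    \<comment> \<open>The path enters the data only through its level; the two models evaluate the
      same \<open>H\<close> at the coefficient \<open>w 0\<close> and at
      \<open>s * w 0\<close>.\<close>
    define H where "H r v = G (case r of (N, T, \<epsilon>) \<Rightarrow> (N, \<lambda>j. if j < N then (T j, b * v + \<epsilon> j) else (0, 0)))" for r v
    have H1: "G (subject_obs (trig_model P \<sigma> 1 (\<lambda>_. s * b)) (w, r)) = H r (s * w 0)" for w r
      by (simp add: H_def subject_obs_def const split_beta mult_ac cong: if_cong)
    have H2: "G (subject_obs (trig_model P \<sigma> 1 (\<lambda>_. b)) (w, r)) = H r (w 0)" for w r
      by (simp add: H_def subject_obs_def const split_beta cong: if_cong)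
    have m: "(\<lambda>w. H r (w 0)) \<in> borel_measurable (gauss_seq 1)" if "r \<in> space (noise_law P \<sigma>)" for r
    proof -
      have "(\<lambda>w. (w, r)) \<in> gauss_seq 1 \<rightarrow>\<^sub>M gauss_seq 1 \<Otimes>\<^sub>M noise_law P \<sigma>"
        using that by measurable
      hence "(\<lambda>w. G (subject_obs (trig_model P \<sigma> 1 (\<lambda>_. b)) (w, r))) \<in> borel_measurable (gauss_seq 1)"
        by measurable
      thus ?thesis by (simp only: H2)
    qed
    have Hm: "H r \<in> borel_measurable borel" if "r \<in> space (noise_law P \<sigma>)" for r
    proof -
      \<comment> \<open>Measurability in the level is read off along constant sequences.\<close>
      have "(\<lambda>v. (\<lambda>_. v)) \<in> borel \<rightarrow>\<^sub>M gauss_seq 1"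
        by (rule measurable_PiM_single') auto
      from measurable_compose[OF this m[OF that]] show ?thesis by simp
    qed
    interpret RW: pair_sigma_finite "gauss_seq 1" "noise_law P \<sigma>" by standard
    have [measurable]: "(\<lambda>z. H (snd z) (s * fst z 0)) \<in> borel_measurable (gauss_seq 1 \<Otimes>\<^sub>M noise_law P \<sigma>)"
    proof -
      have "(\<lambda>z. G (subject_obs (trig_model P \<sigma> 1 (\<lambda>_. s * b)) z)) \<in> borel_measurable (gauss_seq 1 \<Otimes>\<^sub>M noise_law P \<sigma>)"
        by measurable
      moreover have "G (subject_obs (trig_model P \<sigma> 1 (\<lambda>_. s * b)) z) = H (snd z) (s * fst z 0)" for z
        using H1[of "fst z" "snd z"] by simp
      ultimately show ?thesis by (simp only:)
    qed
    have [measurable]: "(\<lambda>z. H (snd z) (fst z 0)) \<in> borel_measurable (gauss_seq 1 \<Otimes>\<^sub>M noise_law P \<sigma>)"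
    proof -
      have "(\<lambda>z. G (subject_obs (trig_model P \<sigma> 1 (\<lambda>_. b)) z)) \<in> borel_measurable (gauss_seq 1 \<Otimes>\<^sub>M noise_law P \<sigma>)"
        by measurable
      moreover have "G (subject_obs (trig_model P \<sigma> 1 (\<lambda>_. b)) z) = H (snd z) (fst z 0)" for z
        using H2[of "fst z" "snd z"] by simp
      ultimately show ?thesis by (simp only:)
    qed
    have "(\<integral>\<^sup>+x. G (subject_obs (trig_model P \<sigma> 1 (\<lambda>_. s * b)) x) \<partial>S) =
        (\<integral>\<^sup>+r. \<integral>\<^sup>+w. H r (s * w 0) \<partial>gauss_seq 1 \<partial>noise_law P \<sigma>)"
      unfolding S_def by (subst RW.nn_integral_snd[symmetric]) (simp_all only: H1, measurable)
    also have "\<dots> = (\<integral>\<^sup>+v. \<integral>\<^sup>+w. H v (w 0) * r (w 0) \<partial>gauss_seq 1 \<partial>noise_law P \<sigma>)"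
    proof (rule nn_integral_cong)
      fix v assume "v \<in> space (noise_law P \<sigma>)"
      note [measurable] = Hm[OF this]
      have "(\<integral>\<^sup>+w. H v (s * w 0) \<partial>gauss_seq 1) = (\<integral>\<^sup>+x. H v (s * x) \<partial>gauss 1)"
        by (rule coord) measurable
      also have "\<dots> = (\<integral>\<^sup>+x. H v x * r x \<partial>gauss 1)"
        unfolding r_def using s2 by (intro nn_integral_gauss_scale) auto
      also have "\<dots> = (\<integral>\<^sup>+w. H v (w 0) * r (w 0) \<partial>gauss_seq 1)"
        by (rule coord[symmetric]) measurable
      finally show "(\<integral>\<^sup>+w. H v (s * w 0) \<partial>gauss_seq 1) = (\<integral>\<^sup>+w. H v (w 0) * r (w 0) \<partial>gauss_seq 1)" .
    qed
    also have "\<dots> = (\<integral>\<^sup>+x. G (subject_obs (trig_model P \<sigma> 1 (\<lambda>_. b)) x) * r (fst x 0) \<partial>S)"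
      unfolding S_def by (subst RW.nn_integral_snd[symmetric]) (simp_all only: H2, measurable)
    finally show ?thesis .
  qed
  have "(\<integral>\<^sup>+z. r (fst z 0) \<partial>S) = (\<integral>\<^sup>+x. r x \<partial>gauss 1)" by (rule comp) measurable
  also have "\<dots> = (\<integral>\<^sup>+x. 1 \<partial>gauss 1)"
    using nn_integral_gauss_scale[OF s2(2), of "\<lambda>_. 1"] by (simp add: r_def)
  also have "\<dots> = 1"
    using prob_space.emeasure_space_1[OF prob_space_gauss[of 1]] by simp
  finally have mass: "(\<integral>\<^sup>+z. r (fst z 0) \<partial>S) = 1" .
  have "\<delta> < 1" using \<delta>1 \<delta>(1) by (intro power2_less_imp_less[of \<delta> 1]) auto
  hence lt: "2 - 2 / s\<^sup>2 < 1" using \<delta>(1) by (simp add: s2 field_simps)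
  have "(\<integral>\<^sup>+z. (r (fst z 0))\<^sup>2 \<partial>S) = (\<integral>\<^sup>+x. (r x)\<^sup>2 \<partial>gauss 1)"
    by (rule comp[of "\<lambda>x. (r x)\<^sup>2"]) measurable
  also have "\<dots> = (\<integral>\<^sup>+x. ennreal (1 / s\<^sup>2) * ennreal (exp ((2 - 2 / s\<^sup>2) * x\<^sup>2 / 2)) \<partial>gauss 1)"
  proof (rule nn_integral_cong)
    fix x :: real
    have "(exp u / s)\<^sup>2 = 1 / s\<^sup>2 * exp (2 * u)" for u :: real
      by (simp add: power_divide exp_double)
    hence "(exp ((1 - 1 / s\<^sup>2) * x\<^sup>2 / 2) / s)\<^sup>2 = 1 / s\<^sup>2 * exp (2 * ((1 - 1 / s\<^sup>2) * x\<^sup>2 / 2))" .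
    also have "2 * ((1 - 1 / s\<^sup>2) * x\<^sup>2 / 2) = (2 - 2 / s\<^sup>2) * x\<^sup>2 / 2"
      by (simp add: algebra_simps)
    finally show "(r x)\<^sup>2 = ennreal (1 / s\<^sup>2) * ennreal (exp ((2 - 2 / s\<^sup>2) * x\<^sup>2 / 2))"
      using s2(2) by (simp add: r_def ennreal_power ennreal_mult[symmetric])
  qed
  also have "\<dots> = ennreal (1 / s\<^sup>2) * ennreal (1 / sqrt (1 - (2 - 2 / s\<^sup>2)))"
  proof (subst nn_integral_cmult)
    show "ennreal (1 / s\<^sup>2) * (\<integral>\<^sup>+x. ennreal (exp ((2 - 2 / s\<^sup>2) * x\<^sup>2 / 2)) \<partial>gauss 1) =
        ennreal (1 / s\<^sup>2) * ennreal (1 / sqrt (1 - (2 - 2 / s\<^sup>2)))"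
      by (simp only: nn_integral_gauss_exp_square lt)
  qed measurable
  also have "\<dots> = ennreal (1 / sqrt (1 - \<delta>\<^sup>2))"
  proof -
    \<comment> \<open>The computation rests on s^4 (2 / s^2 - 1) = 1 - (s^2 - 1)^2 with s^2 - 1 =
      \<delta>.\<close>
    have "sqrt ((s\<^sup>2)\<^sup>2) = s\<^sup>2" by (rule real_sqrt_unique) simp_all
    hence "s\<^sup>2 * sqrt (1 - (2 - 2 / s\<^sup>2)) = sqrt ((s\<^sup>2)\<^sup>2 * (1 - (2 - 2 / s\<^sup>2)))"
      by (simp only: real_sqrt_mult[of "(s\<^sup>2)\<^sup>2"])
    also have "(s\<^sup>2)\<^sup>2 * (1 - (2 - 2 / s\<^sup>2)) = 1 - \<delta>\<^sup>2"
      using \<delta>(1) unfolding s2(1) by (simp add: field_simps power2_eq_square)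
    finally have "1 / s\<^sup>2 * (1 / sqrt (1 - (2 - 2 / s\<^sup>2))) = 1 / sqrt (1 - \<delta>\<^sup>2)"
      by (simp only: times_divide_times_eq mult_1)
    moreover have "0 \<le> 1 / sqrt (1 - (2 - 2 / s\<^sup>2))"
      using lt by (intro divide_nonneg_nonneg real_sqrt_ge_zero) linarith+
    ultimately show ?thesis
      by (subst ennreal_mult[symmetric]) (simp_all only:, simp)
  qed
  finally have "(\<integral>\<^sup>+z. (r (fst z 0))\<^sup>2 \<partial>S) ^ n = ennreal ((1 / sqrt (1 - \<delta>\<^sup>2)) ^ n)"
    using \<delta>1 by (simp add: ennreal_power)
  also have "\<dots> \<le> ennreal 2"
  proof (rule ennreal_leI)
    have "1/4 \<le> (1 - \<delta>\<^sup>2) ^ n"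
      using Bernoulli_inequality[of "- \<delta>\<^sup>2" n] \<delta> \<delta>1 by simp
    hence "sqrt (1/4) \<le> sqrt ((1 - \<delta>\<^sup>2) ^ n)" by (rule real_sqrt_le_mono)
    hence "1/2 \<le> sqrt (1 - \<delta>\<^sup>2) ^ n" by (simp add: real_sqrt_divide real_sqrt_power)
    thus "(1 / sqrt (1 - \<delta>\<^sup>2)) ^ n \<le> 2"
      by (simp add: power_one_over field_simps)
  qed
  finally have square: "(\<integral>\<^sup>+z. (r (fst z 0))\<^sup>2 \<partial>S) ^ n \<le> 2" by simp
  \<comment> \<open>The second moment is finite on the whole space, so the event is
    everything.\<close>
  define B where "B = space S"
  have mass': "ennreal (3/4) \<le> (\<integral>\<^sup>+x. indicator B x * r (fst x 0) \<partial>S) ^ n"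
  proof -
    have "(\<integral>\<^sup>+x. indicator B x * r (fst x 0) \<partial>S) = 1"
      unfolding mass[symmetric] by (intro nn_integral_cong) (simp add: B_def)
    thus ?thesis by (simp add: ennreal_le_1)
  qed
  have square': "(\<integral>\<^sup>+x. indicator B x * (r (fst x 0))\<^sup>2 \<partial>S) ^ n \<le> 2"
  proof -
    have "(\<integral>\<^sup>+x. indicator B x * (r (fst x 0))\<^sup>2 \<partial>S) = (\<integral>\<^sup>+z. (r (fst z 0))\<^sup>2 \<partial>S)"
      by (intro nn_integral_cong) (simp add: B_def)
    thus ?thesis using square by simp
  qed
  have "(\<lambda>z. r (fst z 0)) \<in> borel_measurable S" unfolding S_def by measurable
  thus ?thesis
    using change unfolding S_def
    by (intro model_two_point[where B=B and L="\<lambda>z. r (fst z 0)", OF _ _ _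
          mass'[unfolded S_def] square'[unfolded S_def] G D]) (auto simp: S_def B_def)
qed

end

section \<open>Bessel's inequality on the torus\<close>

abbreviation torus :: "(real \<times> real) measure" where
  "torus \<equiv> circle \<Otimes>\<^sub>M circle"

lemma prob_space_torus: "prob_space torus"
  by (intro prob_space_pair prob_space_circle)

lemma sets_torus [measurable_cong]: "sets torus = sets borel"
proof -
  have "sets torus = sets (borel \<Otimes>\<^sub>M borel)"
    by (intro sets_pair_measure_cong sets_circle)
  thus ?thesis by (simp only: borel_prod)
qed

lemma integral_circle_cos:
  fixes l :: int
  assumes "l \<noteq> 0"
  shows "(LINT t|circle. cos (2 * pi * real_of_int l * (s - t))) = 0"
proof -
  let ?c = "2 * pi * real_of_int l"
  have c: "?c \<noteq> 0" using assms by simp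
  have "((\<lambda>t. - sin (?c * (s - t)) / ?c) has_real_derivative cos (?c * (s - t))) (at t)" for t
    using assms by (auto intro!: derivative_eq_intros)
  hence "has_bochner_integral lborel (\<lambda>t. cos (?c * (s - t)) * indicator {0..1} t)
      (- sin (?c * (s - 1)) / ?c - - sin (?c * (s - 0)) / ?c)"
    by (intro has_bochner_integral_FTC_Icc_real) auto
  moreover have "sin (?c * (s - 1)) = sin (?c * s)"
  proof -
    have "?c * (s - 1) = ?c * s - 2 * pi * real_of_int l" by (simp add: algebra_simps)
    moreover have "sin (2 * pi * real_of_int l) = 0" "cos (2 * pi * real_of_int l) = 1"
      using sin_int_2pin[of l] cos_int_2pin[of l] by (simp_all add: mult.commute mult.left_commute)
    ultimately show ?thesis by (simp add: sin_diff)
  qed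
  ultimately have "(LINT t|lborel. cos (?c * (s - t)) * indicator {0..1} t) = 0"
    by (simp add: has_bochner_integral_integral_eq)
  moreover have "(LINT t|circle. cos (?c * (s - t))) = (LINT t|lborel. indicator {0..<1} t *\<^sub>R cos (?c * (s - t)))"
    unfolding circle_def ennreal_indicator[symmetric] by (rule integral_density) auto
  moreover have "\<dots> = (LINT t|lborel. cos (?c * (s - t)) * indicator {0..1} t)"
    by (rule integral_cong_AE) (use AE_lborel_singleton[of "1::real"] in \<open>auto elim!: eventually_mono split: split_indicator\<close>)
  ultimately show ?thesis by simp
qed

lemma integrable_torus_bounded:
  assumes "F \<in> borel_measurable borel" "\<And>z. \<bar>F z\<bar> \<le> B"
  shows "integrable torus (F :: real \<times> real \<Rightarrow> real)"
proof -
  interpret prob_space torus by (rule prob_space_torus)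
  have "F \<in> borel_measurable torus"
    using assms(1) by (subst measurable_cong_sets[OF sets_torus refl])
  thus ?thesis using assms(2) by (intro integrable_const_bound[of _ B]) auto
qed

definition cos_diff_fun :: "nat \<Rightarrow> real \<times> real \<Rightarrow> real" where
  "cos_diff_fun k z = cos (2 * pi * real k * (fst z - snd z))"

lemma borel_measurable_cos_diff_fun [measurable]: "cos_diff_fun k \<in> borel_measurable borel"
  unfolding cos_diff_fun_def[abs_def] by (intro borel_measurable_continuous_onI continuous_intros)

lemma abs_cos_diff_fun_le: "\<bar>cos_diff_fun k z\<bar> \<le> 1"
  by (simp add: cos_diff_fun_def)

lemma trig_cov_eq: "trig_cov M A z = (\<Sum>k<M. (A k)\<^sup>2 * cos_diff_fun k z)"
  by (simp add: trig_cov_def cos_diff_fun_def split_beta)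

lemma integral_torus_cos:
  fixes l :: int
  shows "(LINT z|torus. cos (2 * pi * real_of_int l * (fst z - snd z))) = (if l = 0 then 1 else 0)"
proof -
  interpret prob_space torus by (rule prob_space_torus)
  interpret C: prob_space circle by (rule prob_space_circle)
  interpret CC: pair_sigma_finite circle circle by standard
  let ?f = "\<lambda>z. cos (2 * pi * real_of_int l * (fst z - snd z))"
  have "integrable torus ?f"
    by (rule integrable_torus_bounded[of _ 1])
      (auto intro!: borel_measurable_continuous_onI continuous_intros)
  hence "(LINT z|torus. ?f z) = (LINT s|circle. LINT t|circle. cos (2 * pi * real_of_int l * (s - t)))"
    by (subst CC.integral_fst'[symmetric]) (simp_all add: split_beta)
  also have "\<dots> = (if l = 0 then 1 else 0)"
    by (simp add: integral_circle_cos C.prob_space[simplified])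
  finally show ?thesis .
qed

text \<open>\<open>k\<close> starts at 1 because the constant function has squared norm 1 instead of
  1/2; the spectra of the lower bound start at 1 accordingly.\<close>

lemma integral_cos_diff_fun_mult:
  assumes "1 \<le> k"
  shows "(LINT z|torus. cos_diff_fun l z * cos_diff_fun k z) = (if l = k then 1/2 else 0)"
proof -
  have eq: "cos_diff_fun l z * cos_diff_fun k z =
      cos (2 * pi * real_of_int (int l - int k) * (fst z - snd z)) / 2 +
      cos (2 * pi * real_of_int (int l + int k) * (fst z - snd z)) / 2" for z
    unfolding cos_diff_fun_def cos_times_cos left_diff_distrib[symmetric] distrib_right[symmetric]
      right_diff_distrib[symmetric] distrib_left[symmetric] add_divide_distrib by simp
  have int: "integrable torus (\<lambda>z. cos (2 * pi * real_of_int j * (fst z - snd z)))" for j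
    by (rule integrable_torus_bounded[of _ 1])
      (auto intro!: borel_measurable_continuous_onI continuous_intros)
  show ?thesis
    unfolding eq using assms int
    by (subst Bochner_Integration.integral_add) (auto simp only: integral_torus_cos integral_divide_zero integrable_divide, auto)
qed

text \<open>The cosines are orthogonal with squared norm 1/2, so an error e in a Fourier coefficient
  contributes 2 e^2. The true coefficient at \<open>k\<close> is (A k)^2 / 2.\<close>

lemma bessel_trig_cov:
  assumes [measurable]: "F \<in> borel_measurable borel" and K: "\<And>k. k \<in> K \<Longrightarrow> 1 \<le> k \<and> k < M"
  shows "(\<Sum>k\<in>K. ennreal (2 * ((LINT z|torus. F z * cos_diff_fun k z) - (A k)\<^sup>2 / 2)\<^sup>2)) \<le>
    L2_dist_sq F (trig_cov M A)"
proof -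
  interpret prob_space torus by (rule prob_space_torus)
  have fin: "finite K" using K by (intro finite_subset[of K "{..<M}"]) auto
  define H where "H z = F z - trig_cov M A z" for z
  have [measurable]: "trig_cov M A \<in> borel_measurable borel"
    unfolding trig_cov_eq[abs_def] by measurable
  have [measurable]: "H \<in> borel_measurable borel" unfolding H_def by measurable
  have dist: "L2_dist_sq F (trig_cov M A) = (\<integral>\<^sup>+z. ennreal ((H z)\<^sup>2) \<partial>torus)"
    by (simp add: L2_dist_sq_def H_def)
  show ?thesis
  \<comment> \<open>At infinite distance the claim is trivial, whatever value the integral of a
    non-integrable \<open>F\<close> takes. Otherwise \<open>F\<close> is a bounded function plus a
    square integrable \<open>H\<close>, and all coefficients exist.\<close>
  proof (cases "L2_dist_sq F (trig_cov M A) = \<infinity>")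
    case False
    have [measurable]: "H \<in> borel_measurable torus" by measurable
    have intH2: "integrable torus (\<lambda>z. (H z)\<^sup>2)"
      using False dist by (intro integrableI_nonneg) (auto simp: top.not_eq_extremum)
    have intH: "integrable torus H"
      by (rule square_integrable_imp_integrable[OF _ intH2]) measurable
    have intHk: "integrable torus (\<lambda>z. H z * cos_diff_fun k z)" for k
      by (rule Bochner_Integration.integrable_bound[OF intH])
        (auto simp: abs_mult intro!: mult_left_le abs_cos_diff_fun_le)
    have intkl: "integrable torus (\<lambda>z. cos_diff_fun l z * cos_diff_fun k z)" for k l
      using abs_cos_diff_fun_le by (intro integrable_torus_bounded[of _ 1]) (auto simp: abs_mult intro!: mult_le_one)
    define e where "e k = (LINT z|torus. H z * cos_diff_fun k z)" for k
    have e: "(LINT z|torus. F z * cos_diff_fun k z) - (A k)\<^sup>2 / 2 = e k" if "k \<in> K" for k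
    proof -
      have k: "1 \<le> k" "k < M" using K that by auto
      have "(LINT z|torus. F z * cos_diff_fun k z) =
          (LINT z|torus. H z * cos_diff_fun k z + (\<Sum>l<M. (A l)\<^sup>2 * (cos_diff_fun l z * cos_diff_fun k z)))"
        by (simp add: H_def trig_cov_eq left_diff_distrib sum_distrib_right mult.assoc)
      also have "\<dots> = e k + (LINT z|torus. (\<Sum>l<M. (A l)\<^sup>2 * (cos_diff_fun l z * cos_diff_fun k z)))"
        unfolding e_def using intHk intkl by (intro Bochner_Integration.integral_add) auto
      also have "(LINT z|torus. (\<Sum>l<M. (A l)\<^sup>2 * (cos_diff_fun l z * cos_diff_fun k z))) =
          (\<Sum>l<M. (A l)\<^sup>2 * (if l = k then 1/2 else 0))"
        using intkl k by (subst Bochner_Integration.integral_sum) (simp_all add: integral_cos_diff_fun_mult)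
      also have "\<dots> = (A k)\<^sup>2 / 2" using k by (simp add: if_distrib[of "(*) _"] cong: if_cong)
      finally show ?thesis by simp
    qed
    \<comment> \<open>Orthogonal projection of \<open>H\<close> onto the cosines in
      \<open>K\<close>; the factor 2 inverts their squared norm. Bessel's inequality follows from
      the nonnegative norm of H - p.\<close>
    define p where "p z = (\<Sum>k\<in>K. 2 * e k * cos_diff_fun k z)" for z
    have exp: "(H z - p z)\<^sup>2 = (H z)\<^sup>2 - (\<Sum>k\<in>K. 4 * e k * (H z * cos_diff_fun k z)) +
        (\<Sum>k\<in>K. \<Sum>l\<in>K. 4 * e k * e l * (cos_diff_fun l z * cos_diff_fun k z))" for z
    proof -
      have "2 * H z * p z = (\<Sum>k\<in>K. 4 * e k * (H z * cos_diff_fun k z))"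
        unfolding p_def sum_distrib_left by (intro sum.cong) auto
      moreover have "(p z)\<^sup>2 = (\<Sum>k\<in>K. \<Sum>l\<in>K. 4 * e k * e l * (cos_diff_fun l z * cos_diff_fun k z))"
        unfolding p_def power2_eq_square sum_product by (intro sum.cong) auto
      ultimately show ?thesis by (simp add: power2_diff)
    qed
    have "0 \<le> (LINT z|torus. (H z - p z)\<^sup>2)" by (intro integral_nonneg_AE) auto
    also have "\<dots> = (LINT z|torus. (H z)\<^sup>2) - (\<Sum>k\<in>K. 4 * e k * e k) + (\<Sum>k\<in>K. \<Sum>l\<in>K. 4 * e k * e l * (if l = k then 1/2 else 0))"
    proof -
      have "(LINT z|torus. (\<Sum>k\<in>K. \<Sum>l\<in>K. 4 * e k * e l * (cos_diff_fun l z * cos_diff_fun k z))) =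
          (\<Sum>k\<in>K. \<Sum>l\<in>K. 4 * e k * e l * (if l = k then 1/2 else 0))"
        using intkl K by (simp add: Bochner_Integration.integral_sum integral_cos_diff_fun_mult)
      moreover have "(LINT z|torus. (\<Sum>k\<in>K. 4 * e k * (H z * cos_diff_fun k z))) = (\<Sum>k\<in>K. 4 * e k * e k)"
        using intHk by (simp add: Bochner_Integration.integral_sum e_def)
      ultimately show ?thesis
        unfolding exp using intHk intkl intH2
        by (subst Bochner_Integration.integral_add) (auto simp: Bochner_Integration.integral_diff)
    qed
    also have "(\<Sum>k\<in>K. \<Sum>l\<in>K. 4 * e k * e l * (if l = k then 1/2 else 0)) = (\<Sum>k\<in>K. 2 * e k * e k)"
      using fin by (intro sum.cong) (auto simp: if_distrib[of "(*) _"] cong: if_cong)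
    finally have nonneg: "0 \<le> (LINT z|torus. (H z)\<^sup>2) - (\<Sum>k\<in>K. 4 * e k * e k) + (\<Sum>k\<in>K. 2 * e k * e k)" .
    have "(\<Sum>k\<in>K. 2 * (e k)\<^sup>2) \<le> (LINT z|torus. (H z)\<^sup>2)"
    proof -
      have "(\<Sum>k\<in>K. 4 * e k * e k) = (\<Sum>k\<in>K. 2 * (e k)\<^sup>2) + (\<Sum>k\<in>K. 2 * (e k)\<^sup>2)"
        unfolding sum.distrib[symmetric] by (intro sum.cong) (simp_all add: power2_eq_square)
      moreover have "(\<Sum>k\<in>K. 2 * e k * e k) = (\<Sum>k\<in>K. 2 * (e k)\<^sup>2)"
        by (intro sum.cong) (simp_all add: power2_eq_square)
      ultimately show ?thesis using nonneg by linarith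
    qed
    hence "ennreal (\<Sum>k\<in>K. 2 * (e k)\<^sup>2) \<le> ennreal (LINT z|torus. (H z)\<^sup>2)"
      by (rule ennreal_leI)
    also have "ennreal (LINT z|torus. (H z)\<^sup>2) = (\<integral>\<^sup>+z. ennreal ((H z)\<^sup>2) \<partial>torus)"
      by (rule nn_integral_eq_integral[OF intH2, symmetric]) simp
    also have "ennreal (\<Sum>k\<in>K. 2 * (e k)\<^sup>2) = (\<Sum>k\<in>K. ennreal (2 * (e k)\<^sup>2))"
      by (rule sum_ennreal[symmetric]) simp
    also have "\<dots> = (\<Sum>k\<in>K. ennreal (2 * ((LINT z|torus. F z * cos_diff_fun k z) - (A k)\<^sup>2 / 2)\<^sup>2))"
      by (intro sum.cong refl) (simp only: e)
    finally show ?thesis unfolding dist .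
  qed (simp only: infinity_ennreal_def top_greatest)
qed

section \<open>The minimax bound\<close>

text \<open>Pairs the vertices of the hypercube along the edges of direction
  \<open>k\<close>.\<close>

lemma sum_Pow_insert:
  fixes f :: "'a set \<Rightarrow> 'b::comm_monoid_add"
  assumes "finite K" "k \<in> K"
  shows "(\<Sum>V\<in>Pow K. f V) = (\<Sum>V\<in>Pow (K - {k}). f V + f (insert k V))"
proof -
  have "Pow K = Pow (insert k (K - {k}))" using assms by (simp add: insert_absorb)
  also have "\<dots> = Pow (K - {k}) \<union> insert k ` Pow (K - {k})" by (rule Pow_insert)
  finally have "(\<Sum>V\<in>Pow K. f V) = (\<Sum>V\<in>Pow (K - {k}). f V) + (\<Sum>V\<in>insert k ` Pow (K - {k}). f V)"
    using assms by (simp only:) (rule sum.union_disjoint, auto)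
  also have "(\<Sum>V\<in>insert k ` Pow (K - {k}). f V) = (\<Sum>V\<in>Pow (K - {k}). f (insert k V))"
    by (rule sum.reindex_cong[of "insert k"]) (auto intro!: inj_onI)
  finally show ?thesis by (simp add: sum.distrib)
qed

lemma
  assumes est: "est \<in> estimators n"
  shows borel_measurable_estimate: "d \<in> space (data_space n) \<Longrightarrow> est d \<in> borel_measurable borel"
    and borel_measurable_estimate_coeff: "(\<lambda>d. LINT z|torus. est d z * cos_diff_fun k z) \<in> borel_measurable (data_space n)"
    and borel_measurable_L2_dist_sq: "C \<in> borel_measurable borel \<Longrightarrow> (\<lambda>d. L2_dist_sq (est d) C) \<in> borel_measurable (data_space n)"
proof -
  interpret prob_space torus by (rule prob_space_torus)
  have e [measurable]: "(\<lambda>p. est (fst p) (snd p)) \<in> borel_measurable (data_space n \<Otimes>\<^sub>M borel)"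
    using est by (simp add: estimators_def split_beta)
  have t: "sets (data_space n \<Otimes>\<^sub>M torus) = sets (data_space n \<Otimes>\<^sub>M borel)"
    by (intro sets_pair_measure_cong refl sets_torus)
  show "est d \<in> borel_measurable borel" if "d \<in> space (data_space n)"
    using measurable_compose[OF measurable_Pair1'[OF that] e] by simp
  have "(\<lambda>p. est (fst p) (snd p) * cos_diff_fun k (snd p)) \<in> borel_measurable (data_space n \<Otimes>\<^sub>M torus)"
    by (subst measurable_cong_sets[OF t refl]) measurable
  thus "(\<lambda>d. LINT z|torus. est d z * cos_diff_fun k z) \<in> borel_measurable (data_space n)"
    by (intro borel_measurable_lebesgue_integral) (simp add: split_beta)
  assume [measurable]: "C \<in> borel_measurable borel"
  have "(\<lambda>p. ennreal ((est (fst p) (snd p) - C (snd p))\<^sup>2)) \<in> borel_measurable (data_space n \<Otimes>\<^sub>M torus)"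
    by (subst measurable_cong_sets[OF t refl]) measurable
  thus "(\<lambda>d. L2_dist_sq (est d) C) \<in> borel_measurable (data_space n)"
    unfolding L2_dist_sq_def by (intro borel_measurable_nn_integral) (simp add: split_beta)
qed

lemma observations_in_data_space: "observations P n x \<in> space (data_space n)"
  by (auto simp: observations_def data_space_def space_PiM space_pair_measure)

context
  fixes P :: fda_model and \<sigma> :: real
  assumes P: "prob_space (design_law P)" and \<sigma>: "0 < \<sigma>"
begin

lemma measurable_observations:
  "observations (trig_model P \<sigma> M A) n \<in> joint_law (trig_model P \<sigma> M A) n \<rightarrow>\<^sub>M data_space n"
proof -
  note [measurable] = measurable_subject_obs[OF P \<sigma>]
  show ?thesis
    unfolding observations_def[abs_def] joint_law_def subject_law_trig_model data_space_def
      subject_data_space_def[symmetric]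
    by measurable
qed

text \<open>Origin of 1/32: the losses of two neighbours in the differing coordinate add up to a^4 /
  4, the two-point bound keeps a quarter of this, and each direction has 2^(M-1) edges for 2^M
  vertices.\<close>

lemma assouad_bound:
  assumes "1 \<le> n" and est: "est \<in> estimators n"
    and x: "x = a\<^sup>2 / \<sigma>\<^sup>2"
    and m2: "(\<integral>\<^sup>+N. ennreal ((real N)\<^sup>2) \<partial>measure_pmf (count_law P)) \<le> ennreal m2" "0 \<le> m2"
    and small: "real n * (16 * x\<^sup>2 * m2) \<le> 1"
    and \<P>: "\<And>V. V \<subseteq> {1..M} \<Longrightarrow> trig_model P \<sigma> (Suc M) (\<lambda>k. if k \<in> V then a else 0) \<in> \<P>"
    and "1 \<le> M"
  shows "ennreal (real M * a ^ 4 / 32) \<le> (SUP Q\<in>\<P>. risk Q n est)"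
proof -
  define S where "S = (SUP Q\<in>\<P>. risk Q n est)"
  define A where "A V = (\<lambda>k. if k \<in> V then a else 0)" for V :: "nat set"
  \<comment> \<open>\<open>Suc M\<close> frequencies are 0, ..., M; for \<open>V\<close> inside
    {1..M} frequency 0 keeps amplitude 0.\<close>
  define Q where "Q V = trig_model P \<sigma> (Suc M) (A V)" for V
  \<comment> \<open>Loss in coordinate \<open>k\<close>. It depends on the spectrum only through
    whether \<open>k\<close> belongs to it, so along an edge of direction \<open>k\<close> there are
    just two losses to compare.\<close>
  define g where "g k b d = ennreal (2 * ((LINT z|torus. est d z * cos_diff_fun k z) - (if b then a\<^sup>2 else 0) / 2)\<^sup>2)" for k b d
  define r where "r V k = (\<integral>\<^sup>+y. g k (k \<in> V) (observations (Q V) n y) \<partial>joint_law (Q V) n)" for V k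
  have g [measurable]: "g k b \<in> borel_measurable (data_space n)" for k b
  proof -
    note [measurable] = borel_measurable_estimate_coeff[OF est]
    show ?thesis unfolding g_def[abs_def] by measurable
  qed
  have obs [measurable]: "observations (Q V) n \<in> joint_law (Q V) n \<rightarrow>\<^sub>M data_space n" for V
    unfolding Q_def by (rule measurable_observations)
  have pair: "ennreal (a ^ 4 / 16) \<le> r V k + r (insert k V) k" if "k \<in> {1..M}" "k \<notin> V" for k V
  proof -
    have A: "(A V)(k := a) = A (insert k V)" "A V k = 0" using that by (auto simp: A_def)
    have "ennreal (a ^ 4 / 4) \<le> g k False d + g k True d" for d
    proof -
      define y where "y = (LINT z|torus. est d z * cos_diff_fun k z)"
      \<comment> \<open>Equivalent to 2 y^2 + 2 (y - c)^2 >= c^2 for c = a^2 / 2.\<close>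
      have "0 \<le> (2 * y - a\<^sup>2 / 2)\<^sup>2" by simp
      hence "a ^ 4 / 4 \<le> 2 * (y - 0 / 2)\<^sup>2 + 2 * (y - a\<^sup>2 / 2)\<^sup>2"
        by (simp add: power2_eq_square power4_eq_xxxx field_simps)
      hence "ennreal (a ^ 4 / 4) \<le> ennreal (2 * (y - 0 / 2)\<^sup>2 + 2 * (y - a\<^sup>2 / 2)\<^sup>2)"
        by (rule ennreal_leI)
      thus ?thesis by (simp add: g_def y_def)
    qed
    from wave_two_point[where M="Suc M" and A="A V" and k=k and ?G0.0="g k False" and ?G1.0="g k True",
        OF P \<sigma> _ A(2) x m2 small \<open>1 \<le> n\<close> g g _ this]
    show ?thesis using that by (simp add: r_def Q_def A(1))
  qed
  have lower: "(\<Sum>k\<in>{1..M}. r V k) \<le> S" if "V \<subseteq> {1..M}" for V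
  proof -
    have "(\<Sum>k\<in>{1..M}. r V k) = (\<integral>\<^sup>+y. (\<Sum>k\<in>{1..M}. g k (k \<in> V) (observations (Q V) n y)) \<partial>joint_law (Q V) n)"
      unfolding r_def by (rule nn_integral_sum[symmetric]) measurable
    also have "\<dots> \<le> (\<integral>\<^sup>+y. L2_dist_sq (est (observations (Q V) n y)) (trig_cov (Suc M) (A V)) \<partial>joint_law (Q V) n)"
    proof (rule nn_integral_mono)
      fix y
      have "g k (k \<in> V) d = ennreal (2 * ((LINT z|torus. est d z * cos_diff_fun k z) - (A V k)\<^sup>2 / 2)\<^sup>2)" for k d
        by (simp add: g_def A_def)
      thus "(\<Sum>k\<in>{1..M}. g k (k \<in> V) (observations (Q V) n y)) \<le>
          L2_dist_sq (est (observations (Q V) n y)) (trig_cov (Suc M) (A V))"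
        using bessel_trig_cov[OF borel_measurable_estimate[OF est observations_in_data_space], of "{1..M}" "Suc M"]
        by simp
    qed
    also have "\<dots> = risk (Q V) n est" by (simp add: risk_def Q_def)
    also have "\<dots> \<le> S"
      unfolding S_def using \<P>[OF that] by (intro SUP_upper) (simp add: Q_def A_def)
    finally show ?thesis .
  qed
  have two: "(2 :: ennreal) ^ j = ennreal (2 ^ j)" for j
    by (simp add: ennreal_power[symmetric])
  \<comment> \<open>Sum over the hypercube: the edges bound it from below, and the supremum bounds
    each of the 2^M vertices from above.\<close>
  have "ennreal (real M * (2 ^ (M - 1) * (a ^ 4 / 16))) = (\<Sum>k\<in>{1..M}. \<Sum>V\<in>Pow ({1..M} - {k}). ennreal (a ^ 4 / 16))"
    by (simp add: card_Pow two ennreal_of_nat_eq_real_of_nat ennreal_mult[symmetric])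
  also have "\<dots> \<le> (\<Sum>k\<in>{1..M}. \<Sum>V\<in>Pow ({1..M} - {k}). r V k + r (insert k V) k)"
    by (intro sum_mono pair) auto
  also have "\<dots> = (\<Sum>k\<in>{1..M}. \<Sum>V\<in>Pow {1..M}. r V k)"
    by (intro sum.cong refl sum_Pow_insert[symmetric]) auto
  also have "\<dots> = (\<Sum>V\<in>Pow {1..M}. \<Sum>k\<in>{1..M}. r V k)"
    by (rule sum.swap)
  also have "\<dots> \<le> (\<Sum>V\<in>Pow {1..M}. S)"
    by (intro sum_mono lower) auto
  also have "\<dots> = ennreal (2 ^ M) * S"
    by (simp add: card_Pow ennreal_power[symmetric])
  finally have main: "ennreal (real M * (2 ^ (M - 1) * (a ^ 4 / 16))) \<le> ennreal (2 ^ M) * S" .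
  have "ennreal (real M * a ^ 4 / 32) \<le> S"
  proof (cases S)
    case (real s)
    have "real M * (2 ^ (M - 1) * (a ^ 4 / 16)) \<le> 2 ^ M * s"
      using main real by (simp add: ennreal_mult[symmetric])
    moreover have "(2::real) ^ M = 2 * 2 ^ (M - 1)"
      using \<open>1 \<le> M\<close> by (cases M) auto
    ultimately have "2 ^ (M - 1) * (real M * a ^ 4 / 16) \<le> 2 ^ (M - 1) * (2 * s)"
      by (simp only:) (simp add: mult_ac)
    hence "real M * a ^ 4 / 16 \<le> 2 * s" by (rule mult_left_le_imp_le) simp
    thus ?thesis unfolding real(2) by (intro ennreal_leI) simp
  qed simp
  thus ?thesis by (simp add: S_def)
qed

text \<open>The choice of \<delta> makes n \<delta>^2 = 1/4. The two losses add up to at least B^2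
  \<delta>^2 / 2; a quarter remains after the two-point bound and half of that for the larger risk,
  which is B^2 / (64 n).\<close>

lemma parametric_bound:
  assumes "1 \<le> n" and est: "est \<in> estimators n" and \<delta>: "\<delta> = 1 / (2 * sqrt (real n))"
    and b: "b\<^sup>2 = B" and s: "s = sqrt (1 + \<delta>)"
    and \<P>: "trig_model P \<sigma> 1 (\<lambda>_. b) \<in> \<P>" "trig_model P \<sigma> 1 (\<lambda>_. s * b) \<in> \<P>"
  shows "ennreal (B\<^sup>2 / 64 / real n) \<le> (SUP Q\<in>\<P>. risk Q n est)"
proof -
  interpret T: prob_space torus by (rule prob_space_torus)
  define S where "S = (SUP Q\<in>\<P>. risk Q n est)"
  have n: "0 < real n" using assms by simp
  have \<delta>2: "\<delta>\<^sup>2 = 1 / (4 * real n)" "0 < \<delta>" using n by (simp_all add: \<delta> power_divide power_mult_distrib)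
  have s2: "s\<^sup>2 = 1 + \<delta>" using \<delta>2(2) by (simp add: s)
  have cov: "trig_cov 1 (\<lambda>_. c) = (\<lambda>_. c\<^sup>2)" for c
    by (simp add: trig_cov_def fun_eq_iff)
  let ?g = "\<lambda>c d. L2_dist_sq (est d) (\<lambda>_. c)"
  have g: "?g c \<in> borel_measurable (data_space n)" for c
    by (rule borel_measurable_L2_dist_sq[OF est]) simp
  have D: "ennreal (B\<^sup>2 * \<delta>\<^sup>2 / 2) \<le> ?g B d + ?g ((1 + \<delta>) * B) d" if "d \<in> space (data_space n)" for d
  proof -
    have [measurable]: "est d \<in> borel_measurable torus"
      using borel_measurable_estimate[OF est that] by (subst measurable_cong_sets[OF sets_torus refl])
    have "ennreal (B\<^sup>2 * \<delta>\<^sup>2 / 2) = (\<integral>\<^sup>+z. ennreal (B\<^sup>2 * \<delta>\<^sup>2 / 2) \<partial>torus)"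
      by (simp add: T.emeasure_space_1)
    also have "\<dots> \<le> (\<integral>\<^sup>+z. ennreal ((est d z - B)\<^sup>2) + ennreal ((est d z - (1 + \<delta>) * B)\<^sup>2) \<partial>torus)"
    proof (rule nn_integral_mono)
      fix z
      have "0 \<le> ((est d z - B) + (est d z - (1 + \<delta>) * B))\<^sup>2" by simp
      hence "B\<^sup>2 * \<delta>\<^sup>2 / 2 \<le> (est d z - B)\<^sup>2 + (est d z - (1 + \<delta>) * B)\<^sup>2"
        by (simp add: power2_eq_square field_simps)
      hence "ennreal (B\<^sup>2 * \<delta>\<^sup>2 / 2) \<le> ennreal ((est d z - B)\<^sup>2 + (est d z - (1 + \<delta>) * B)\<^sup>2)"
        by (rule ennreal_leI)
      thus "ennreal (B\<^sup>2 * \<delta>\<^sup>2 / 2) \<le> ennreal ((est d z - B)\<^sup>2) + ennreal ((est d z - (1 + \<delta>) * B)\<^sup>2)"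
        by simp
    qed
    also have "\<dots> = ?g B d + ?g ((1 + \<delta>) * B) d"
      unfolding L2_dist_sq_def by (rule nn_integral_add) measurable
    finally show ?thesis .
  qed
  have "ennreal (B\<^sup>2 * \<delta>\<^sup>2 / 2 / 4) \<le> risk (trig_model P \<sigma> 1 (\<lambda>_. b)) n est + risk (trig_model P \<sigma> 1 (\<lambda>_. s * b)) n est"
    unfolding risk_def model_cov_trig_model cov power_mult_distrib s2 b
    using \<delta>2 n by (intro scale_two_point[OF P \<sigma> _ _ s \<open>1 \<le> n\<close> g g _ D]) simp_all
  also have "\<dots> \<le> S + S"
    unfolding S_def by (intro add_mono SUP_upper \<P>)
  also have "B\<^sup>2 * \<delta>\<^sup>2 / 2 / 4 = B\<^sup>2 / 64 / real n + B\<^sup>2 / 64 / real n"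
    using n by (simp add: \<delta>2 field_simps)
  finally have main: "ennreal (B\<^sup>2 / 64 / real n + B\<^sup>2 / 64 / real n) \<le> S + S" .
  have "ennreal (B\<^sup>2 / 64 / real n) \<le> S"
  proof (cases S)
    case (real t)
    have "ennreal (B\<^sup>2 / 64 / real n + B\<^sup>2 / 64 / real n) \<le> ennreal (t + t)"
      using main real(1) unfolding real(2) by (simp only: ennreal_plus[symmetric])
    hence "B\<^sup>2 / 64 / real n \<le> t" using real by (subst (asm) ennreal_le_iff) auto
    thus ?thesis unfolding real(2) by (rule ennreal_leI)
  qed simp
  thus ?thesis by (simp add: S_def)
qed

end

text \<open>E N^2 = E N (N - 1) + E N, and m <= m^2 absorbs the linear term.\<close>

lemma count_second_moment:
  assumes k: "consts_ok k" and P: "A3 k P" "intensity k m P" and m: "2 \<le> m"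
  shows "(\<integral>\<^sup>+N. ennreal ((real N)\<^sup>2) \<partial>measure_pmf (count_law P)) \<le>
    ennreal ((pair_hi k * (mean_hi k)\<^sup>2 + mean_hi k) * m\<^sup>2)"
proof -
  let ?\<nu> = "measure_pmf (count_law P)"
  have i4: "integrable ?\<nu> (\<lambda>N. real N ^ 4)"
    using P by (simp add: A3_def Let_def)
  have "N ^ i \<le> N ^ 4" if "1 \<le> i" "i \<le> 4" for N i :: nat
    using that by (cases "N = 0") (auto intro: power_increasing)
  hence le: "real N ^ i \<le> real N ^ 4" if "1 \<le> i" "i \<le> 4" for N i :: nat
    using that by (metis of_nat_le_iff of_nat_power)
  have i2: "integrable ?\<nu> (\<lambda>N. (real N)\<^sup>2)"
    by (rule Bochner_Integration.integrable_bound[OF i4]) (use le[of 2] in auto)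
  have i1: "integrable ?\<nu> real"
    by (rule Bochner_Integration.integrable_bound[OF i4]) (use le[of 1] in auto)
  define E where "E = (LINT N|?\<nu>. real N)"
  have "(LINT N|?\<nu>. real N * (real N - 1)) = (LINT N|?\<nu>. (real N)\<^sup>2 - real N)"
    by (simp add: power2_eq_square algebra_simps)
  also have "\<dots> = (LINT N|?\<nu>. (real N)\<^sup>2) - E"
    unfolding E_def using i2 i1 by (rule Bochner_Integration.integral_diff)
  finally have "(LINT N|?\<nu>. (real N)\<^sup>2) \<le> pair_hi k * E\<^sup>2 + E"
    using P by (simp add: A3_def Let_def E_def)
  also have "\<dots> \<le> pair_hi k * (mean_hi k * m)\<^sup>2 + mean_hi k * m\<^sup>2"
  proof (intro add_mono mult_left_mono power_mono)
    show E: "E \<le> mean_hi k * m" "0 \<le> E"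
      using P by (auto simp: intensity_def E_def intro!: integral_nonneg_AE)
    have "mean_hi k * m \<le> mean_hi k * m\<^sup>2"
      using k m by (intro mult_left_mono) (auto simp: consts_ok_def power2_eq_square)
    thus "E \<le> mean_hi k * m\<^sup>2" using E by simp
    show "0 \<le> pair_hi k" using k by (simp add: consts_ok_def)
  qed
  also have "\<dots> = (pair_hi k * (mean_hi k)\<^sup>2 + mean_hi k) * m\<^sup>2"
    by (simp add: power_mult_distrib algebra_simps)
  finally show ?thesis
    by (subst nn_integral_eq_integral[OF i2]) (auto intro: ennreal_leI)
qed

text \<open>Over an empty class the supremum, and with it the minimax risk, would be zero;
  nonemptiness excludes this and supplies the member whose counts and design are kept.\<close>

theorem theorem6p4:
  fixes \<beta> R :: real and k :: fda_consts and K :: "real \<Rightarrow> real"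
  assumes "0 < \<beta>" "\<beta> \<le> 2" "0 < R" "consts_ok k" "A6 K"
  shows "\<exists>c>0. \<forall>(qs :: nat \<Rightarrow> nat) J (n :: nat) (m :: real).
           divisor_chain qs J \<longrightarrow> n \<ge> 1 \<longrightarrow> m \<ge> 2 \<longrightarrow>
           (\<forall>q \<in> qs ` {..J}.
              model_class k (qs ` {..J}) q \<beta> R m \<noteq> {} \<longrightarrow>
              minimax_risk (model_class k (qs ` {..J}) q \<beta> R m) n
                \<ge> ennreal (c * ((real n * m\<^sup>2) powr (- ((2 * \<beta> + 1) / (2 * \<beta> + 2))) + 1 / real n)))"
proof -
  define K0 where "K0 = mom_const k"
  \<comment> \<open>The largest value with \<open>2 * \<sigma> \<le> mom_const k\<close>.\<close>
  define \<sigma> where "\<sigma> = K0 / 2"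
  define \<kappa> where "\<kappa> = pair_hi k * (mean_hi k)\<^sup>2 + mean_hi k"
  \<comment> \<open>In this order the bounds keep the variance within \<open>A4\<close>, the Hoelder
    norm within \<open>R\<close>, and each frequency undetectable.\<close>
  define e where "e = min (K0\<^sup>2 / 4) (min (R / (7 * (2 * pi) powr \<beta>)) (\<sigma>\<^sup>2 / (4 * sqrt \<kappa>)))"
  \<comment> \<open>The larger of the two variances is at most 3 B / 2; the two terms solve 4 (3 B /
    2) = K0^2 and 7 (3 B / 2) = R.\<close>
  define B where "B = min (K0\<^sup>2 / 6) (2 * R / 21)"
  \<comment> \<open>1/32 is Assouad's constant, and the power of 2 pays for rounding up to M <= 2
    u.\<close>
  define c1 where "c1 = e\<^sup>2 / 32 * 2 powr (- (2 * \<beta> + 1))"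
  define c2 where "c2 = B\<^sup>2 / 64"
  \<comment> \<open>Halved because only the maximum of the two lower bounds is available, and it is
    at least their mean.\<close>
  define c where "c = min c1 c2 / 2"
  have K0: "0 < K0" "0 < \<sigma>" using assms by (simp_all add: K0_def \<sigma>_def consts_ok_def)
  have "0 < pair_hi k" "0 < mean_hi k" using assms by (auto simp: consts_ok_def)
  hence \<kappa>: "0 < \<kappa>" by (simp add: \<kappa>_def add_pos_pos)
  have e: "0 < e" using K0 \<kappa> assms by (simp add: e_def)
  have B: "0 < B" using K0 assms by (simp add: B_def)
  have c12: "0 < c1" "0 < c2" using e B by (simp_all add: c1_def c2_def)
  hence "0 < c" by (simp add: c_def)
  moreover have "ennreal (c * ((real n * m\<^sup>2) powr (- ((2 * \<beta> + 1) / (2 * \<beta> + 2))) + 1 / real n)) \<le>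
      minimax_risk (model_class k Q q \<beta> R m) n"
    if n: "1 \<le> n" and m: "2 \<le> m" and ne: "model_class k Q q \<beta> R m \<noteq> {}" for Q q n and m :: real
    unfolding minimax_risk_def
  proof (rule INF_greatest)
    fix est assume est: "est \<in> estimators n"
    obtain P where P: "P \<in> model_class k Q q \<beta> R m" using ne by blast
    have des: "prob_space (design_law P)" and A3: "A3 k P" and int: "intensity k m P"
      using P by (auto simp: model_class_def fda_valid_def)
    define S where "S = (SUP Q\<in>model_class k Q q \<beta> R m. risk Q n est)"
    define r where "r = real n * m\<^sup>2"
    define u where "u = r powr (1 / (2 * \<beta> + 2))"
    \<comment> \<open>Rounded up because M >= u is what makes a frequency undetectable; as u >= 1,
      this costs a factor of at most 2.\<close>
    define M where "M = nat \<lceil>u\<rceil>"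
    have "1 * 2\<^sup>2 \<le> r" unfolding r_def using n m by (intro mult_mono power_mono) auto
    hence r: "1 \<le> r" by simp
    hence u: "1 \<le> u" using assms by (simp add: u_def ge_one_powr_ge_zero)
    have M: "u \<le> real M" "real M \<le> 2 * u" using u by (auto simp: M_def) linarith+
    hence M1: "1 \<le> M" using u by linarith
    define a2 where "a2 = e * real M powr (- \<beta> - 1)"
    define a where "a = sqrt a2"
    have a2: "0 < a2" "a\<^sup>2 = a2" using e M1 by (simp_all add: a2_def a_def)
    have a22: "a2\<^sup>2 = e\<^sup>2 * real M powr (- (2 * \<beta> + 2))"
    proof -
      have "a2\<^sup>2 = e\<^sup>2 * (real M powr (- \<beta> - 1) * real M powr (- \<beta> - 1))"
        by (simp add: a2_def power2_eq_square)
      also have "\<dots> = e\<^sup>2 * real M powr ((- \<beta> - 1) + (- \<beta> - 1))"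
        by (simp only: powr_add)
      also have "(- \<beta> - 1) + (- \<beta> - 1) = - (2 * \<beta> + 2)" by simp
      finally show ?thesis .
    qed
    have Ma2: "real M * a2 = e * real M powr (- \<beta>)"
      using M1 by (simp add: a2_def powr_diff)
    have u_pow: "u powr (2 * \<beta> + 2) = r" "u powr (- (2 * \<beta> + 1)) = r powr (- ((2 * \<beta> + 1) / (2 * \<beta> + 2)))"
    proof -
      have "1 / (2 * \<beta> + 2) * (- (2 * \<beta> + 1)) = - ((2 * \<beta> + 1) / (2 * \<beta> + 2))"
        by (simp only: times_divide_eq_left mult_1 minus_divide_left)
      thus "u powr (- (2 * \<beta> + 1)) = r powr (- ((2 * \<beta> + 1) / (2 * \<beta> + 2)))"
        by (simp only: u_def powr_powr)
    qed (use r assms in \<open>simp add: u_def powr_powr\<close>)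
    have 1: "ennreal (real M * a ^ 4 / 32) \<le> S"
      unfolding S_def
    proof (rule assouad_bound[OF des K0(2) n est refl])
      show "(\<integral>\<^sup>+N. ennreal ((real N)\<^sup>2) \<partial>measure_pmf (count_law P)) \<le> ennreal (\<kappa> * m\<^sup>2)"
        unfolding \<kappa>_def using assms(4) A3 int m by (rule count_second_moment)
      show "0 \<le> \<kappa> * m\<^sup>2" using \<kappa> by simp
      \<comment> \<open>The balance of the construction: M^(2\<beta>+2) is at least n m^2.\<close>
      have "r * a2\<^sup>2 \<le> e\<^sup>2"
      proof -
        have "a2\<^sup>2 = e\<^sup>2 * real M powr (- (2 * \<beta> + 2))" by (rule a22)
        also have "\<dots> \<le> e\<^sup>2 * u powr (- (2 * \<beta> + 2))"
          using M u assms by (intro mult_left_mono powr_mono2') auto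
        also have "\<dots> = e\<^sup>2 / r" unfolding powr_minus_divide u_pow by simp
        finally show ?thesis using r by (simp add: field_simps)
      qed
      have "e \<le> \<sigma>\<^sup>2 / (4 * sqrt \<kappa>)" by (simp add: e_def)
      hence "e\<^sup>2 \<le> (\<sigma>\<^sup>2 / (4 * sqrt \<kappa>))\<^sup>2" using e by (intro power_mono) auto
      also have "\<dots> = (\<sigma>\<^sup>2)\<^sup>2 / (16 * \<kappa>)" using \<kappa> by (simp add: power_divide power_mult_distrib)
      finally have "16 * \<kappa> * e\<^sup>2 \<le> (\<sigma>\<^sup>2)\<^sup>2" using \<kappa> by (simp add: field_simps)
      moreover have "16 * \<kappa> * (r * a2\<^sup>2) \<le> 16 * \<kappa> * e\<^sup>2"
        using \<open>r * a2\<^sup>2 \<le> e\<^sup>2\<close> \<kappa> by (intro mult_left_mono) auto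
      ultimately have "16 * \<kappa> * (r * a2\<^sup>2) / (\<sigma>\<^sup>2)\<^sup>2 \<le> 1" using K0 by (simp add: field_simps)
      moreover have "real n * (16 * (a\<^sup>2 / \<sigma>\<^sup>2)\<^sup>2 * (\<kappa> * m\<^sup>2)) = 16 * \<kappa> * (r * a2\<^sup>2) / (\<sigma>\<^sup>2)\<^sup>2"
        by (simp add: r_def a2 power_divide)
      ultimately show "real n * (16 * (a\<^sup>2 / \<sigma>\<^sup>2)\<^sup>2 * (\<kappa> * m\<^sup>2)) \<le> 1" by simp
      show "trig_model P \<sigma> (Suc M) (\<lambda>k. if k \<in> V then a else 0) \<in> model_class k Q q \<beta> R m"
        if V: "V \<subseteq> {1..M}" for V
      \<comment> \<open>F is the highest angular frequency; its power M^\<beta> cancels against the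
        total weight of at most e M^(-\<beta>).\<close>
      proof (rule trig_model_in_class[OF P assms(1,2) K0(2), where F="2 * pi * real M"])
        have "(\<Sum>k<Suc M. (if k \<in> V then a else 0)\<^sup>2) = (\<Sum>k\<in>V. a2)"
          using V by (intro sum.mono_neutral_cong_right) (auto simp: a2)
        also have "\<dots> \<le> real M * a2"
          using card_mono[OF _ V] a2 by (simp add: mult_right_mono)
        finally have w: "(\<Sum>k<Suc M. (if k \<in> V then a else 0)\<^sup>2) \<le> e * real M powr (- \<beta>)"
          by (simp only: Ma2)
        have "real M powr (- \<beta>) \<le> 1" using M1 assms by (simp add: powr_minus_divide ge_one_powr_ge_zero)
        hence "e * real M powr (- \<beta>) \<le> e" using e by (simp add: mult_left_le)
        also have "\<dots> \<le> K0\<^sup>2 / 4" by (simp add: e_def)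
        finally show "4 * (\<Sum>k<Suc M. (if k \<in> V then a else 0)\<^sup>2) \<le> (mom_const k)\<^sup>2"
          using w by (simp add: K0_def)
        show "2 * \<sigma> \<le> mom_const k" by (simp add: \<sigma>_def K0_def)
        have "1 * 1 \<le> 2 * pi * real M" using pi_gt3 M1 by (intro mult_mono) auto
        thus "1 \<le> 2 * pi * real M" by simp
        show "2 * pi * real k \<le> 2 * pi * real M" if "k < Suc M" for k
          using that by simp
        have "7 * (2 * pi * real M) powr \<beta> * (\<Sum>k<Suc M. (if k \<in> V then a else 0)\<^sup>2) \<le>
            7 * (2 * pi * real M) powr \<beta> * (e * real M powr (- \<beta>))"
          by (intro mult_left_mono w) auto
        also have "\<dots> = 7 * (2 * pi) powr \<beta> * e * (real M powr \<beta> * real M powr (- \<beta>))"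
          by (simp add: powr_mult)
        also have "real M powr \<beta> * real M powr (- \<beta>) = 1"
          using M1 by (simp add: powr_add[symmetric])
        also have "7 * (2 * pi) powr \<beta> * e * 1 \<le> 7 * (2 * pi) powr \<beta> * (R / (7 * (2 * pi) powr \<beta>))"
          unfolding mult_1_right by (intro mult_left_mono) (auto simp: e_def)
        also have "\<dots> = R" by simp
        finally show "7 * (2 * pi * real M) powr \<beta> * (\<Sum>k<Suc M. (if k \<in> V then a else 0)\<^sup>2) \<le> R" .
      qed
    qed (rule M1)
    have "c1 * r powr (- ((2 * \<beta> + 1) / (2 * \<beta> + 2))) = e\<^sup>2 / 32 * (2 * u) powr (- (2 * \<beta> + 1))"
      using u by (simp add: c1_def powr_mult u_pow(2)[symmetric])
    also have "\<dots> \<le> e\<^sup>2 / 32 * real M powr (- (2 * \<beta> + 1))"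
      using M M1 assms by (intro mult_left_mono powr_mono2') auto
    also have "\<dots> = real M * a ^ 4 / 32"
    proof -
      have "real M * a ^ 4 = e\<^sup>2 * (real M powr 1 * real M powr (- (2 * \<beta> + 2)))"
      proof -
        have "a ^ 4 = a2\<^sup>2" using a2(2) by (metis mult_2 power_even_eq numeral_Bit0 power_mult power2_eq_square power4_eq_xxxx mult.assoc)
        also note a22
        finally show ?thesis using M1 by simp
      qed
      also have "real M powr 1 * real M powr (- (2 * \<beta> + 2)) = real M powr (- (2 * \<beta> + 1))"
      proof -
        have "1 + - (2 * \<beta> + 2) = - (2 * \<beta> + 1)" by simp
        thus ?thesis by (simp only: powr_add[symmetric])
      qed
      finally show ?thesis by simp
    qed
    finally have l1: "ennreal (c1 * r powr (- ((2 * \<beta> + 1) / (2 * \<beta> + 2)))) \<le> S"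
      using 1 by (meson ennreal_leI order_trans)
    define \<delta> where "\<delta> = 1 / (2 * sqrt (real n))"
    have "1 \<le> sqrt (real n)" using n by simp
    hence \<delta>: "0 \<le> \<delta>" "\<delta> \<le> 1/2" by (auto simp: \<delta>_def field_simps)
    have mem: "trig_model P \<sigma> 1 (\<lambda>_. b) \<in> model_class k Q q \<beta> R m" if b: "b\<^sup>2 \<le> 3 / 2 * B" for b
    \<comment> \<open>Only frequency 0 occurs, so the smallest admissible F is available.\<close>
    proof (rule trig_model_in_class[OF P assms(1,2) K0(2), where F=1])
      have "B \<le> K0\<^sup>2 / 6" "B \<le> 2 * R / 21" by (simp_all add: B_def)
      thus "4 * (\<Sum>k<(1::nat). b\<^sup>2) \<le> (mom_const k)\<^sup>2" "7 * 1 powr \<beta> * (\<Sum>k<(1::nat). b\<^sup>2) \<le> R"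
        using b by (simp_all add: K0_def)
      show "2 * \<sigma> \<le> mom_const k" by (simp add: \<sigma>_def K0_def)
    qed auto
    have "ennreal (B\<^sup>2 / 64 / real n) \<le> S"
      unfolding S_def
    proof (rule parametric_bound[OF des K0(2) n est \<delta>_def _ refl, where b="sqrt B"])
      show "(sqrt B)\<^sup>2 = B" using B by simp
      show "trig_model P \<sigma> 1 (\<lambda>_. sqrt B) \<in> model_class k Q q \<beta> R m"
        using B by (intro mem) simp
      have "(1 + \<delta>) * B \<le> 3 / 2 * B" using \<delta> B by (intro mult_right_mono) auto
      thus "trig_model P \<sigma> 1 (\<lambda>_. sqrt (1 + \<delta>) * sqrt B) \<in> model_class k Q q \<beta> R m"
        using B \<delta> by (intro mem) (simp add: power_mult_distrib)
    qed
    hence l2: "ennreal (c2 * (1 / real n)) \<le> S" by (simp add: c2_def)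
    let ?r = "r powr (- ((2 * \<beta> + 1) / (2 * \<beta> + 2)))"
    have "c * (?r + 1 / real n) \<le> max (c1 * ?r) (c2 * (1 / real n))"
    proof -
      have "min c1 c2 * ?r \<le> c1 * ?r" "min c1 c2 * (1 / real n) \<le> c2 * (1 / real n)"
        by (intro mult_right_mono; simp)+
      thus ?thesis unfolding c_def by (simp add: distrib_left max_def)
    qed
    hence "ennreal (c * (?r + 1 / real n)) \<le> ennreal (max (c1 * ?r) (c2 * (1 / real n)))"
      by (rule ennreal_leI)
    also have "\<dots> \<le> S" using l1 l2 unfolding max_def by presburger
    finally show "ennreal (c * ((real n * m\<^sup>2) powr (- ((2 * \<beta> + 1) / (2 * \<beta> + 2))) + 1 / real n)) \<le>
      (SUP Q\<in>model_class k Q q \<beta> R m. risk Q n est)"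
      by (simp add: r_def S_def)
  qed
  ultimately show ?thesis by blast
qed

end
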